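(* Consider the linear Bayesian bandit with horizon $n$, action set $\{\mathbf a_1,\dots,\mathbf a_K\}\subset\mathbb R^d$ and environment $\boldsymbol\nu\in\mathbb R^d$, in which pulling action $A^i$ at round $i$ gives the reward $X^i=\langle A^i,\boldsymbol\nu\rangle+\eta^i$, where $(\eta^i)_{i=1}^n$ are i.i.d. $\mathcal N(0,\sigma^2(n))$ with $\sigma(n)$ given, and the prior of $\boldsymbol\nu$ is $\mathcal N(\boldsymbol\alpha(n),\Sigma(n))$. Let $w^i(\mathbf s,\mathbf q)$ be its optimal expected cumulative reward from round $i$ (defined in the context). Let $f(n)>0$ be a scaling factor such that there exist a vector $\hat{\boldsymbol\alpha}\in\mathbb R^d$, an invertible matrix $\hat\Sigma\in\mathbb R^{d\times d}$ and a real number $\hat\sigma$ with $$\lim_{n\to\infty}\frac{\sigma^2(n)}{n}\Sigma^{-1}(n)=\hat\Sigma^{-1},\qquad \lim_{n\to\infty}\frac{\sigma^2(n)}{f(n)}\Sigma^{-1}(n)\boldsymbol\alpha(n)=\hat{\boldsymbol\alpha},\qquad \lim_{n\to\infty}\frac{\sqrt n}{f(n)}\sigma(n)=\hat\sigma .$$ Then, as $n\to\infty$, the rescaled Bayesian bandit problem with scaling factor $f(n)$ converges (in the sense defined in the context) to the HJB equation $$\partial_t v+\max_{\hat{\boldsymbol\pi}\in\Delta^K}\sum_{k=1}^K\Big(\partial_{\hat q_k}v+\hat\mu(\hat{\mathbf s},\hat{\mathbf q},\mathbf a_k)\,\partial_{\hat s_k}v+\tfrac12\hat\sigma^2\,\partial_{\hat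 s_k}^2v+\hat\mu(\hat{\mathbf s},\hat{\mathbf q},\mathbf a_k)\Big)\hat\pi_k=0,\qquad v(1,\hat{\mathbf s},\hat{\mathbf q})=0,$$ where, for $\mathbf b\in\mathbb R^d$, $$\hat\mu(\mathbf s,\mathbf q,\mathbf b)=\mathbf b^\top\Big(\hat\Sigma^{-1}+\sum_{k=1}^Kq_k\mathbf a_k\mathbf a_k^\top\Big)^{-1}\Big(\hat{\boldsymbol\alpha}+\sum_{k=1}^Ks_k\mathbf a_k\Big)$$ and the diffusion coefficient is the constant $\hat\sigma$.
   Context: $K,d\ge1$ are fixed, $n\in\mathbb Z_+$ is the horizon (number of rounds), $\sigma(n)>0$, $\boldsymbol\alpha(n)\in\mathbb R^d$, $\Sigma(n)\in\mathbb R^{d\times d}$ is symmetric positive definite, $\mathbf e_k$ is the $k$-th standard basis vector of $\mathbb R^K$, and $\Delta^K=\{\pi\in[0,1]^K:\sum_k\pi_k=1\}$. Arm $k$ means action $\mathbf a_k$. Bayesian bandit. In each round $i=1,\dots,n$ one arm is pulled and its reward is observed. The state at the beginning of round $i$ is $(\mathbf s,\mathbf q)$, where $s_k$ is the cumulative reward from arm $k$ and $q_k\in\{0,\dots,i-1\}$ the number of pulls of arm $k$ in rounds $1,\dots,i-1$. Given $(\mathbf s,\mathbf q)$, the posterior $\rho(\boldsymbol\nu|\mathbf s,\mathbf q)$ is the normal law with covariance $\Sigma'=(\Sigma^{-1}+\sigma^{-2}\sum_kq_k\mathbf a_k\mathbf a_k^\top)^{-1}$ and mean $\Sigma'(\Sigma^{-1}\boldsymbol\alpha+\sigma^{-2}\sum_ks_k\mathbf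 a_k)$. The goal is to maximize the total expected reward, each reward being averaged over the current posterior. The optimal expected cumulative reward $w^i(\mathbf s,\mathbf q)$ collected in rounds $i,\dots,n$ starting from state $(\mathbf s,\mathbf q)$ satisfies $w^{n+1}\equiv0$ and $$w^i(\mathbf s,\mathbf q)=\max_{1\le k\le K}\Big\{\int\mu_k(\boldsymbol\nu)\rho(\boldsymbol\nu|\mathbf s,\mathbf q)d\boldsymbol\nu+\int\mathbb E_{X\sim P_k^{\boldsymbol\nu}}\big[w^{i+1}(\mathbf s+X\mathbf e_k,\mathbf q+\mathbf e_k)\big]\rho(\boldsymbol\nu|\mathbf s,\mathbf q)d\boldsymbol\nu\Big\},$$ where $P^{\boldsymbol\nu}_k=\mathcal N(\langle\mathbf a_k,\boldsymbol\nu\rangle,\sigma^2)$ is the reward law of arm $k$ and $\mu_k(\boldsymbol\nu)=\langle\mathbf a_k,\boldsymbol\nu\rangle$ its mean. Admissible states at round $i$ are those with $q_k\in\{0,\dots,i-1\}$, and $s_k\in\mathbb R$ with $s_k=0$ if $q_k=0$. Convergence. "The rescaled Bayesian bandit problem with scaling factor $f(n)$ converges to the HJB equation" means: there is a function $v$ on $[0,1]\times\mathbb R^K\times[0,1]^K$ that is a viscosity solution of the HJB equation in $(0,1)\times\mathbb R^K\times(0,1)^K$ with $v(1,\cdot,\cdot)=0$, such that $\frac1{f(n)}w^{i_n}(\mathbf s_n,\mathbf q_n)\to v(t,\hat{\mathbf s},\hat{\mathbf q})$ as $n\to\infty$ for every $(t,\hat{\mathbf s},\hat{\mathbf q})\in[0,1]\times\mathbb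 R^K\times[0,1]^K$ and every sequence of rounds $i_n\in\{1,\dots,n+1\}$ and admissible states $(\mathbf s_n,\mathbf q_n)$ at round $i_n$ with $\big(\frac{i_n-1}{n},\frac{\mathbf s_n}{f(n)},\frac{\mathbf q_n}{n}\big)\to(t,\hat{\mathbf s},\hat{\mathbf q})$. *)

theory Defs
  imports "HOL-Probability.Probability"
begin

definition sym_pos_def :: "real^'d^'d \<Rightarrow> bool" where
  "sym_pos_def S \<longleftrightarrow> transpose S = S \<and> (\<forall>x. x \<noteq> 0 \<longrightarrow> 0 < x \<bullet> (S *v x))"

definition mvn_density :: "real^'d \<Rightarrow> real^'d^'d \<Rightarrow> real^'d \<Rightarrow> real" where
  "mvn_density m S x =
     exp (- ((x - m) \<bullet> (matrix_inv S *v (x - m))) / 2) / sqrt ((2 * pi) ^ CARD('d) * det S)"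

definition mvn :: "real^'d \<Rightarrow> real^'d^'d \<Rightarrow> (real^'d) measure" where
  "mvn m S = density lborel (\<lambda>x. ennreal (mvn_density m S x))"

text \<open>The one-dimensional normal law with mean \<open>m\<close> and standard deviation \<open>s\<close>
  (variance \<open>s\<^sup>2\<close>).\<close>

definition normal_law :: "real \<Rightarrow> real \<Rightarrow> real measure" where
  "normal_law m s = density lborel (\<lambda>x. ennreal (normal_density m s x))"

definition outer :: "real^'d \<Rightarrow> real^'d^'d" where
  "outer b = (\<chi> i j. b $ i * b $ j)"

text \<open>Arms are indexed by the finite type \<open>'k\<close>; arm \<open>k\<close> is the action \<open>a k\<close>. In a state
  \<open>(s, q)\<close>, \<open>s $ k\<close> is the cumulative reward of arm \<open>k\<close> and \<open>q $ k\<close> its number of pulls.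
  The parameter \<open>\<sigma>\<close> is the standard deviation of the noise, and the prior is
  \<open>mvn \<alpha> \<Sigma>\<close>.\<close>

definition posterior_cov ::
  "('k::finite \<Rightarrow> real^'d) \<Rightarrow> real \<Rightarrow> real^'d^'d \<Rightarrow> nat^'k \<Rightarrow> real^'d^'d" where
  "posterior_cov a \<sigma> \<Sigma> q =
     matrix_inv (matrix_inv \<Sigma> + (1 / \<sigma>\<^sup>2) *\<^sub>R (\<Sum>k\<in>UNIV. real (q $ k) *\<^sub>R outer (a k)))"

definition posterior_mean ::
  "('k::finite \<Rightarrow> real^'d) \<Rightarrow> real \<Rightarrow> real^'d \<Rightarrow> real^'d^'d \<Rightarrow> real^'k \<Rightarrow> nat^'k \<Rightarrow> real^'d" where
  "posterior_mean a \<sigma> \<alpha> \<Sigma> s q =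
     posterior_cov a \<sigma> \<Sigma> q *v (matrix_inv \<Sigma> *v \<alpha> + (1 / \<sigma>\<^sup>2) *\<^sub>R (\<Sum>k\<in>UNIV. s $ k *\<^sub>R a k))"

definition posterior ::
  "('k::finite \<Rightarrow> real^'d) \<Rightarrow> real \<Rightarrow> real^'d \<Rightarrow> real^'d^'d \<Rightarrow> real^'k \<Rightarrow> nat^'k \<Rightarrow> (real^'d) measure" where
  "posterior a \<sigma> \<alpha> \<Sigma> s q = mvn (posterior_mean a \<sigma> \<alpha> \<Sigma> s q) (posterior_cov a \<sigma> \<Sigma> q)"

text \<open>\<open>opt_reward a \<sigma> \<alpha> \<Sigma> n i s q\<close> is the optimal expected reward collected in rounds
  \<open>i, \<dots>, n\<close> from the state \<open>(s, q)\<close>, given by the Bellman recursion. The recursion makes sense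
  at every \<open>(s, q)\<close> and leads from admissible states to admissible states only.\<close>

function opt_reward ::
  "('k::finite \<Rightarrow> real^'d) \<Rightarrow> real \<Rightarrow> real^'d \<Rightarrow> real^'d^'d \<Rightarrow> nat \<Rightarrow> nat \<Rightarrow> real^'k \<Rightarrow> nat^'k \<Rightarrow> real" where
  "opt_reward a \<sigma> \<alpha> \<Sigma> n i s q =
     (if i > n then 0
      else Max (range (\<lambda>k.
        (\<integral>\<nu>. a k \<bullet> \<nu> \<partial>posterior a \<sigma> \<alpha> \<Sigma> s q) +
        (\<integral>\<nu>. (\<integral>x. opt_reward a \<sigma> \<alpha> \<Sigma> n (Suc i) (s + x *\<^sub>R axis k 1) (q + axis k 1)
                 \<partial>normal_law (a k \<bullet> \<nu>) \<sigma>)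
            \<partial>posterior a \<sigma> \<alpha> \<Sigma> s q))))"
  by pat_completeness auto
termination
  by (relation "Wellfounded.measure (\<lambda>(a, \<sigma>, \<alpha>, \<Sigma>, n, i, s, q). Suc n - i)") auto

declare opt_reward.simps [simp del]

definition admissible_state :: "nat \<Rightarrow> real^'k \<Rightarrow> nat^'k \<Rightarrow> bool" where
  "admissible_state i s q \<longleftrightarrow> (\<forall>k. q $ k \<in> {0..i - 1} \<and> (q $ k = 0 \<longrightarrow> s $ k = 0))"

text \<open>\<open>C2_on \<Omega> \<phi> g H\<close>: \<open>\<phi>\<close> is twice continuously differentiable on the open set \<open>\<Omega>\<close>, with
  gradient \<open>g\<close> and Hessian \<open>H\<close> (as a bounded linear map).\<close>

definition C2_on ::
  "'a::euclidean_space set \<Rightarrow> ('a \<Rightarrow> real) \<Rightarrow> ('a \<Rightarrow> 'a) \<Rightarrow> ('a \<Rightarrow> 'a \<Rightarrow>\<^sub>L 'a) \<Rightarrow> bool" where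
  "C2_on \<Omega> \<phi> g H \<longleftrightarrow>
     (\<forall>z\<in>\<Omega>. (\<phi> has_derivative (\<lambda>h. g z \<bullet> h)) (at z) \<and>
             (g has_derivative blinfun_apply (H z)) (at z)) \<and>
     continuous_on \<Omega> H"

definition local_max_at :: "('a::topological_space \<Rightarrow> real) \<Rightarrow> 'a \<Rightarrow> bool" where
  "local_max_at u z \<longleftrightarrow> (\<forall>\<^sub>F y in nhds z. u y \<le> u z)"

definition local_min_at :: "('a::topological_space \<Rightarrow> real) \<Rightarrow> 'a \<Rightarrow> bool" where
  "local_min_at u z \<longleftrightarrow> (\<forall>\<^sub>F y in nhds z. u z \<le> u y)"

text \<open>The equation is \<open>F (z, Du(z), D\<^sup>2u(z)) = 0\<close> in the open set \<open>\<Omega>\<close>, with the sign convention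
  that \<open>F\<close> is nonincreasing in the Hessian (degenerate elliptic).\<close>

definition viscosity_subsolution ::
  "'a::euclidean_space set \<Rightarrow> ('a \<Rightarrow> 'a \<Rightarrow> ('a \<Rightarrow>\<^sub>L 'a) \<Rightarrow> real) \<Rightarrow> ('a \<Rightarrow> real) \<Rightarrow> bool" where
  "viscosity_subsolution \<Omega> F u \<longleftrightarrow>
     (\<forall>\<phi> g H z. C2_on \<Omega> \<phi> g H \<longrightarrow> z \<in> \<Omega> \<longrightarrow> local_max_at (\<lambda>y. u y - \<phi> y) z \<longrightarrow>
        F z (g z) (H z) \<le> 0)"

definition viscosity_supersolution ::
  "'a::euclidean_space set \<Rightarrow> ('a \<Rightarrow> 'a \<Rightarrow> ('a \<Rightarrow>\<^sub>L 'a) \<Rightarrow> real) \<Rightarrow> ('a \<Rightarrow> real) \<Rightarrow> bool" where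
  "viscosity_supersolution \<Omega> F u \<longleftrightarrow>
     (\<forall>\<phi> g H z. C2_on \<Omega> \<phi> g H \<longrightarrow> z \<in> \<Omega> \<longrightarrow> local_min_at (\<lambda>y. u y - \<phi> y) z \<longrightarrow>
        F z (g z) (H z) \<ge> 0)"

definition viscosity_solution ::
  "'a::euclidean_space set \<Rightarrow> ('a \<Rightarrow> 'a \<Rightarrow> ('a \<Rightarrow>\<^sub>L 'a) \<Rightarrow> real) \<Rightarrow> ('a \<Rightarrow> real) \<Rightarrow> bool" where
  "viscosity_solution \<Omega> F u \<longleftrightarrow>
     continuous_on \<Omega> u \<and> viscosity_subsolution \<Omega> F u \<and> viscosity_supersolution \<Omega> F u"

definition prob_simplex :: "(real^'k) set" where
  "prob_simplex = {\<pi>. (\<forall>k. \<pi> $ k \<in> {0..1}) \<and> (\<Sum>k\<in>UNIV. \<pi> $ k) = 1}"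

definition mu_hat ::
  "('k::finite \<Rightarrow> real^'d) \<Rightarrow> real^'d \<Rightarrow> real^'d^'d \<Rightarrow> real^'k \<Rightarrow> real^'k \<Rightarrow> real^'d \<Rightarrow> real" where
  "mu_hat a \<alpha>h \<Sigma>h s q b =
     b \<bullet> (matrix_inv (matrix_inv \<Sigma>h + (\<Sum>k\<in>UNIV. q $ k *\<^sub>R outer (a k))) *v
          (\<alpha>h + (\<Sum>k\<in>UNIV. s $ k *\<^sub>R a k)))"

type_synonym 'k hjb_point = "real \<times> (real^'k) \<times> (real^'k)"

text \<open>Points are \<open>z = (t, s, q)\<close> and gradients \<open>(p\<^sub>t, p\<^sub>s, p\<^sub>q)\<close>; the second derivative in \<open>s $ k\<close>
  is the corresponding diagonal entry of the Hessian \<open>X\<close>. The left-hand side of the HJB equation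
  is nondecreasing in \<open>X\<close>, hence the minus sign. The supremum over the compact simplex is
  attained.\<close>

definition hjb_operator ::
  "('k::finite \<Rightarrow> real^'d) \<Rightarrow> real^'d \<Rightarrow> real^'d^'d \<Rightarrow> real \<Rightarrow>
   'k hjb_point \<Rightarrow> 'k hjb_point \<Rightarrow>
   ('k hjb_point \<Rightarrow>\<^sub>L 'k hjb_point) \<Rightarrow> real" where
  "hjb_operator a \<alpha>h \<Sigma>h \<sigma>h = (\<lambda>(t, s, q) (pt, ps, pq) X.
     - (pt + (SUP \<pi>\<in>prob_simplex. \<Sum>k\<in>UNIV.
          (pq $ k + mu_hat a \<alpha>h \<Sigma>h s q (a k) * ps $ k
             + 1 / 2 * \<sigma>h\<^sup>2 * ((0, axis k 1, 0) \<bullet> blinfun_apply X (0, axis k 1, 0))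
             + mu_hat a \<alpha>h \<Sigma>h s q (a k)) * \<pi> $ k)))"

definition hjb_domain :: "('k::finite) hjb_point set" where
  "hjb_domain = {0<..<1} \<times> UNIV \<times> {q. \<forall>k. q $ k \<in> {0<..<1}}"

text \<open>Convergence, with scaling factor \<open>f\<close>, of the bandits with horizon \<open>n\<close>, noise level \<open>\<sigma> n\<close> and
  prior \<open>mvn (\<alpha> n) (\<Sigma> n)\<close> to the equation \<open>F = 0\<close>. Only the horizons \<open>n \<ge> 1\<close> matter, and only
  the values of \<open>v\<close> for \<open>t\<close> and \<open>q $ k\<close> in \<open>{0..1}\<close>.\<close>

definition rescaled_bandit_converges ::
  "('k::finite \<Rightarrow> real^'d) \<Rightarrow> (nat \<Rightarrow> real) \<Rightarrow> (nat \<Rightarrow> real^'d) \<Rightarrow> (nat \<Rightarrow> real^'d^'d) \<Rightarrow> (nat \<Rightarrow> real) \<Rightarrow>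
   ('k hjb_point \<Rightarrow> 'k hjb_point \<Rightarrow>
    ('k hjb_point \<Rightarrow>\<^sub>L 'k hjb_point) \<Rightarrow> real) \<Rightarrow> bool" where
  "rescaled_bandit_converges a \<sigma> \<alpha> \<Sigma> f F \<longleftrightarrow>
     (\<exists>v. viscosity_solution hjb_domain F v \<and>
          (\<forall>s q. (\<forall>k. q $ k \<in> {0..1}) \<longrightarrow> v (1, s, q) = 0) \<and>
          (\<forall>t s q (i :: nat \<Rightarrow> nat) (sn :: nat \<Rightarrow> real^'k) (qn :: nat \<Rightarrow> nat^'k).
             t \<in> {0..1} \<longrightarrow> (\<forall>k. q $ k \<in> {0..1}) \<longrightarrow>
             (\<forall>n\<ge>1. i n \<in> {1..n + 1} \<and> admissible_state (i n) (sn n) (qn n)) \<longrightarrow>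
             (\<lambda>n. (real (i n) - 1) / real n) \<longlonglongrightarrow> t \<longrightarrow>
             (\<lambda>n. (1 / f n) *\<^sub>R sn n) \<longlonglongrightarrow> s \<longrightarrow>
             (\<lambda>n. \<chi> k. real (qn n $ k) / real n) \<longlonglongrightarrow> q \<longrightarrow>
             (\<lambda>n. 1 / f n * opt_reward a (\<sigma> n) (\<alpha> n) (\<Sigma> n) n (i n) (sn n) (qn n))
               \<longlonglongrightarrow> v (t, s, q)))"

end

theory Submission imports Defs begin

text \<open>
  In the posterior predictive law, pulling an arm \<open>m\<close> adds a Gaussian increment to its cumulative
  reward. In the rescaled variables the Bellman recursion with horizon \<open>n\<close> is therefore a monotone
  scheme with time step \<open>1 / n\<close>, whose coefficients converge and do not depend on the round. Its
  solutions are Lipschitz in all variables, uniformly in \<open>n\<close> up to a weight \<open>1 + \<bar>s\<bar>\<^sup>2\<close>.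

  No comparison principle for viscosity solutions is needed for convergence. The solution for a horizon
  \<open>N\<close> satisfies \<open>u \<ge> L u\<close> for the linear one-step operator \<open>L\<close> of every single arm. Since the limit
  diffusion coefficient is constant and the drift is Lipschitz, mollifying \<open>u\<close> in time, \<open>s\<close> and \<open>q\<close>
  preserves these inequalities up to a small error (Krylov's method). The mollified function is smooth,
  hence by Taylor expansion an approximate supersolution of the scheme of any other large horizon \<open>n\<close>,
  and the solution for \<open>n\<close> lies below the one for \<open>N\<close> up to a small error. The roles of \<open>n\<close> and \<open>N\<close>
  are symmetric, so the solutions form a Cauchy sequence. That the limit is a viscosity solution follows
  from monotonicity and consistency, as in the theorem of Barles and Souganidis.
\<close>

subsection \<open>Linear images of Gaussian vectors\<close>

text \<open>Only first-order bounds on the value functions are uniform in the horizon, and this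
  shapes the argument. Evaluating a diffusion coefficient at distance \<open>e\<close> from the
  right point would in general cost \<open>e / sqrt n\<close> per step, hence
  \<open>e * sqrt n\<close> over the horizon. Here the coefficient varies only through the posterior
  variance, which is of relative order \<open>1 / n\<close>, so the cost is at most of order
  \<open>e / n\<close> per step. Averaging preserves the linear inequalities
  \<open>u \<ge> L u\<close>, hence supersolutions for the maximum over arms, but not subsolutions.
  The lower bound therefore has to come from exchanging the two horizons rather than from a second
  mollification. The state is unbounded. Values and the Lipschitz constants in \<open>q\<close> grow
  like \<open>wt s\<close>, a weight quadratic in \<open>s\<close>; so do the derivatives of
  mollified functions, and the moments of a single step contribute two more factors. This is why
  horizons are compared in the weight \<open>wt s ^ 3\<close>. The mollification radius is fixed
  before the horizons become large, because the Taylor constants of the mollified functions depend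
  on it.\<close>

lemma prod_Basis_cart:
  fixes g :: "real^'n \<Rightarrow> 'a::comm_monoid_mult"
  shows "(\<Prod>b\<in>Basis. g b) = (\<Prod>i\<in>UNIV. g (axis i 1))"
proof -
  have B: "(Basis :: (real^'n) set) = range (\<lambda>i. axis i 1)" by (auto simp: Basis_vec_def)
  have "inj (\<lambda>i::'n. axis i 1 :: real^'n)" by (auto simp: inj_def axis_eq_axis)
  then show ?thesis unfolding B by (subst prod.reindex) (auto simp: o_def)
qed

text \<open>Integrating over coordinate \<open>m\<close> innermost, with the other coordinates
  frozen, turns the shear into a translation by the constant \<open>c * x $ n\<close>, since
  \<open>m \<noteq> n\<close>; Lebesgue measure on the line is translation invariant.\<close>

lemma nn_integral_lborel_shear:
  fixes f :: "real^'n \<Rightarrow> ennreal" and c :: real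
  assumes "m \<noteq> n" and f[measurable]: "f \<in> borel_measurable borel"
  shows "(\<integral>\<^sup>+x. f (x + (c * x $ n) *\<^sub>R axis m 1) \<partial>lborel) = (\<integral>\<^sup>+x. f x \<partial>lborel)"
proof -
  let ?B = "Basis :: (real^'n) set"
  let ?m = "axis m (1::real) :: real^'n" and ?n = "axis n (1::real) :: real^'n"
  let ?v = "\<lambda>w :: real^'n \<Rightarrow> real. \<Sum>b\<in>?B. w b *\<^sub>R b"
  let ?I = "?B - {?m}"
  interpret product_sigma_finite "\<lambda>_::real^'n. lborel :: real measure" ..
  have B: "?m \<in> ?B" "?n \<in> ?B" "?n \<noteq> ?m" using \<open>m \<noteq> n\<close> by (auto simp: axis_eq_axis)
  have BI: "?B = insert ?m ?I" using B by auto
  have v_n: "?v w $ n = w ?n" for w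
  proof -
    have "?v w $ n = ?v w \<bullet> ?n" by (simp add: inner_axis)
    also have "\<dots> = w ?n" using B by (simp add: inner_sum_left inner_Basis if_distrib cong: if_cong)
    finally show ?thesis .
  qed
  have v_shift: "?v (w(?m := y)) + t *\<^sub>R ?m = ?v (w(?m := y + t))" for w y t
  proof -
    have "?v (w(?m := y)) = y *\<^sub>R ?m + (\<Sum>b\<in>?I. w b *\<^sub>R b)" for y
      using B by (subst sum.remove[of _ ?m]) (auto intro!: sum.cong)
    then show ?thesis by (simp add: algebra_simps)
  qed
  have [measurable]: "?v \<in> borel_measurable (\<Pi>\<^sub>M b\<in>?B. lborel)" by measurable
  have [measurable]: "(\<lambda>w. w ?n) \<in> borel_measurable (\<Pi>\<^sub>M b\<in>?B. lborel :: real measure)"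
    using B(2) by measurable
  have g[measurable]: "(\<lambda>w. f (?v w + (c * w ?n) *\<^sub>R ?m)) \<in> borel_measurable (\<Pi>\<^sub>M b\<in>?B. lborel)"
    by measurable
  have fv[measurable]: "(\<lambda>w. f (?v w)) \<in> borel_measurable (\<Pi>\<^sub>M b\<in>?B. lborel)"
    by measurable
  have "(\<integral>\<^sup>+x. f (x + (c * x $ n) *\<^sub>R axis m 1) \<partial>lborel)
     = (\<integral>\<^sup>+w. f (?v w + (c * ?v w $ n) *\<^sub>R ?m) \<partial>(\<Pi>\<^sub>M b\<in>?B. lborel))"
    by (subst lborel_eq) (subst nn_integral_distr, auto)
  also have "\<dots> = (\<integral>\<^sup>+w. f (?v w + (c * w ?n) *\<^sub>R ?m) \<partial>(\<Pi>\<^sub>M b\<in>?B. lborel))"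
    by (simp only: v_n)
  also have "\<dots> = (\<integral>\<^sup>+w. (\<integral>\<^sup>+y. f (?v (w(?m := y)) + (c * (w(?m := y)) ?n) *\<^sub>R ?m) \<partial>lborel) \<partial>(\<Pi>\<^sub>M b\<in>?I. lborel))"
    using g by (subst BI, subst product_nn_integral_insert) (auto simp: insert_absorb B)
  also have "\<dots> = (\<integral>\<^sup>+w. (\<integral>\<^sup>+y. f (?v (w(?m := y))) \<partial>lborel) \<partial>(\<Pi>\<^sub>M b\<in>?I. lborel))"
  proof (rule nn_integral_cong)
    fix w assume w: "w \<in> space (\<Pi>\<^sub>M b\<in>?I. lborel :: real measure)"
    have m[measurable]: "(\<lambda>y. f (?v (w(?m := y)))) \<in> borel_measurable lborel"
      by simp
    have "(\<integral>\<^sup>+y. f (?v (w(?m := y)) + (c * (w(?m := y)) ?n) *\<^sub>R ?m) \<partial>lborel)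
        = (\<integral>\<^sup>+y. f (?v (w(?m := c * w ?n + y))) \<partial>lborel)"
      using B(3) by (subst v_shift) (simp add: add.commute)
    also have "\<dots> = (\<integral>\<^sup>+y. f (?v (w(?m := y))) \<partial>distr lborel borel ((+) (c * w ?n)))"
      by (subst nn_integral_distr) auto
    finally show "(\<integral>\<^sup>+y. f (?v (w(?m := y)) + (c * (w(?m := y)) ?n) *\<^sub>R ?m) \<partial>lborel)
        = (\<integral>\<^sup>+y. f (?v (w(?m := y))) \<partial>lborel)" by (simp add: lborel_distr_plus)
  qed
  also have "\<dots> = (\<integral>\<^sup>+w. f (?v w) \<partial>(\<Pi>\<^sub>M b\<in>?B. lborel))"
    using fv by (subst (2) BI, subst product_nn_integral_insert) (auto simp: insert_absorb B)
  also have "\<dots> = (\<integral>\<^sup>+x. f x \<partial>lborel)"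
    by (subst (2) lborel_eq) (subst nn_integral_distr, auto)
  finally show ?thesis .
qed

text \<open>A permutation of coordinates maps boxes to boxes and permutes their side lengths, and
  the volumes of boxes determine Lebesgue measure.\<close>

lemma nn_integral_lborel_transpose:
  fixes f :: "real^'n \<Rightarrow> ennreal"
  assumes f[measurable]: "f \<in> borel_measurable borel"
  shows "(\<integral>\<^sup>+x. f (\<chi> i. x $ Transposition.transpose m n i) \<partial>lborel) = (\<integral>\<^sup>+x. f x \<partial>lborel)"
proof -
  let ?p = "Transposition.transpose m n"
  let ?T = "\<lambda>x :: real^'n. \<chi> i. x $ ?p i"
  have T[measurable]: "?T \<in> borel \<rightarrow>\<^sub>M borel"
    by (intro borel_measurable_continuous_onI continuous_intros)
  have "lborel = distr lborel borel ?T"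
  proof (rule lborel_eqI)
    fix l u :: "real^'n" assume le: "\<And>b. b \<in> Basis \<Longrightarrow> l \<bullet> b \<le> u \<bullet> b"
    have le': "l $ i \<le> u $ i" for i using le[of "axis i 1"] by (simp add: inner_axis)
    have vi: "?T -` box l u = box (?T l) (?T u)"
    proof (auto simp: mem_box_cart)
      fix x :: "real^'n" and i
      assume *: "\<forall>i. l $ i < x $ ?p i \<and> x $ ?p i < u $ i"
      show "l $ ?p i < x $ i" "x $ i < u $ ?p i" using *[rule_format, of "?p i"] by auto
    next
      fix x :: "real^'n" and i
      assume *: "\<forall>i. l $ ?p i < x $ i \<and> x $ i < u $ ?p i"
      show "l $ i < x $ ?p i" "x $ ?p i < u $ i" using *[rule_format, of "?p i"] by auto
    qed
    have "emeasure (distr lborel borel ?T) (box l u) = emeasure lborel (box (?T l) (?T u))"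
      by (subst emeasure_distr) (auto simp: vi)
    also have "\<dots> = ennreal (\<Prod>b\<in>Basis. (?T u - ?T l) \<bullet> b)"
      by (subst emeasure_lborel_box) (auto simp: Basis_vec_def inner_axis le')
    also have "(\<Prod>b\<in>Basis. (?T u - ?T l) \<bullet> b) = (\<Prod>i\<in>UNIV. (u $ ?p i - l $ ?p i))"
      by (simp add: Basis_vec_def axis_eq_axis prod.UNION_disjoint inner_axis)
    also have "\<dots> = (\<Prod>i\<in>UNIV. (u $ i - l $ i))"
      by (rule prod.reindex_bij_betw[of ?p UNIV UNIV "\<lambda>i. u $ i - l $ i"]) simp
    also have "\<dots> = (\<Prod>b\<in>Basis. (u - l) \<bullet> b)"
      by (simp add: Basis_vec_def axis_eq_axis prod.UNION_disjoint inner_axis)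
    finally show "emeasure (distr lborel borel ?T) (box l u) = ennreal (\<Prod>b\<in>Basis. (u - l) \<bullet> b)" .
  qed simp
  then have "(\<integral>\<^sup>+x. f x \<partial>lborel) = (\<integral>\<^sup>+x. f x \<partial>distr lborel borel ?T)" by simp
  then show ?thesis by (simp add: nn_integral_distr)
qed

text \<open>Change of variables by decomposition into elementary matrices; a zero row contradicts
  \<open>det A \<noteq> 0\<close>. The induction predicate \<open>?P\<close> quantifies over
  \<open>f\<close> because the product case applies the hypothesis for the second factor to
  \<open>f\<close> composed with the first.\<close>

lemma nn_integral_lborel_linear:
  fixes A :: "real^'n^'n" and f :: "real^'n \<Rightarrow> ennreal"
  assumes "det A \<noteq> 0" "f \<in> borel_measurable borel"
  shows "(\<integral>\<^sup>+x. f x \<partial>lborel) = ennreal \<bar>det A\<bar> * (\<integral>\<^sup>+x. f (A *v x) \<partial>lborel)"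
proof -
  let ?P = "\<lambda>A :: real^'n^'n. det A \<noteq> 0 \<longrightarrow> (\<forall>f :: real^'n \<Rightarrow> ennreal. f \<in> borel_measurable borel \<longrightarrow>
    (\<integral>\<^sup>+x. f x \<partial>lborel) = ennreal \<bar>det A\<bar> * (\<integral>\<^sup>+x. f (A *v x) \<partial>lborel))"
  have meas: "(*v) A \<in> borel \<rightarrow>\<^sub>M borel" for A :: "real^'n^'n"
    by (intro borel_measurable_continuous_onI matrix_vector_mult_linear_continuous_on)
  have "?P A"
  proof (induction A rule: induct_matrix_elementary)
    case (1 A B)
    show ?case
    proof (intro impI allI)
      fix f :: "real^'n \<Rightarrow> ennreal" assume d: "det (A ** B) \<noteq> 0" and f: "f \<in> borel_measurable borel"
      have [simp]: "det A \<noteq> 0" "det B \<noteq> 0" using d by (auto simp: det_mul)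
      have m: "(\<lambda>x. f (A *v x)) \<in> borel_measurable borel"
        using measurable_compose[OF meas f] .
      have "(\<integral>\<^sup>+x. f x \<partial>lborel) = ennreal \<bar>det A\<bar> * (\<integral>\<^sup>+x. f (A *v x) \<partial>lborel)"
        using 1(1) f by simp
      also have "(\<integral>\<^sup>+x. f (A *v x) \<partial>lborel) = ennreal \<bar>det B\<bar> * (\<integral>\<^sup>+x. f (A *v (B *v x)) \<partial>lborel)"
        using 1(2)[rule_format, OF _ m] by simp
      finally show "(\<integral>\<^sup>+x. f x \<partial>lborel) = ennreal \<bar>det (A ** B)\<bar> * (\<integral>\<^sup>+x. f ((A ** B) *v x) \<partial>lborel)"
        by (simp add: det_mul abs_mult ennreal_mult mult.assoc matrix_vector_mul_assoc)
    qed
  next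
    case (2 A i)
    then show ?case using det_zero_row by blast
  next
    case (3 A)
    show ?case
    proof (intro impI allI)
      fix f :: "real^'n \<Rightarrow> ennreal" assume d: "det A \<noteq> 0" and f: "f \<in> borel_measurable borel"
      have dt: "det A = (\<Prod>i\<in>UNIV. A$i$i)" by (rule det_diagonal) (use 3 in auto)
      \<comment> \<open>Reads off a diagonal entry from the basis vector, the indexing that
        \<open>lborel_affine_euclidean\<close> expects.\<close>
      let ?c = "\<lambda>b. b \<bullet> (A *v b)"
      have Ab: "A *v axis i 1 = A$i$i *\<^sub>R axis i 1" for i
        using 3 by (subst matrix_vector_mult_basis) (auto simp: vec_eq_iff column_def axis_def)
      have ci: "?c (axis i 1) = A$i$i" for i by (simp add: Ab inner_axis_axis)
      have cb: "?c b \<noteq> 0" if "b \<in> Basis" for b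
        using that d unfolding dt by (auto simp: Basis_vec_def ci)
      have pc: "(\<Prod>b\<in>Basis. \<bar>?c b\<bar>) = \<bar>det A\<bar>"
        unfolding dt abs_prod
        by (simp add: Basis_vec_def axis_eq_axis prod.UNION_disjoint ci)
      have T: "0 + (\<Sum>j\<in>Basis. (?c j * (x \<bullet> j)) *\<^sub>R j) = A *v x" for x
      proof -
        have "A *v x = A *v (\<Sum>i\<in>UNIV. x$i *\<^sub>R axis i 1)"
          by (metis basis_expansion scalar_mult_eq_scaleR)
        also have "\<dots> = (\<Sum>i\<in>UNIV. (A$i$i * x$i) *\<^sub>R axis i 1)"
          by (simp add: matrix_vector_right_distrib linear_sum[OF matrix_vector_mul_linear] 
              matrix_vector_mult_scaleR Ab mult.commute)
        also have "\<dots> = 0 + (\<Sum>j\<in>Basis. (?c j * (x \<bullet> j)) *\<^sub>R j)"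
          by (simp add: Basis_vec_def axis_eq_axis sum.UNION_disjoint ci inner_axis)
        finally show ?thesis ..
      qed
      have "(\<integral>\<^sup>+x. f x \<partial>lborel) = (\<integral>\<^sup>+x. f x \<partial>density (distr lborel borel ((*v) A)) (\<lambda>_. ennreal \<bar>det A\<bar>))"
        using lborel_affine_euclidean[of ?c "0::real^'n"] cb unfolding T pc by auto
      also have "\<dots> = ennreal \<bar>det A\<bar> * (\<integral>\<^sup>+x. f (A *v x) \<partial>lborel)"
        using f meas[of A] by (subst nn_integral_density) (auto simp: nn_integral_distr nn_integral_cmult)
      finally show "(\<integral>\<^sup>+x. f x \<partial>lborel) = ennreal \<bar>det A\<bar> * (\<integral>\<^sup>+x. f (A *v x) \<partial>lborel)" .
    qed
  next
    case (4 m n)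
    let ?p = "Transposition.transpose m n"
    have v: "(\<chi> i j. mat 1 $ i $ ?p j) *v x = (\<chi> i. x $ ?p i)" for x :: "real^'n"
    proof -
      have "(\<Sum>j\<in>UNIV. mat 1 $ i $ ?p j * x $ j) = x $ ?p i" for i
      proof -
        have "(\<Sum>j\<in>UNIV. mat 1 $ i $ ?p j * x $ j) = (\<Sum>j\<in>UNIV. if j = ?p i then x $ j else 0)"
          by (rule sum.cong) (auto simp: mat_def transpose_apply_commute)
        then show ?thesis by simp
      qed
      then show ?thesis by (simp add: vec_eq_iff matrix_vector_mult_def)
    qed
    have "\<bar>det ((\<chi> i j. mat 1 $ i $ ?p j) :: real^'n^'n)\<bar> = 1"
    proof -
      have "det (\<chi> i j. (mat 1 :: real^'n^'n) $ i $ ?p j) = of_int (sign ?p) * det (mat 1 :: real^'n^'n)"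
        by (rule det_permute_columns) (simp add: permutes_swap_id)
      then show ?thesis by (simp add: sign_def)
    qed
    then show ?case by (simp add: v nn_integral_lborel_transpose)
  next
    case (5 m n c)
    let ?A = "(\<chi> i j. if i = m \<and> j = n then c else of_bool (i = j)) :: real^'n^'n"
    have v: "?A *v x = x + (c * x $ n) *\<^sub>R axis m 1" for x :: "real^'n"
    proof -
      have "(?A *v x) $ i = (x + (c * x $ n) *\<^sub>R axis m 1) $ i" for i
      proof -
        have "(?A *v x) $ i = (\<Sum>j\<in>UNIV. (if j = i then x $ j else 0) + (if j = n then (if i = m then c * x $ j else 0) else 0))"
          unfolding matrix_vector_mult_def using 5 by (auto intro!: sum.cong)
        then show ?thesis by (simp add: sum.distrib axis_def)
      qed
      then show ?thesis by (simp add: vec_eq_iff)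
    qed
    have "det ?A = 1"
    proof -
      have "?A = (\<chi> k. if k = m then row m (mat 1) + c *s row n (mat 1) else row k (mat 1))"
        using 5 by (auto simp: vec_eq_iff row_def mat_def)
      then show ?thesis using det_row_operation[OF 5, of "mat 1 :: real^'n^'n" c] by (simp add: det_I)
    qed
    then show ?case using nn_integral_lborel_shear[OF 5] by (simp add: v)
  qed
  then show ?thesis using assms by blast
qed


section \<open>Matrix inverses, positive definite matrices and one-dimensional Gaussian
  marginals\<close>

lemma matrix_inv_left:
  fixes S :: "real^'d^'d" assumes "invertible S" shows "matrix_inv S ** S = mat 1"
  using assms unfolding invertible_def matrix_inv_def by (rule someI2_ex) auto

lemma matrix_inv_right:
  fixes S :: "real^'d^'d" assumes "invertible S" shows "S ** matrix_inv S = mat 1"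
  using assms unfolding invertible_def matrix_inv_def by (rule someI2_ex) auto

lemma symmetric_inner_matrix:
  fixes M :: "real^'d^'d" assumes "transpose M = M" shows "x \<bullet> (M *v y) = (M *v x) \<bullet> y"
  using assms by (metis dot_lmul_matrix vector_transpose_matrix)

lemma pos_def_invertible:
  fixes S :: "real^'d^'d" assumes "\<And>x. x \<noteq> 0 \<Longrightarrow> 0 < x \<bullet> (S *v x)" shows "invertible S"
  unfolding invertible_left_inverse matrix_left_invertible_ker using assms by (metis inner_zero_right less_irrefl)

lemma sym_pos_def_invertible: "sym_pos_def S \<Longrightarrow> invertible S"
  by (rule pos_def_invertible) (auto simp: sym_pos_def_def)

lemma sym_pos_def_matrix_inv:
  assumes S: "sym_pos_def S" shows "sym_pos_def (matrix_inv S)"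
proof -
  let ?M = "matrix_inv S"
  have inv: "invertible S" by (rule sym_pos_def_invertible[OF S])
  have SM: "S *v (?M *v x) = x" for x
    by (simp add: matrix_vector_mul_assoc matrix_inv_right[OF inv])
  have tS: "transpose S = S" using S by (simp add: sym_pos_def_def)
  have "?M = (transpose ?M ** S) ** ?M"
  proof -
    have "transpose ?M ** S = mat 1"
      by (metis inv matrix_inv_right matrix_transpose_mul tS transpose_mat)
    then show ?thesis by (simp add: matrix_mul_lid)
  qed
  also have "\<dots> = transpose ?M"
    by (metis inv matrix_inv_right matrix_mul_assoc matrix_mul_rid)
  finally have "transpose ?M = ?M" by simp
  moreover have "0 < x \<bullet> (?M *v x)" if "x \<noteq> 0" for x
  proof -
    have "?M *v x \<noteq> 0" using SM[of x] that by auto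
    then have "0 < (?M *v x) \<bullet> (S *v (?M *v x))" using S by (auto simp: sym_pos_def_def)
    then show ?thesis by (simp add: SM inner_commute)
  qed
  ultimately show ?thesis by (simp add: sym_pos_def_def)
qed

text \<open>Gram-Schmidt completion for the inner product \<open>x \<bullet> (M *v y)\<close>, one
  index at a time, starting from the prescribed vector at index \<open>i0\<close>. The basis is
  indexed by the coordinates so that it can serve as the columns of a square matrix.\<close>

lemma sym_pos_def_orthonormal_basis:
  fixes M :: "real^'d^'d"
  assumes M: "sym_pos_def M" and x0: "x0 \<bullet> (M *v x0) = 1"
  shows "\<exists>b :: 'd \<Rightarrow> real^'d. b i0 = x0 \<and> (\<forall>i j. b i \<bullet> (M *v b j) = (if i = j then 1 else 0))"
proof -
  have sym: "x \<bullet> (M *v y) = y \<bullet> (M *v x)" for x y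
    using symmetric_inner_matrix[of M x y] M by (simp add: sym_pos_def_def inner_commute)
  have "finite F \<Longrightarrow> i0 \<notin> F \<Longrightarrow> \<exists>b :: 'd \<Rightarrow> real^'d. b i0 = x0 \<and>
      (\<forall>i\<in>insert i0 F. \<forall>j\<in>insert i0 F. b i \<bullet> (M *v b j) = (if i = j then 1 else 0))" for F
  proof (induction F rule: finite_induct)
    case empty
    then show ?case using x0 by (intro exI[of _ "\<lambda>_. x0"]) auto
  next
    case (insert k F)
    then obtain b where b: "b i0 = x0"
      "\<And>i j. i \<in> insert i0 F \<Longrightarrow> j \<in> insert i0 F \<Longrightarrow> b i \<bullet> (M *v b j) = (if i = j then 1 else 0)"
      by blast
    \<comment> \<open>Orthogonality to the \<open>b i\<close> for the form is ordinary orthogonality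
      to these vectors. There are fewer of them than the dimension, so a nonzero such vector
      exists.\<close>
    let ?S = "(\<lambda>i. M *v b i) ` insert i0 F"
    have "card (insert i0 F) < CARD('d)"
      using insert by (intro psubset_card_mono) auto
    moreover have "card ?S \<le> card (insert i0 F)" using insert by (intro card_image_le) auto
    moreover have "dim ?S \<le> card ?S" using insert by (intro dim_le_card') auto
    ultimately have "dim ?S < DIM(real^'d)" by simp
    then obtain y where y: "y \<noteq> 0" "\<And>z. z \<in> span ?S \<Longrightarrow> orthogonal y z"
      using orthogonal_to_subspace_exists by blast
    have y0: "y \<bullet> (M *v b i) = 0" if "i \<in> insert i0 F" for i
      using y(2)[of "M *v b i"] that by (auto simp: orthogonal_def intro: span_base)
    have ypos: "0 < y \<bullet> (M *v y)" using y(1) M by (simp add: sym_pos_def_def)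
    define z where "z = (1 / sqrt (y \<bullet> (M *v y))) *\<^sub>R y"
    have zz: "z \<bullet> (M *v z) = 1"
    proof -
      have "z \<bullet> (M *v z) = (y \<bullet> (M *v y)) / (sqrt (y \<bullet> (M *v y)) * sqrt (y \<bullet> (M *v y)))"
        by (simp add: z_def matrix_vector_mult_scaleR)
      with ypos show ?thesis by simp
    qed
    have z0: "z \<bullet> (M *v b i) = 0" "b i \<bullet> (M *v z) = 0" if "i \<in> insert i0 F" for i
      using y0[OF that] sym[of z "b i"] by (simp_all add: z_def)
    show ?case
      using b zz z0 insert by (intro exI[of _ "b(k := z)"]) (auto split: if_splits)
  qed
  from this[of "UNIV - {i0}"] show ?thesis by (auto simp: insert_UNIV)
qed

text \<open>Whitening: with the columns of \<open>B\<close> orthonormal for the inverse covariance,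
  \<open>x = m + B *v y\<close> turns the density into a product of standard normal densities, and
  the linear form sees one coordinate of \<open>y\<close> only. The case \<open>a = 0\<close>, with
  standard deviation 0, is included.\<close>

lemma nn_integral_mvn_inner:
  fixes S :: "real^'d^'d" and g :: "real \<Rightarrow> ennreal"
  assumes S: "sym_pos_def S" and g[measurable]: "g \<in> borel_measurable borel"
  shows "(\<integral>\<^sup>+x. g (a \<bullet> x) \<partial>mvn m S)
       = (\<integral>\<^sup>+x. g (a \<bullet> m + sqrt (a \<bullet> (S *v a)) * x) \<partial>std_normal_distribution)"
proof -
  let ?M = "matrix_inv S"
  define c where "c = sqrt (a \<bullet> (S *v a))"
  have M: "sym_pos_def ?M" by (rule sym_pos_def_matrix_inv[OF S])
  have inv: "invertible S" by (rule sym_pos_def_invertible[OF S])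
  have MS: "?M *v (S *v x) = x" for x
    by (simp add: matrix_vector_mul_assoc matrix_inv_left[OF inv])
  obtain i0 :: 'd where True by blast
  have unit: "(1 / sqrt r) *\<^sub>R x \<bullet> (?M *v ((1 / sqrt r) *\<^sub>R x)) = 1" if "r = x \<bullet> (?M *v x)" "r > 0" for r x
  proof -
    have "(1 / sqrt r) *\<^sub>R x \<bullet> (?M *v ((1 / sqrt r) *\<^sub>R x)) = r / (sqrt r * sqrt r)"
      using that by (simp add: matrix_vector_mult_scaleR)
    with that show ?thesis by simp
  qed
  \<comment> \<open>An orthonormal basis for the form \<open>S\<^sup>-\<^sup>1\<close> whose first vector is proportional to \<open>S a\<close>:
    in its coordinates \<open>a \<bullet> x\<close> depends on one coordinate only.\<close>
  obtain b where b: "\<And>i j. b i \<bullet> (?M *v b j) = (if i = j then 1 else 0)"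
    and ab: "\<And>i. a \<bullet> b i = (if i = i0 then c else 0)"
  proof (cases "a = 0")
    case True
    have pos: "0 < axis i0 1 \<bullet> (?M *v axis i0 1)" using M by (auto simp: sym_pos_def_def axis_eq_0_iff)
    let ?x = "(1 / sqrt (axis i0 1 \<bullet> (?M *v axis i0 1))) *\<^sub>R axis i0 1"
    have "?x \<bullet> (?M *v ?x) = 1" by (rule unit) (use pos in auto)
    from sym_pos_def_orthonormal_basis[OF M this, of i0] obtain b :: "'d \<Rightarrow> real^'d" where
      "\<And>i j. b i \<bullet> (?M *v b j) = (if i = j then 1 else 0)" by blast
    with that[of b] True show ?thesis by (simp add: c_def)
  next
    case False
    then have pos: "0 < a \<bullet> (S *v a)" using S by (simp add: sym_pos_def_def)
    then have c: "c > 0" "c * c = a \<bullet> (S *v a)" by (auto simp: c_def)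
    let ?x = "(1 / c) *\<^sub>R (S *v a)"
    have "?x \<bullet> (?M *v ?x) = 1"
      using c pos by (simp add: matrix_vector_mult_scaleR MS inner_commute)
    from sym_pos_def_orthonormal_basis[OF M this, of i0] obtain b where
      b: "b i0 = ?x" "\<And>i j. b i \<bullet> (?M *v b j) = (if i = j then 1 else 0)" by blast
    have "a \<bullet> b i = (if i = i0 then c else 0)" for i
    proof -
      have "a = c *\<^sub>R (?M *v b i0)" using c by (simp add: b(1) matrix_vector_mult_scaleR MS)
      then have "a \<bullet> b i = c * (b i \<bullet> (?M *v b i0))" by (metis inner_commute inner_scaleR_left)
      then show ?thesis using b(2) by auto
    qed
    with b(2) that show ?thesis by blast
  qed
  define B :: "real^'d^'d" where "B = (\<chi> i j. b j $ i)"
  have Bv: "B *v x = (\<Sum>j\<in>UNIV. x $ j *\<^sub>R b j)" for x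
    by (simp add: B_def matrix_vector_mult_def vec_eq_iff mult.commute)
  have BMB: "(B *v x) \<bullet> (?M *v (B *v x)) = (\<Sum>i\<in>UNIV. (x $ i)\<^sup>2)" for x
  proof -
    have *: "x $ i * (x $ j * (b j \<bullet> (?M *v b i))) = (if j = i then (x $ i)\<^sup>2 else 0)" for i j
      by (simp add: b power2_eq_square)
    show ?thesis
      by (simp add: Bv linear_sum[OF matrix_vector_mul_linear] matrix_vector_mult_scaleR
          inner_sum_left inner_sum_right sum_distrib_left *)
  qed
  have aB: "a \<bullet> (B *v x) = c * x $ i0" for x
    by (simp add: Bv inner_sum_right ab if_distrib mult.commute cong: if_cong)
  have "transpose B ** (?M ** B) = mat 1"
  proof -
    have "(transpose B ** (?M ** B)) $ i $ j = b i \<bullet> (?M *v b j)" for i j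
      by (simp add: B_def transpose_def matrix_matrix_mult_def matrix_vector_mult_def inner_vec_def)
    then show ?thesis by (simp add: vec_eq_iff mat_def b)
  qed
  \<comment> \<open>Determinants give \<open>det S = (det B)^2\<close>, so the normalising constant
    of the density cancels the Jacobian.\<close>
  then have "det B * (det ?M * det B) = 1"
    by (metis det_I det_mul det_transpose)
  moreover have "det ?M * det S = 1"
    by (metis det_I det_mul matrix_inv_left[OF inv])
  ultimately have dB: "det B \<noteq> 0" "det S = (det B)\<^sup>2"
    by (auto simp: power2_eq_square) (metis mult.commute mult.left_commute mult_1)
  have dens: "ennreal (mvn_density m S (m + B *v x)) =
      ennreal (1 / \<bar>det B\<bar>) * (\<Prod>i\<in>UNIV. ennreal (std_normal_density (x $ i)))" for x
  proof -
    have sd: "sqrt ((2 * pi) ^ CARD('d) * det S) = sqrt (2 * pi) ^ CARD('d) * \<bar>det B\<bar>"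
      by (simp only: dB(2) real_sqrt_mult[of "_ ^ _"] real_sqrt_power[of "2 * pi"] real_sqrt_abs)
    have "(\<Prod>i\<in>UNIV. std_normal_density (x $ i)) = exp (- (\<Sum>i\<in>UNIV. (x $ i)\<^sup>2) / 2) / sqrt (2 * pi) ^ CARD('d)"
      by (simp add: std_normal_density_def prod_dividef exp_sum[symmetric] sum_negf sum_divide_distrib)
    also have "\<dots> = \<bar>det B\<bar> * mvn_density m S (m + B *v x)"
      using dB(1) unfolding mvn_density_def sd by (simp add: BMB power_mult_distrib real_sqrt_mult)
    finally have "mvn_density m S (m + B *v x) = 1 / \<bar>det B\<bar> * (\<Prod>i\<in>UNIV. std_normal_density (x $ i))"
      using dB by simp
    then show ?thesis by (simp add: ennreal_mult[symmetric] prod_nonneg prod_ennreal normal_density_nonneg)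
  qed
  have cont: "continuous_on UNIV (mvn_density m S)"
    unfolding mvn_density_def
    by (intro continuous_intros continuous_on_compose2[OF matrix_vector_mult_linear_continuous_on]) (use dB in auto)
  have [measurable]: "mvn_density m S \<in> borel_measurable borel"
    using cont by (rule borel_measurable_continuous_onI)
  have [measurable]: "(*v) B \<in> borel \<rightarrow>\<^sub>M borel"
    by (intro borel_measurable_continuous_onI matrix_vector_mult_linear_continuous_on)
  \<comment> \<open>\<open>g\<close> depends on coordinate \<open>i0\<close> only and is absorbed
    into that factor, so the integral still splits into a product.\<close>
  let ?h = "\<lambda>i t. if i = i0 then ennreal (std_normal_density t) * g (a \<bullet> m + c * t) else ennreal (std_normal_density t)"
  have "(\<integral>\<^sup>+x. g (a \<bullet> x) \<partial>mvn m S) = (\<integral>\<^sup>+x. ennreal (mvn_density m S x) * g (a \<bullet> x) \<partial>distr lborel borel ((+) m))"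
    unfolding mvn_def lborel_distr_plus by (subst nn_integral_density) auto
  also have "\<dots> = (\<integral>\<^sup>+x. ennreal (mvn_density m S (m + x)) * g (a \<bullet> (m + x)) \<partial>lborel)"
    by (subst nn_integral_distr) auto
  also have "\<dots> = ennreal \<bar>det B\<bar> * (\<integral>\<^sup>+x. ennreal (mvn_density m S (m + B *v x)) * g (a \<bullet> (m + B *v x)) \<partial>lborel)"
    by (rule nn_integral_lborel_linear[OF dB(1)]) measurable
  also have "\<dots> = ennreal \<bar>det B\<bar> * (\<integral>\<^sup>+x. ennreal (1 / \<bar>det B\<bar>) * (\<Prod>i\<in>UNIV. ?h i (x $ i)) \<partial>lborel)"
  proof -
    have "(\<Prod>i\<in>UNIV. ennreal (std_normal_density (x $ i))) * g (a \<bullet> m + c * x $ i0) = (\<Prod>i\<in>UNIV. ?h i (x $ i))" for x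
      by (subst (1 2) prod.remove[of _ i0]) (auto intro!: arg_cong2[where f="(*)"] prod.cong simp: mult_ac)
    then show ?thesis by (simp add: dens inner_add_right aB mult.assoc)
  qed
  also have "\<dots> = ennreal \<bar>det B\<bar> * (ennreal (1 / \<bar>det B\<bar>) * (\<integral>\<^sup>+x. (\<Prod>i\<in>UNIV. ?h i (x $ i)) \<partial>lborel))"
    by (subst nn_integral_cmult) auto
  also have "\<dots> = (\<integral>\<^sup>+x. (\<Prod>i\<in>UNIV. ?h i (x $ i)) \<partial>lborel)"
    using dB by (simp add: mult.assoc[symmetric] ennreal_mult[symmetric])
  \<comment> \<open>The product formula for Lebesgue measure is indexed by \<open>Basis\<close>;
    \<open>THE\<close> recovers the coordinate from the basis vector.\<close>
  also have "\<dots> = (\<integral>\<^sup>+x. (\<Prod>b\<in>Basis. ?h (THE i. (b :: real^'d) = axis i 1) (x \<bullet> b)) \<partial>lborel)"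
    unfolding prod_Basis_cart by (simp add: axis_eq_axis inner_axis cong: if_cong)
  also have "\<dots> = (\<Prod>b\<in>Basis. \<integral>\<^sup>+t. ?h (THE i. (b :: real^'d) = axis i 1) t \<partial>lborel)"
    by (rule nn_integral_lborel_prod) auto
  also have "\<dots> = (\<Prod>i\<in>UNIV. \<integral>\<^sup>+t. ?h i t \<partial>lborel)"
    unfolding prod_Basis_cart by (simp add: axis_eq_axis cong: if_cong)
  also have "\<dots> = (\<integral>\<^sup>+t. ?h i0 t \<partial>lborel)"
  proof -
    have "(\<integral>\<^sup>+t. ennreal (std_normal_density t) \<partial>lborel) = 1"
      using prob_space.emeasure_space_1[OF prob_space_normal_density[of 1 0]]
      by (simp add: emeasure_density)
    then show ?thesis by (subst prod.remove[of _ i0]) auto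
  qed
  also have "\<dots> = (\<integral>\<^sup>+x. g (a \<bullet> m + c * x) \<partial>std_normal_distribution)"
    by (subst nn_integral_density) auto
  finally show ?thesis by (simp add: c_def)
qed

lemma distr_mvn_inner:
  assumes S: "sym_pos_def S"
  shows "distr (mvn m S) borel ((\<bullet>) a) = distr std_normal_distribution borel (\<lambda>x. a \<bullet> m + sqrt (a \<bullet> (S *v a)) * x)"
proof (rule measure_eqI)
  fix X assume "X \<in> sets (distr (mvn m S) borel ((\<bullet>) a))"
  then have X[measurable]: "X \<in> sets borel" by simp
  have [measurable]: "(\<bullet>) a \<in> mvn m S \<rightarrow>\<^sub>M borel" by (simp add: mvn_def)
  have eq: "emeasure (distr M borel h) X = (\<integral>\<^sup>+x. indicator X (h x) \<partial>M)" if "h \<in> M \<rightarrow>\<^sub>M borel" for M and h :: "'z \<Rightarrow> real"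
    using that by (simp add: nn_integral_distr[symmetric])
  show "emeasure (distr (mvn m S) borel ((\<bullet>) a)) X
      = emeasure (distr std_normal_distribution borel (\<lambda>x. a \<bullet> m + sqrt (a \<bullet> (S *v a)) * x)) X"
    by (subst (1 2) eq) (auto intro!: nn_integral_mvn_inner[OF S])
qed simp


section \<open>One-dimensional normal laws and the posterior predictive law\<close>

lemma prob_space_std_normal: "prob_space std_normal_distribution"
  by (rule prob_space_normal_density) simp

lemma measure_std_normal_UNIV [simp]: "measure std_normal_distribution UNIV = 1"
  using prob_space.prob_space[OF prob_space_std_normal] by simp

lemma distr_std_normal_affine:
  assumes "\<sigma> > 0"
  shows "distr std_normal_distribution borel (\<lambda>x. m + \<sigma> * x) = normal_law m \<sigma>"
proof -
  interpret prob_space std_normal_distribution by (rule prob_space_std_normal)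
  have "distributed std_normal_distribution lborel (\<lambda>x. x) std_normal_density"
    unfolding distributed_def
    by (auto intro!: measure_eqI simp: emeasure_distr)
  from normal_density_affine[OF this, of \<sigma> m] assms
  have "distributed std_normal_distribution lborel (\<lambda>x. m + \<sigma> * x) (normal_density m \<sigma>)" by simp
  then have "distr std_normal_distribution lborel (\<lambda>x. m + \<sigma> * x) = normal_law m \<sigma>"
    by (simp add: distributed_distr_eq_density normal_law_def)
  moreover have "distr std_normal_distribution lborel (\<lambda>x. m + \<sigma> * x) = distr std_normal_distribution borel (\<lambda>x. m + \<sigma> * x)"
    by (rule distr_cong) auto
  ultimately show ?thesis by simp
qed

lemma integral_normal_law:
  assumes "\<sigma> > 0" and [measurable]: "F \<in> borel_measurable borel"
  shows "(\<integral>x. F x \<partial>normal_law m \<sigma>) = (\<integral>x. (F (m + \<sigma> * x) :: real) \<partial>std_normal_distribution)"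
  unfolding distr_std_normal_affine[OF assms(1), symmetric] by (subst integral_distr) auto

lemma integral_mvn_inner:
  assumes "sym_pos_def S" and F[measurable]: "F \<in> borel_measurable borel"
  shows "(\<integral>x. F (a \<bullet> x) \<partial>mvn m S) = (\<integral>x. (F (a \<bullet> m + sqrt (a \<bullet> (S *v a)) * x) :: real) \<partial>std_normal_distribution)"
proof -
  have [measurable]: "(\<bullet>) a \<in> mvn m S \<rightarrow>\<^sub>M borel" by (simp add: mvn_def)
  have "(\<integral>x. F (a \<bullet> x) \<partial>mvn m S) = (\<integral>y. F y \<partial>distr (mvn m S) borel ((\<bullet>) a))"
    by (subst integral_distr) auto
  then show ?thesis unfolding distr_mvn_inner[OF assms(1)] by (subst (asm) integral_distr) auto
qed

lemma integral_mvn_inner_mean: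
  assumes "sym_pos_def S"
  shows "(\<integral>x. a \<bullet> x \<partial>mvn m S) = a \<bullet> m"
proof -
  interpret prob_space std_normal_distribution by (rule prob_space_std_normal)
  have "integrable std_normal_distribution (\<lambda>x. x)" "(\<integral>x. x \<partial>std_normal_distribution) = 0"
    using integrable_std_normal_distribution_moment[of 1] integral_std_normal_distribution_moment_odd[of 1] by auto
  then have "(\<integral>x. a \<bullet> m + sqrt (a \<bullet> (S *v a)) * x \<partial>std_normal_distribution) = a \<bullet> m"
    by simp
  then show ?thesis using integral_mvn_inner[OF assms, of "\<lambda>x. x"] by simp
qed

text \<open>Independent centred normal variables add to a normal variable whose variance is the sum.
  The case \<open>c = 0\<close>, which occurs for the zero action, is treated apart because the
  degenerate law has no density.\<close>

lemma integral_std_normal_convolution: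
  assumes "0 \<le> c" "0 < \<sigma>" and [measurable]: "F \<in> borel_measurable borel"
    and int: "integrable std_normal_distribution (\<lambda>x. F (m + sqrt (c\<^sup>2 + \<sigma>\<^sup>2) * x))"
  shows "(\<integral>y. (\<integral>x. F (m + c * y + \<sigma> * x) \<partial>std_normal_distribution) \<partial>std_normal_distribution)
       = (\<integral>x. (F (m + sqrt (c\<^sup>2 + \<sigma>\<^sup>2) * x) :: real) \<partial>std_normal_distribution)"
proof (cases "c = 0")
  case True
  interpret prob_space std_normal_distribution by (rule prob_space_std_normal)
  show ?thesis using True \<open>0 < \<sigma>\<close> by simp
next
  case False
  with \<open>0 \<le> c\<close> have c: "c > 0" by simp
  let ?c = "normal_law 0 c" and ?s = "normal_law 0 \<sigma>" and ?r = "normal_law 0 (sqrt (c\<^sup>2 + \<sigma>\<^sup>2))"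
  interpret C: prob_space ?c unfolding normal_law_def by (rule prob_space_normal_density[OF c])
  interpret S: prob_space ?s unfolding normal_law_def by (rule prob_space_normal_density) fact
  interpret pair_prob_space ?c ?s ..
  have r: "sqrt (c\<^sup>2 + \<sigma>\<^sup>2) > 0" using c by (simp add: add_pos_nonneg)
  have [measurable_cong, simp]: "sets (normal_law a b) = sets borel" for a b by (simp add: normal_law_def)
  have conv: "?c \<star> ?s = ?r"
    unfolding normal_law_def
    using C.finite_measure_axioms S.finite_measure_axioms c \<open>0 < \<sigma>\<close>
    by (subst convolution_density)
      (auto simp: normal_law_def conv_normal_density_zero_mean ennreal_mult[symmetric] normal_density_nonneg)
  have "integrable ?r (\<lambda>z. F (m + z))"
    using int unfolding distr_std_normal_affine[OF r, symmetric] by (subst integrable_distr_eq) auto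
  then have i2: "integrable (?c \<Otimes>\<^sub>M ?s) (\<lambda>(y, x). F (m + (y + x)))"
    unfolding conv[symmetric] convolution_def by (subst (asm) integrable_distr_eq) (auto simp: case_prod_unfold)
  have "(\<integral>x. F (m + sqrt (c\<^sup>2 + \<sigma>\<^sup>2) * x) \<partial>std_normal_distribution) = (\<integral>z. F (m + z) \<partial>?r)"
    by (subst integral_normal_law[OF r]) auto
  also have "\<dots> = (\<integral>p. F (m + (fst p + snd p)) \<partial>(?c \<Otimes>\<^sub>M ?s))"
    unfolding conv[symmetric] convolution_def by (subst integral_distr) (auto simp: case_prod_unfold)
  also have "\<dots> = (\<integral>y. (\<integral>x. F (m + (y + x)) \<partial>?s) \<partial>?c)"
    using integral_fst[OF i2] by (simp add: case_prod_unfold)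
  also have "\<dots> = (\<integral>y. (\<integral>x. F (m + (y + \<sigma> * x)) \<partial>std_normal_distribution) \<partial>?c)"
    by (subst integral_normal_law[OF \<open>0 < \<sigma>\<close>]) auto
  also have "\<dots> = (\<integral>y. (\<integral>x. F (m + (c * y + \<sigma> * x)) \<partial>std_normal_distribution) \<partial>std_normal_distribution)"
  proof (subst integral_normal_law[OF c])
    interpret N: prob_space std_normal_distribution by (rule prob_space_std_normal)
    show "(\<lambda>y. \<integral>x. F (m + (y + \<sigma> * x)) \<partial>std_normal_distribution) \<in> borel_measurable borel"
      by measurable
  qed simp
  finally show ?thesis by (simp add: add.assoc)
qed

text \<open>Parameter uncertainty and noise add up: averaged over the posterior, the reward is
  normal with mean \<open>a \<bullet> m\<close> and variance
  \<open>a \<bullet> (S *v a) + \<sigma>^2\<close>. The double integral of the Bellman recursion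
  thereby becomes a single Gaussian integral.\<close>

lemma integral_mvn_normal_law:
  assumes S: "sym_pos_def S" and "0 < \<sigma>" and [measurable]: "F \<in> borel_measurable borel"
    and int: "integrable std_normal_distribution (\<lambda>x. F (a \<bullet> m + sqrt (a \<bullet> (S *v a) + \<sigma>\<^sup>2) * x))"
  shows "(\<integral>\<nu>. (\<integral>x. F x \<partial>normal_law (a \<bullet> \<nu>) \<sigma>) \<partial>mvn m S)
       = (\<integral>x. (F (a \<bullet> m + sqrt (a \<bullet> (S *v a) + \<sigma>\<^sup>2) * x) :: real) \<partial>std_normal_distribution)"
proof -
  interpret prob_space std_normal_distribution by (rule prob_space_std_normal)
  let ?c = "sqrt (a \<bullet> (S *v a))"
  have nn: "0 \<le> a \<bullet> (S *v a)" using S by (cases "a = 0") (auto simp: sym_pos_def_def less_imp_le)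
  have [measurable]: "(\<lambda>y. \<integral>x. F (y + \<sigma> * x) \<partial>std_normal_distribution) \<in> borel_measurable borel"
    by measurable
  have "(\<integral>\<nu>. (\<integral>x. F x \<partial>normal_law (a \<bullet> \<nu>) \<sigma>) \<partial>mvn m S)
      = (\<integral>y. (\<integral>x. F (a \<bullet> m + ?c * y + \<sigma> * x) \<partial>std_normal_distribution) \<partial>std_normal_distribution)"
    using \<open>0 < \<sigma>\<close> by (simp add: integral_normal_law integral_mvn_inner[OF S, of "\<lambda>y. \<integral>x. F (y + \<sigma> * x) \<partial>std_normal_distribution"])
  also have "\<dots> = (\<integral>x. F (a \<bullet> m + sqrt (?c\<^sup>2 + \<sigma>\<^sup>2) * x) \<partial>std_normal_distribution)"
    by (rule integral_std_normal_convolution) (use nn int \<open>0 < \<sigma>\<close> in auto)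
  finally show ?thesis using nn by simp
qed

subsection \<open>Moments of the standard normal law\<close>

lemma integrable_std_normal_weight: "integrable std_normal_distribution (\<lambda>x. (1 + \<bar>x\<bar>) ^ m)"
proof -
  have "integrable std_normal_distribution (\<lambda>x. \<Sum>i\<le>m. real (m choose i) * \<bar>x ^ i\<bar>)"
    by (intro Bochner_Integration.integrable_sum integrable_mult_right integrable_abs
        integrable_std_normal_distribution_moment)
  then show ?thesis by (simp add: binomial_ring add.commute[of 1] power_abs)
qed

definition normal_weight :: "nat \<Rightarrow> real" where
  "normal_weight m = (\<integral>x. (1 + \<bar>x\<bar>) ^ m \<partial>std_normal_distribution)"

lemma normal_weight_ge_1: "normal_weight m \<ge> 1"
proof -
  interpret prob_space std_normal_distribution by (rule prob_space_std_normal)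
  have "(\<integral>x. 1 \<partial>std_normal_distribution) \<le> normal_weight m"
    unfolding normal_weight_def by (intro integral_mono integrable_std_normal_weight) auto
  then show ?thesis by simp
qed

lemma std_normal_bound:
  assumes [measurable]: "f \<in> borel_measurable borel" and b: "\<And>x. \<bar>f x :: real\<bar> \<le> B * (1 + \<bar>x\<bar>) ^ m"
  shows "integrable std_normal_distribution f"
    and "\<bar>\<integral>x. f x \<partial>std_normal_distribution\<bar> \<le> B * normal_weight m"
proof -
  have B: "0 \<le> B" using b[of 0] by simp
  show i: "integrable std_normal_distribution f"
    by (rule Bochner_Integration.integrable_bound[OF integrable_mult_right[OF integrable_std_normal_weight[of m], of B]])
      (use b B in \<open>auto simp: abs_mult\<close>)
  have "\<bar>\<integral>x. f x \<partial>std_normal_distribution\<bar> \<le> (\<integral>x. \<bar>f x\<bar> \<partial>std_normal_distribution)"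
    by (rule integral_abs_bound)
  also have "\<dots> \<le> (\<integral>x. B * (1 + \<bar>x\<bar>) ^ m \<partial>std_normal_distribution)"
    by (intro integral_mono integrable_abs i integrable_mult_right integrable_std_normal_weight b)
  finally show "\<bar>\<integral>x. f x \<partial>std_normal_distribution\<bar> \<le> B * normal_weight m" by (simp add: normal_weight_def)
qed

lemma std_normal_moments:
  shows "integrable std_normal_distribution (\<lambda>x. x)" "(\<integral>x. x \<partial>std_normal_distribution) = 0"
    and "integrable std_normal_distribution (\<lambda>x. x\<^sup>2)" "(\<integral>x. x\<^sup>2 \<partial>std_normal_distribution) = 1"
  using integrable_std_normal_distribution_moment[of 1] integral_std_normal_distribution_moment_odd[of 1]
    integrable_std_normal_distribution_moment[of 2] std_normal_distribution_even_moments(1)[of 1]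
  by auto

subsection \<open>Estimates for the rescaled Bellman recursion\<close>

lemma Max_range_le_add:
  fixes f g :: "'k::finite \<Rightarrow> real"
  assumes "\<And>k. f k \<le> g k + e" shows "Max (range f) \<le> Max (range g) + e"
proof -
  have "f k \<le> Max (range g) + e" for k
    by (rule order_trans[OF assms add_right_mono[OF Max_ge]]) auto
  then show ?thesis by (simp add: Max_le_iff)
qed

lemma Max_range_diff_le:
  fixes f g :: "'k::finite \<Rightarrow> real"
  assumes "\<And>k. \<bar>f k - g k\<bar> \<le> e" shows "\<bar>Max (range f) - Max (range g)\<bar> \<le> e"
proof -
  have "f k \<le> g k + e" "g k \<le> f k + e" for k using assms[of k] by auto
  then have "Max (range f) \<le> Max (range g) + e" "Max (range g) \<le> Max (range f) + e"
    by (simp_all only: Max_range_le_add)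
  then show ?thesis by linarith
qed

text \<open>A quadratic weight, so that its increment under a move is exactly a quadratic polynomial
  in the Gaussian increment; see \<open>wt_move\<close>.\<close>

definition wt :: "'a::real_normed_vector \<Rightarrow> real" where "wt s = 1 + (norm s)\<^sup>2"

lemma wt_ge_1 [simp]: "1 \<le> wt s" and wt_pos [simp]: "0 < wt s" and wt_nonneg [simp]: "0 \<le> wt s"
  by (auto simp: wt_def add_pos_nonneg)

lemma norm_le_wt: "1 + norm s \<le> 2 * wt s" "(1 + norm s)\<^sup>2 \<le> 2 * wt s" "norm s \<le> wt s"
proof -
  have 0: "0 \<le> (1 - norm s)\<^sup>2" by simp
  show a: "(1 + norm s)\<^sup>2 \<le> 2 * wt s" using 0 by (simp add: wt_def power2_eq_square algebra_simps)
  have "0 \<le> (norm s - 1/4)\<^sup>2" by simp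
  then show "1 + norm s \<le> 2 * wt s" by (simp add: wt_def power2_eq_square algebra_simps)
  have "0 \<le> (norm s - 1/2)\<^sup>2" by simp
  then show "norm s \<le> wt s" by (simp add: wt_def power2_eq_square algebra_simps)
qed

lemma wt_add: "wt (s + v) \<le> 2 * wt s * (1 + (norm v)\<^sup>2)"
proof -
  have "(norm (s + v))\<^sup>2 \<le> (norm s + norm v)\<^sup>2" by (intro power_mono norm_triangle_ineq) simp
  also have "\<dots> \<le> 2 * (norm s)\<^sup>2 + 2 * (norm v)\<^sup>2"
    using zero_le_power2[of "norm s - norm v"] by (simp add: power2_eq_square algebra_simps)
  finally have "(norm (s + v))\<^sup>2 \<le> 2 * (norm s)\<^sup>2 + 2 * (norm v)\<^sup>2" .
  moreover have "0 \<le> (norm s)\<^sup>2 * (norm v)\<^sup>2" by simp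
  ultimately show ?thesis unfolding wt_def distrib_left distrib_right by linarith
qed

lemma power3_expand: "(x + y) ^ 3 = x ^ 3 + 3 * x\<^sup>2 * y + 3 * x * y\<^sup>2 + y ^ 3" for x y :: real
  by (simp add: power2_eq_square power3_eq_cube algebra_simps)

text \<open>The properties of the rescaled bandit behind the estimates, with one constant for all
  large horizons. In the bandit \<open>\<tau>\<close> varies with \<open>q\<close> through the
  posterior variance alone, whence the factor \<open>1 / n\<close> in \<open>tau_lip\<close>. The
  drift is affine in \<open>s\<close> with coefficients depending on \<open>q\<close>, whence the
  factor \<open>1 + norm s\<close> in \<open>mu_lip_q\<close>.\<close>

locale bandit_scheme =
  fixes \<mu> :: "nat \<Rightarrow> 'k::finite \<Rightarrow> real^'k \<Rightarrow> real^'k \<Rightarrow> real"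
    and \<tau> :: "nat \<Rightarrow> 'k \<Rightarrow> real^'k \<Rightarrow> real"
    and C :: real and n0 :: nat
  assumes C: "1 \<le> C" and n0: "1 \<le> n0"
    and mu_growth: "\<And>n k s q. n0 \<le> n \<Longrightarrow> \<bar>\<mu> n k s q\<bar> \<le> C * (1 + norm s)"
    and mu_lip_s: "\<And>n k s s' q. n0 \<le> n \<Longrightarrow> \<bar>\<mu> n k s q - \<mu> n k s' q\<bar> \<le> C * norm (s - s')"
    and mu_lip_q: "\<And>n k s q q'. n0 \<le> n \<Longrightarrow> \<bar>\<mu> n k s q - \<mu> n k s q'\<bar> \<le> C * (1 + norm s) * norm (q - q')"
    and tau_bound: "\<And>n k q. n0 \<le> n \<Longrightarrow> \<bar>\<tau> n k q\<bar> \<le> C"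
    and tau_lip: "\<And>n k q q'. n0 \<le> n \<Longrightarrow> \<bar>\<tau> n k q - \<tau> n k q'\<bar> \<le> C * norm (q - q') / real n"
begin

definition incr :: "nat \<Rightarrow> 'k \<Rightarrow> real^'k \<Rightarrow> real^'k \<Rightarrow> real \<Rightarrow> real" where
  "incr n k s q x = \<mu> n k s q / real n + \<tau> n k q / sqrt (real n) * x"

definition move :: "nat \<Rightarrow> 'k \<Rightarrow> real^'k \<Rightarrow> real^'k \<Rightarrow> real \<Rightarrow> real^'k" where
  "move n k s q x = s + incr n k s q x *\<^sub>R axis k 1"

definition step :: "nat \<Rightarrow> 'k \<Rightarrow> (real^'k \<Rightarrow> real^'k \<Rightarrow> real) \<Rightarrow> real^'k \<Rightarrow> real^'k \<Rightarrow> real" where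
  "step n k \<phi> s q = (\<integral>x. \<phi> (move n k s q x) (q + (1 / real n) *\<^sub>R axis k 1) \<partial>std_normal_distribution)"

text \<open>\<open>u n j s q\<close> is the optimal reward with \<open>j\<close> rounds to go, for horizon \<open>n\<close>, in the rescaled
  variables: rewards are divided by \<open>f n\<close> and pull counts by \<open>n\<close>, so \<open>q\<close> is an arbitrary real vector.\<close>

primrec u :: "nat \<Rightarrow> nat \<Rightarrow> real^'k \<Rightarrow> real^'k \<Rightarrow> real" where
  "u n 0 = (\<lambda>s q. 0)"
| "u n (Suc j) = (\<lambda>s q. Max (range (\<lambda>k. \<mu> n k s q / real n + step n k (u n j) s q)))"

lemma n_pos: "n0 \<le> n \<Longrightarrow> 1 \<le> real n" "n0 \<le> n \<Longrightarrow> 1 \<le> sqrt (real n)"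
  "n0 \<le> n \<Longrightarrow> sqrt (real n) \<le> real n"
proof -
  assume "n0 \<le> n"
  then show 1: "1 \<le> real n" using n0 by simp
  then show 2: "1 \<le> sqrt (real n)" by simp
  show "sqrt (real n) \<le> real n" using 1 2 by (smt (verit) mult_le_cancel_right1 real_sqrt_mult_self)
qed

lemma incr_bound:
  assumes n: "n0 \<le> n" shows "\<bar>incr n k s q x\<bar> \<le> C * (1 + norm s) * (1 + \<bar>x\<bar>) / sqrt (real n)"
proof -
  note N = n_pos[OF n]
  have "\<bar>\<mu> n k s q / real n\<bar> \<le> C * (1 + norm s) / sqrt (real n)"
    unfolding abs_divide using mu_growth[OF n, of k s q] N C by (intro frac_le) auto
  moreover have "\<bar>\<tau> n k q / sqrt (real n) * x\<bar> \<le> C * (1 + norm s) * \<bar>x\<bar> / sqrt (real n)"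
  proof -
    have "\<bar>\<tau> n k q\<bar> * \<bar>x\<bar> \<le> (C * (1 + norm s)) * \<bar>x\<bar>"
      using tau_bound[OF n, of k q] C by (intro mult_right_mono) (auto intro: order_trans simp: mult_le_cancel_left1)
    then show ?thesis using N by (simp add: abs_mult divide_right_mono)
  qed
  moreover have "C * (1 + norm s) / sqrt (real n) + C * (1 + norm s) * \<bar>x\<bar> / sqrt (real n) = C * (1 + norm s) * (1 + \<bar>x\<bar>) / sqrt (real n)"
    by (simp add: algebra_simps add_divide_distrib)
  ultimately show ?thesis unfolding incr_def by linarith
qed

lemma incr_measurable [measurable]: "incr n k s q \<in> borel_measurable borel"
  unfolding incr_def[abs_def] by measurable

lemma move_measurable [measurable]: "move n k s q \<in> borel_measurable borel"
  unfolding move_def[abs_def] by measurable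

lemma integral_incr: "integrable std_normal_distribution (incr n k s q)"
  "(\<integral>x. incr n k s q x \<partial>std_normal_distribution) = \<mu> n k s q / real n"
proof -
  interpret prob_space std_normal_distribution by (rule prob_space_std_normal)
  show "integrable std_normal_distribution (incr n k s q)"
    "(\<integral>x. incr n k s q x \<partial>std_normal_distribution) = \<mu> n k s q / real n"
    unfolding incr_def[abs_def] using std_normal_moments by simp_all
qed

lemma integral_incr_sq: 
  assumes "n0 \<le> n"
  shows "integrable std_normal_distribution (\<lambda>x. (incr n k s q x)\<^sup>2)"
  "(\<integral>x. (incr n k s q x)\<^sup>2 \<partial>std_normal_distribution) = (\<mu> n k s q / real n)\<^sup>2 + (\<tau> n k q)\<^sup>2 / real n"
proof -
  interpret prob_space std_normal_distribution by (rule prob_space_std_normal)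
  have e: "(incr n k s q x)\<^sup>2 = (\<mu> n k s q / real n)\<^sup>2 + 2 * (\<mu> n k s q / real n) * (\<tau> n k q / sqrt (real n)) * x
    + (\<tau> n k q)\<^sup>2 / real n * x\<^sup>2" for x
  proof -
    have "(incr n k s q x)\<^sup>2 = (\<mu> n k s q / real n)\<^sup>2 + 2 * (\<mu> n k s q / real n) * (\<tau> n k q / sqrt (real n)) * x
      + (\<tau> n k q / sqrt (real n))\<^sup>2 * x\<^sup>2"
      by (simp add: incr_def power2_eq_square algebra_simps)
    then show ?thesis by (simp add: power_divide)
  qed
  show "integrable std_normal_distribution (\<lambda>x. (incr n k s q x)\<^sup>2)"
    "(\<integral>x. (incr n k s q x)\<^sup>2 \<partial>std_normal_distribution) = (\<mu> n k s q / real n)\<^sup>2 + (\<tau> n k q)\<^sup>2 / real n"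
    unfolding e using std_normal_moments by simp_all
qed

lemma wt_move: "wt (move n k s q x) = wt s + (2 * s $ k * incr n k s q x + (incr n k s q x)\<^sup>2)"
proof -
  have "(norm (move n k s q x))\<^sup>2 = (norm s)\<^sup>2 + 2 * (s \<bullet> (incr n k s q x *\<^sub>R axis k 1)) + (norm (incr n k s q x *\<^sub>R (axis k 1 :: real^'k)))\<^sup>2"
    unfolding move_def by (simp only: power2_norm_eq_inner) (simp add: inner_add_left inner_add_right inner_commute)
  then show ?thesis by (simp add: wt_def inner_axis mult_ac power_mult_distrib)
qed

text \<open>A crude bound that squares the weight. It serves integrability only; the sharp growth in
  the mean is \<open>integral_wt_move\<close>.\<close>

lemma wt_move_bound:
  assumes n: "n0 \<le> n" shows "wt (move n k s q x) \<le> 6 * C\<^sup>2 * (wt s)\<^sup>2 * (1 + \<bar>x\<bar>)\<^sup>2"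
proof -
  have "\<bar>incr n k s q x\<bar> \<le> C * (1 + norm s) * (1 + \<bar>x\<bar>) / 1"
    by (rule order_trans[OF incr_bound[OF n] divide_left_mono]) (use n_pos[OF n] C in auto)
  then have "\<bar>incr n k s q x\<bar>\<^sup>2 \<le> (C * (1 + norm s) * (1 + \<bar>x\<bar>))\<^sup>2" by (intro power_mono) auto
  also have "\<dots> \<le> C\<^sup>2 * (2 * wt s) * (1 + \<bar>x\<bar>)\<^sup>2"
    unfolding power_mult_distrib using norm_le_wt(2)[of s] by (intro mult_right_mono mult_left_mono) auto
  finally have 1: "(incr n k s q x)\<^sup>2 \<le> 2 * C\<^sup>2 * wt s * (1 + \<bar>x\<bar>)\<^sup>2" by (simp add: mult_ac)
  have "1 * 1 * 1 \<le> C\<^sup>2 * wt s * (1 + \<bar>x\<bar>)\<^sup>2"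
    using C by (intro mult_mono) (auto simp: one_le_power)
  with 1 have 2: "1 + (incr n k s q x)\<^sup>2 \<le> 3 * C\<^sup>2 * wt s * (1 + \<bar>x\<bar>)\<^sup>2" by (simp add: algebra_simps)
  have "wt (move n k s q x) \<le> 2 * wt s * (1 + (incr n k s q x)\<^sup>2)"
    using wt_add[of s "incr n k s q x *\<^sub>R axis k 1"] by (simp add: move_def norm_axis_1 power_mult_distrib)
  also have "\<dots> \<le> 2 * wt s * (3 * C\<^sup>2 * wt s * (1 + \<bar>x\<bar>)\<^sup>2)" using 2 by (intro mult_left_mono) auto
  finally show ?thesis by (simp add: power2_eq_square mult_ac)
qed

lemma integrable_move:
  fixes f :: "real^'k \<Rightarrow> real"
  assumes n: "n0 \<le> n" and [measurable]: "f \<in> borel_measurable borel" and b: "\<And>s. \<bar>f s\<bar> \<le> B * (wt s) ^ 3"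
  shows "integrable std_normal_distribution (\<lambda>x. f (move n k s q x))"
proof (rule std_normal_bound(1))
  show "(\<lambda>x. f (move n k s q x)) \<in> borel_measurable borel" by measurable
  have B: "0 \<le> B" using b[of 0] by (simp add: wt_def)
  fix x
  have "\<bar>f (move n k s q x)\<bar> \<le> B * (6 * C\<^sup>2 * (wt s)\<^sup>2 * (1 + \<bar>x\<bar>)\<^sup>2) ^ 3"
    using b[of "move n k s q x"] wt_move_bound[OF n, of k s q x] B
    by (elim order_trans) (intro mult_left_mono power_mono, auto)
  then show "\<bar>f (move n k s q x)\<bar> \<le> B * (6 * C\<^sup>2 * (wt s)\<^sup>2) ^ 3 * (1 + \<bar>x\<bar>) ^ 6"
    by (simp add: power_mult_distrib mult_ac flip: power_mult)
qed

lemma integrable_move1: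
  fixes f :: "real^'k \<Rightarrow> real"
  assumes n: "n0 \<le> n" and [measurable]: "f \<in> borel_measurable borel" and b: "\<And>s. \<bar>f s\<bar> \<le> B * wt s"
  shows "integrable std_normal_distribution (\<lambda>x. f (move n k s q x))"
proof (rule integrable_move[OF n])
  fix s :: "real^'k"
  have B: "0 \<le> B" using b[of 0] by (simp add: wt_def)
  have "wt s ^ 1 \<le> wt s ^ 3" by (rule power_increasing) auto
  then show "\<bar>f s\<bar> \<le> B * wt s ^ 3" using b[of s] B by (simp add: order_trans[OF _ mult_left_mono])
qed simp

text \<open>With \<open>X\<close> the increment of \<open>wt\<close> in one step, the three terms
  bound the contributions of \<open>X\<close>, \<open>X^2\<close> and \<open>X^3\<close> to the mean
  of \<open>(wt s + X)^3\<close>: 21 = 3 * 7, 108 = 3 * 36 and 216 = 6^3.\<close>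

definition cw :: real where "cw = 21 * C\<^sup>2 + 108 * C ^ 4 * normal_weight 4 + 216 * C ^ 6 * normal_weight 6"

lemma wt_measurable [measurable]: "wt \<in> borel_measurable borel"
  unfolding wt_def[abs_def] by measurable

text \<open>The increment of the weight has size \<open>1 / sqrt n\<close>, but the Gaussian part of
  \<open>incr\<close> has mean zero, which leaves order \<open>1 / n\<close> for the mean. The
  constant 7 is 4 + 2 + 1: the cross term with the drift, the squared drift and the
  variance.\<close>

lemma integral_wt_move_incr:
  assumes n: "n0 \<le> n"
  shows "integrable std_normal_distribution (\<lambda>x. 2 * s $ k * incr n k s q x + (incr n k s q x)\<^sup>2)"
    "(\<integral>x. 2 * s $ k * incr n k s q x + (incr n k s q x)\<^sup>2 \<partial>std_normal_distribution) \<le> 7 * C\<^sup>2 * wt s / real n"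
proof -
  note N = n_pos[OF n]
  show "integrable std_normal_distribution (\<lambda>x. 2 * s $ k * incr n k s q x + (incr n k s q x)\<^sup>2)"
    using integral_incr[of n k s q] integral_incr_sq[OF n, of k s q] by simp
  have "(\<integral>x. 2 * s $ k * incr n k s q x + (incr n k s q x)\<^sup>2 \<partial>std_normal_distribution)
     = 2 * s $ k * (\<mu> n k s q / real n) + ((\<mu> n k s q / real n)\<^sup>2 + (\<tau> n k q)\<^sup>2 / real n)"
    using integral_incr[of n k s q] integral_incr_sq[OF n, of k s q] by simp
  also have "\<dots> \<le> 4 * C\<^sup>2 * wt s / real n + (2 * C\<^sup>2 * wt s / real n + C\<^sup>2 * wt s / real n)"
  proof (intro add_mono)
    have "s $ k * \<mu> n k s q \<le> \<bar>s $ k\<bar> * \<bar>\<mu> n k s q\<bar>" by (metis abs_ge_self abs_mult)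
    also have "\<dots> \<le> (1 + norm s) * (C * (1 + norm s))"
      using mu_growth[OF n] component_le_norm_cart[of s k] by (intro mult_mono) auto
    also have "\<dots> = C * (1 + norm s)\<^sup>2" by (simp add: power2_eq_square)
    also have "\<dots> \<le> C\<^sup>2 * (2 * wt s)" 
      using norm_le_wt(2)[of s] C by (intro mult_mono) (auto simp: power2_eq_square mult_le_cancel_left1)
    finally show "2 * s $ k * (\<mu> n k s q / real n) \<le> 4 * C\<^sup>2 * wt s / real n"
      using N divide_right_mono[of "2 * (s $ k * \<mu> n k s q)" "2 * (C\<^sup>2 * (2 * wt s))" "real n"] by (simp add: mult_ac)
    have "\<bar>\<mu> n k s q\<bar>\<^sup>2 \<le> (C * (1 + norm s))\<^sup>2" using mu_growth[OF n] by (intro power_mono) auto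
    also have "\<dots> \<le> C\<^sup>2 * (2 * wt s)" unfolding power_mult_distrib using norm_le_wt(2)[of s] by (intro mult_left_mono) auto
    finally have "(\<mu> n k s q)\<^sup>2 \<le> 2 * C\<^sup>2 * wt s" by (simp add: mult_ac)
    then have "(\<mu> n k s q / real n)\<^sup>2 \<le> (2 * C\<^sup>2 * wt s) / (real n)\<^sup>2" by (simp add: power_divide divide_right_mono)
    also have "\<dots> \<le> (2 * C\<^sup>2 * wt s) / real n" using N by (intro divide_left_mono) (auto simp: power2_eq_square)
    finally show "(\<mu> n k s q / real n)\<^sup>2 \<le> 2 * C\<^sup>2 * wt s / real n" .
    have "\<bar>\<tau> n k q\<bar>\<^sup>2 \<le> C\<^sup>2" using tau_bound[OF n] by (intro power_mono) auto
    also have "\<dots> \<le> C\<^sup>2 * wt s" by (simp add: mult_le_cancel_left1)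
    finally show "(\<tau> n k q)\<^sup>2 / real n \<le> C\<^sup>2 * wt s / real n" by (simp add: divide_right_mono)
  qed
  also have "\<dots> = 7 * C\<^sup>2 * wt s / real n" by (simp add: field_simps)
  finally show "(\<integral>x. 2 * s $ k * incr n k s q x + (incr n k s q x)\<^sup>2 \<partial>std_normal_distribution) \<le> 7 * C\<^sup>2 * wt s / real n" .
qed

lemma cw_ge: "7 * C\<^sup>2 \<le> cw" "1 \<le> cw"
proof -
  have "0 \<le> 108 * C ^ 4 * normal_weight 4" "0 \<le> 216 * C ^ 6 * normal_weight 6"
    using C normal_weight_ge_1[of 4] normal_weight_ge_1[of 6] by (auto intro!: mult_nonneg_nonneg)
  moreover have "1 \<le> C\<^sup>2" using C by simp
  ultimately show "7 * C\<^sup>2 \<le> cw" "1 \<le> cw" unfolding cw_def by linarith+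
qed

lemma integral_wt_move:
  assumes n: "n0 \<le> n"
  shows "(\<integral>x. wt (move n k s q x) \<partial>std_normal_distribution) \<le> (1 + cw / real n) * wt s"
proof -
  interpret prob_space std_normal_distribution by (rule prob_space_std_normal)
  have "(\<integral>x. wt (move n k s q x) \<partial>std_normal_distribution) \<le> wt s + 7 * C\<^sup>2 * wt s / real n"
    unfolding wt_move using integral_wt_move_incr[OF n, of s k q] by simp
  also have "\<dots> \<le> wt s + cw * wt s / real n"
    using cw_ge n_pos[OF n] by (intro add_left_mono divide_right_mono mult_right_mono) auto
  finally show ?thesis by (simp add: algebra_simps)
qed

text \<open>The cube is the weight of the comparison argument, so it must be almost invariant under
  a step. Only the first power of the increment \<open>X\<close> of \<open>wt\<close> needs the
  cancellation of the Gaussian mean: \<open>X\<close> is of order \<open>1 / sqrt n\<close> up to a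
  polynomial in the noise, so \<open>X^2\<close> and \<open>X^3\<close> are at most of order
  \<open>1 / n\<close> anyway.\<close>

lemma integral_wt3_move:
  assumes n: "n0 \<le> n"
  shows "(\<integral>x. wt (move n k s q x) ^ 3 \<partial>std_normal_distribution) \<le> (1 + cw / real n) * wt s ^ 3"
proof -
  interpret prob_space std_normal_distribution by (rule prob_space_std_normal)
  note N = n_pos[OF n]
  define X where "X x = 2 * s $ k * incr n k s q x + (incr n k s q x)\<^sup>2" for x
  let ?r = "sqrt (real n)"
  have [measurable]: "X \<in> borel_measurable borel" unfolding X_def[abs_def] by measurable
  have Xb: "\<bar>X x\<bar> \<le> 6 * C\<^sup>2 * wt s * (1 + \<bar>x\<bar>)\<^sup>2 / ?r" for x
  proof -
    let ?d = "C * (1 + norm s) * (1 + \<bar>x\<bar>) / ?r"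
    have d: "\<bar>incr n k s q x\<bar> \<le> ?d" by (rule incr_bound[OF n])
    have CC: "C \<le> C\<^sup>2" using C by (simp add: power2_eq_square)
    have xx: "1 + \<bar>x\<bar> \<le> (1 + \<bar>x\<bar>)\<^sup>2" using self_le_power[of "1 + \<bar>x\<bar>" 2] by simp
    have "\<bar>X x\<bar> \<le> 2 * \<bar>s $ k\<bar> * \<bar>incr n k s q x\<bar> + \<bar>incr n k s q x\<bar>\<^sup>2"
      unfolding X_def by (rule order_trans[OF abs_triangle_ineq]) (simp add: abs_mult)
    also have "\<dots> \<le> 2 * (1 + norm s) * ?d + ?d\<^sup>2"
      using d component_le_norm_cart[of s k] by (intro add_mono mult_mono power_mono) auto
    also have "\<dots> = (2 * C * (1 + norm s)\<^sup>2 * (1 + \<bar>x\<bar>)) / ?r + (C\<^sup>2 * (1 + norm s)\<^sup>2 * (1 + \<bar>x\<bar>)\<^sup>2) / real n"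
    proof -
      have "2 * (1 + norm s) * ?d = (2 * C * (1 + norm s)\<^sup>2 * (1 + \<bar>x\<bar>)) / ?r"
        by (simp only: power2_eq_square times_divide_eq_right mult_ac)
      moreover have "?d\<^sup>2 = (C\<^sup>2 * (1 + norm s)\<^sup>2 * (1 + \<bar>x\<bar>)\<^sup>2) / real n"
        using N by (simp add: power_mult_distrib power_divide)
      ultimately show ?thesis by simp
    qed
    also have "\<dots> \<le> (2 * C\<^sup>2 * (2 * wt s) * (1 + \<bar>x\<bar>)\<^sup>2) / ?r + (C\<^sup>2 * (2 * wt s) * (1 + \<bar>x\<bar>)\<^sup>2) / ?r"
      using norm_le_wt(2)[of s] CC xx C N by (intro add_mono frac_le mult_mono mult_nonneg_nonneg) auto
    also have "\<dots> = 6 * C\<^sup>2 * wt s * (1 + \<bar>x\<bar>)\<^sup>2 / ?r" by (simp add: field_simps)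
    finally show ?thesis .
  qed
  have X2: "\<bar>(X x)\<^sup>2\<bar> \<le> 36 * C ^ 4 * (wt s)\<^sup>2 / real n * (1 + \<bar>x\<bar>) ^ 4" for x
  proof -
    have "\<bar>X x\<bar>\<^sup>2 \<le> (6 * C\<^sup>2 * wt s * (1 + \<bar>x\<bar>)\<^sup>2 / ?r)\<^sup>2" using Xb by (intro power_mono) auto
    then show ?thesis using N by (simp add: power_mult_distrib power_divide flip: power_mult)
  qed
  have X3: "\<bar>(X x) ^ 3\<bar> \<le> 216 * C ^ 6 * (wt s) ^ 3 / real n * (1 + \<bar>x\<bar>) ^ 6" for x
  proof -
    have "\<bar>X x\<bar> ^ 3 \<le> (6 * C\<^sup>2 * wt s * (1 + \<bar>x\<bar>)\<^sup>2 / ?r) ^ 3" using Xb by (intro power_mono) auto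
    also have "\<dots> = 216 * C ^ 6 * (wt s) ^ 3 * (1 + \<bar>x\<bar>) ^ 6 / (?r ^ 3)"
      by (simp add: power_mult_distrib power_divide flip: power_mult)
    also have "\<dots> \<le> 216 * C ^ 6 * (wt s) ^ 3 * (1 + \<bar>x\<bar>) ^ 6 / real n"
    proof (rule divide_left_mono)
      have "real n = ?r ^ 2" using N by simp
      also have "?r ^ 2 \<le> ?r ^ 3" using N by (intro power_increasing) auto
      finally show "real n \<le> ?r ^ 3" .
    qed (use C N in auto)
    finally show ?thesis by (simp add: power_abs)
  qed
  have EX: "integrable std_normal_distribution X" "(\<integral>x. X x \<partial>std_normal_distribution) \<le> 7 * C\<^sup>2 * wt s / real n"
    unfolding X_def[abs_def] by (rule integral_wt_move_incr[OF n])+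
  have EX2: "integrable std_normal_distribution (\<lambda>x. (X x)\<^sup>2)" "(\<integral>x. (X x)\<^sup>2 \<partial>std_normal_distribution) \<le> 36 * C ^ 4 * (wt s)\<^sup>2 / real n * normal_weight 4"
    using std_normal_bound[OF _ X2] by auto
  have EX3: "integrable std_normal_distribution (\<lambda>x. (X x) ^ 3)" "(\<integral>x. (X x) ^ 3 \<partial>std_normal_distribution) \<le> 216 * C ^ 6 * (wt s) ^ 3 / real n * normal_weight 6"
    using std_normal_bound[OF _ X3] by auto
  have "(\<integral>x. wt (move n k s q x) ^ 3 \<partial>std_normal_distribution)
      = (\<integral>x. wt s ^ 3 + 3 * (wt s)\<^sup>2 * X x + 3 * wt s * (X x)\<^sup>2 + X x ^ 3 \<partial>std_normal_distribution)"
    unfolding wt_move X_def[symmetric] power3_expand ..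
  also have "\<dots> = wt s ^ 3 + 3 * (wt s)\<^sup>2 * (\<integral>x. X x \<partial>std_normal_distribution)
       + 3 * wt s * (\<integral>x. (X x)\<^sup>2 \<partial>std_normal_distribution) + (\<integral>x. (X x) ^ 3 \<partial>std_normal_distribution)"
    using EX(1) EX2(1) EX3(1) by simp
  also have "\<dots> \<le> wt s ^ 3 + 3 * (wt s)\<^sup>2 * (7 * C\<^sup>2 * wt s / real n)
       + 3 * wt s * (36 * C ^ 4 * (wt s)\<^sup>2 / real n * normal_weight 4) + 216 * C ^ 6 * (wt s) ^ 3 / real n * normal_weight 6"
    using EX(2) EX2(2) EX3(2) by (intro add_mono mult_left_mono order_refl) auto
  also have "\<dots> = (1 + cw / real n) * wt s ^ 3"
    using n_pos(1)[OF n] by (simp add: cw_def power2_eq_square power3_eq_cube field_simps)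
  finally show ?thesis .
qed

section \<open>Growth and Lipschitz bounds uniform in the horizon\<close>

definition cu :: real where "cu = cw + 2 * C + 2 * C * normal_weight 1"

text \<open>The solution of the linear recursion \<open>gr_Suc\<close> with initial value 0: a
  common Gronwall bound for the growth and for both Lipschitz constants of
  \<open>u n j\<close>.\<close>

definition gr :: "nat \<Rightarrow> nat \<Rightarrow> real" where "gr n j = (1 + cu / real n) ^ j - 1"

lemma cu_ge: "cw + 2 * C \<le> cu" "1 \<le> cu" "0 \<le> cu"
proof -
  have "0 \<le> 2 * C * normal_weight 1" using C normal_weight_ge_1[of 1] by simp
  then show "cw + 2 * C \<le> cu" "1 \<le> cu" "0 \<le> cu" using C cw_ge unfolding cu_def by linarith+
qed

lemma gr_nonneg: "0 \<le> gr n j"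
  using cu_ge by (simp add: gr_def)

lemma gr_Suc: "gr n (Suc j) = gr n j * (1 + cu / real n) + cu / real n"
  by (simp add: gr_def algebra_simps)

lemma continuous_of_lip:
  fixes f :: "real^'k \<Rightarrow> real^'k \<Rightarrow> real"
  assumes "\<And>s s' q. \<bar>f s q - f s' q\<bar> \<le> g * norm (s - s')"
    and "\<And>s q q'. \<bar>f s q - f s q'\<bar> \<le> g * wt s * norm (q - q')"
  shows "continuous_on UNIV (\<lambda>p. f (fst p) (snd p))"
  unfolding continuous_on_def
proof (intro ballI)
  fix p :: "(real^'k) \<times> (real^'k)"
  let ?h = "\<lambda>x. g * norm (fst x - fst p) + g * wt (fst p) * norm (snd x - snd p)"
  have "(?h \<longlongrightarrow> g * norm (fst p - fst p) + g * wt (fst p) * norm (snd p - snd p)) (at p within UNIV)"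
    by (intro tendsto_intros)
  then have "((\<lambda>x. f (fst x) (snd x) - f (fst p) (snd p)) \<longlongrightarrow> 0) (at p within UNIV)"
  proof (rule Lim_null_comparison[rotated, OF tendsto_eq_rhs])
    show "\<forall>\<^sub>F x in at p within UNIV. norm (f (fst x) (snd x) - f (fst p) (snd p)) \<le> ?h x"
    proof (rule always_eventually, intro allI)
      fix x :: "(real^'k) \<times> (real^'k)"
      show "norm (f (fst x) (snd x) - f (fst p) (snd p)) \<le> ?h x"
        using assms(1)[of "fst x" "snd x" "fst p"] assms(2)[of "fst p" "snd x" "snd p"] by simp
    qed
  qed simp
  then show "((\<lambda>p. f (fst p) (snd p)) \<longlongrightarrow> f (fst p) (snd p)) (at p within UNIV)"
    by (simp add: LIM_zero_iff)
qed

text \<open>The three bounds are proved together because they need each other: the Lipschitz bounds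
  give the continuity behind measurability, the growth bound gives integrability, and the estimate
  in \<open>q\<close> uses the one in \<open>s\<close>, as the two moved states differ. States are
  compared under the same noise variable. The bound in \<open>q\<close> carries the weight because
  the drift does.\<close>

lemma u_estimates:
  assumes n: "n0 \<le> n"
  shows "(\<forall>s q. \<bar>u n j s q\<bar> \<le> gr n j * wt s) \<and>
    (\<forall>s s' q. \<bar>u n j s q - u n j s' q\<bar> \<le> gr n j * norm (s - s')) \<and>
    (\<forall>s q q'. \<bar>u n j s q - u n j s q'\<bar> \<le> gr n j * wt s * norm (q - q'))"
proof (induction j)
  case 0
  then show ?case by (simp add: gr_def)
next
  case (Suc j)
  interpret prob_space std_normal_distribution by (rule prob_space_std_normal)
  note N = n_pos[OF n]
  have g: "0 \<le> gr n j" by (rule gr_nonneg)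
  have IH1: "\<bar>u n j s q\<bar> \<le> gr n j * wt s" and IH2: "\<bar>u n j s q - u n j s' q\<bar> \<le> gr n j * norm (s - s')"
    and IH3: "\<bar>u n j s q - u n j s q'\<bar> \<le> gr n j * wt s * norm (q - q')" for s s' q q'
    using Suc by blast+
  have cont: "continuous_on UNIV (\<lambda>p. u n j (fst p) (snd p))" using IH2 IH3 by (rule continuous_of_lip)
  have m[measurable]: "(\<lambda>s. u n j s q) \<in> borel_measurable borel" for q
    by (intro borel_measurable_continuous_onI continuous_on_compose2[OF cont, of _ "\<lambda>s. (s, q)", simplified] continuous_intros)
  have int[simp]: "integrable std_normal_distribution (\<lambda>x. u n j (move n k s q x) q')" for k s q q'
    using integrable_move1[OF n m IH1] .
  have intw[simp]: "integrable std_normal_distribution (\<lambda>x. wt (move n k s q x))" for k s q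
    using integrable_move1[OF n wt_measurable, of 1] by simp
  let ?e = "\<lambda>k q. q + (1 / real n) *\<^sub>R axis k (1::real) :: real^'k"
  have "\<bar>u n (Suc j) s q\<bar> \<le> gr n (Suc j) * wt s" for s q
  proof -
    have "\<bar>\<mu> n k s q / real n + step n k (u n j) s q - 0\<bar> \<le> gr n (Suc j) * wt s" for k
    proof -
      have "\<bar>\<mu> n k s q / real n\<bar> \<le> 2 * C * wt s / real n"
        unfolding abs_divide using order_trans[OF mu_growth[OF n, of k s q] mult_left_mono[OF norm_le_wt(1)[of s]]] C N
        by (intro frac_le) auto
      moreover have "\<bar>step n k (u n j) s q\<bar> \<le> gr n j * ((1 + cw / real n) * wt s)"
      proof -
        have "\<bar>step n k (u n j) s q\<bar> \<le> (\<integral>x. \<bar>u n j (move n k s q x) (?e k q)\<bar> \<partial>std_normal_distribution)"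
          unfolding step_def by (rule integral_abs_bound)
        also have "\<dots> \<le> (\<integral>x. gr n j * wt (move n k s q x) \<partial>std_normal_distribution)"
          by (intro integral_mono) (auto intro: IH1)
        also have "\<dots> \<le> gr n j * ((1 + cw / real n) * wt s)"
          using mult_left_mono[OF integral_wt_move[OF n, of k s q] g] by simp
        finally show ?thesis .
      qed
      moreover have "2 * C * wt s / real n + gr n j * ((1 + cw / real n) * wt s) = (gr n j * (1 + cw / real n) + 2 * C / real n) * wt s"
        by (simp add: algebra_simps)
      ultimately have "\<bar>\<mu> n k s q / real n + step n k (u n j) s q - 0\<bar> \<le> (gr n j * (1 + cw / real n) + 2 * C / real n) * wt s"
        by linarith
      also have "gr n j * (1 + cw / real n) + 2 * C / real n \<le> gr n (Suc j)"
        unfolding gr_Suc using cu_ge C N g cw_ge by (intro add_mono mult_left_mono divide_right_mono) (auto intro: divide_right_mono)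
      finally show ?thesis by (simp add: mult_right_mono)
    qed
    from Max_range_diff_le[of "\<lambda>k. \<mu> n k s q / real n + step n k (u n j) s q" "\<lambda>k. 0", OF this]
    show ?thesis by simp
  qed
  moreover have "\<bar>u n (Suc j) s q - u n (Suc j) s' q\<bar> \<le> gr n (Suc j) * norm (s - s')" for s s' q
  proof -
    have "\<bar>(\<mu> n k s q / real n + step n k (u n j) s q) - (\<mu> n k s' q / real n + step n k (u n j) s' q)\<bar>
        \<le> gr n (Suc j) * norm (s - s')" for k
    proof -
      have 1: "\<bar>\<mu> n k s q / real n - \<mu> n k s' q / real n\<bar> \<le> C * norm (s - s') / real n"
        using mu_lip_s[OF n, of k s q s'] N by (simp add: divide_right_mono flip: diff_divide_distrib)
      \<comment> \<open>\<open>\<tau>\<close> does not depend on \<open>s\<close>, so the noise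
        cancels in the difference of the two moves.\<close>
      have 2: "norm (move n k s q x - move n k s' q x) \<le> (1 + C / real n) * norm (s - s')" for x
      proof -
        have "move n k s q x - move n k s' q x = (s - s') + ((\<mu> n k s q - \<mu> n k s' q) / real n) *\<^sub>R axis k 1"
          by (simp add: move_def incr_def algebra_simps diff_divide_distrib)
        then have "norm (move n k s q x - move n k s' q x) \<le> norm (s - s') + \<bar>\<mu> n k s q / real n - \<mu> n k s' q / real n\<bar>"
          using norm_triangle_ineq[of "s - s'" "((\<mu> n k s q - \<mu> n k s' q) / real n) *\<^sub>R axis k 1"]
          by (simp add: norm_axis_1 diff_divide_distrib)
        with 1 show ?thesis by (simp add: algebra_simps)
      qed
      have "\<bar>step n k (u n j) s q - step n k (u n j) s' q\<bar>
          = \<bar>\<integral>x. u n j (move n k s q x) (?e k q) - u n j (move n k s' q x) (?e k q) \<partial>std_normal_distribution\<bar>"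
        unfolding step_def by simp
      also have "\<dots> \<le> (\<integral>x. \<bar>u n j (move n k s q x) (?e k q) - u n j (move n k s' q x) (?e k q)\<bar> \<partial>std_normal_distribution)"
        by (rule integral_abs_bound)
      also have "\<dots> \<le> (\<integral>x. gr n j * ((1 + C / real n) * norm (s - s')) \<partial>std_normal_distribution)"
        using order_trans[OF IH2 mult_left_mono[OF 2 g]] by (intro integral_mono) auto
      finally have "\<bar>step n k (u n j) s q - step n k (u n j) s' q\<bar> \<le> gr n j * ((1 + C / real n) * norm (s - s'))"
        by simp
      with 1 have "\<bar>(\<mu> n k s q / real n + step n k (u n j) s q) - (\<mu> n k s' q / real n + step n k (u n j) s' q)\<bar>
        \<le> (gr n j * (1 + C / real n) + C / real n) * norm (s - s')" by (simp add: algebra_simps)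
      also have "gr n j * (1 + C / real n) + C / real n \<le> gr n (Suc j)"
        unfolding gr_Suc using cu_ge C N g cw_ge by (intro add_mono mult_left_mono divide_right_mono) (auto intro: divide_right_mono)
      finally show ?thesis by (simp add: mult_right_mono)
    qed
    from Max_range_diff_le[OF this] show ?thesis by simp
  qed
  moreover have "\<bar>u n (Suc j) s q - u n (Suc j) s q'\<bar> \<le> gr n (Suc j) * wt s * norm (q - q')" for s q q'
  proof -
    have "\<bar>(\<mu> n k s q / real n + step n k (u n j) s q) - (\<mu> n k s q' / real n + step n k (u n j) s q')\<bar>
        \<le> gr n (Suc j) * wt s * norm (q - q')" for k
    proof -
      have "C * (1 + norm s) * norm (q - q') \<le> C * (2 * wt s) * norm (q - q')"
        using norm_le_wt(1)[of s] C by (intro mult_mono) auto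
      then have 0: "\<bar>\<mu> n k s q - \<mu> n k s q'\<bar> \<le> 2 * C * wt s * norm (q - q')"
        using mu_lip_q[OF n, of k s q q'] by simp
      then have 1: "\<bar>\<mu> n k s q / real n - \<mu> n k s q' / real n\<bar> \<le> 2 * C * wt s * norm (q - q') / real n"
        using N by (simp add: divide_right_mono flip: diff_divide_distrib)
      \<comment> \<open>Here the noise does not cancel, but \<open>tau_lip\<close> makes its
        contribution of order \<open>1 / n\<close>, which is what an iteration over \<open>n\<close>
        steps can afford.\<close>
      have 2: "norm (move n k s q x - move n k s q' x) \<le> 2 * C * wt s * norm (q - q') / real n * (1 + \<bar>x\<bar>)" for x
      proof -
        have "\<bar>\<tau> n k q / sqrt (real n) * x - \<tau> n k q' / sqrt (real n) * x\<bar> = \<bar>\<tau> n k q - \<tau> n k q'\<bar> / sqrt (real n) * \<bar>x\<bar>"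
          using N by (simp add: abs_mult flip: diff_divide_distrib left_diff_distrib)
        also have "\<dots> \<le> \<bar>\<tau> n k q - \<tau> n k q'\<bar> / 1 * \<bar>x\<bar>"
          using N by (intro mult_right_mono divide_left_mono) auto
        also have "\<dots> \<le> (2 * C * wt s * norm (q - q') / real n) * \<bar>x\<bar>"
        proof -
          have "C * norm (q - q') / real n \<le> 2 * C * wt s * norm (q - q') / real n"
          proof -
            have "C * 1 \<le> C * (2 * wt s)" using C wt_ge_1[of s] by (intro mult_left_mono) linarith+
            then show ?thesis using N by (intro divide_right_mono mult_right_mono) auto
          qed
          then show ?thesis using tau_lip[OF n, of k q q'] by (intro mult_right_mono) auto
        qed
        finally have t: "\<bar>\<tau> n k q / sqrt (real n) * x - \<tau> n k q' / sqrt (real n) * x\<bar> \<le> (2 * C * wt s * norm (q - q') / real n) * \<bar>x\<bar>" .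
        have "move n k s q x - move n k s q' x = ((\<mu> n k s q / real n - \<mu> n k s q' / real n) + (\<tau> n k q / sqrt (real n) * x - \<tau> n k q' / sqrt (real n) * x)) *\<^sub>R axis k 1"
          by (simp add: move_def incr_def algebra_simps)
        then have "norm (move n k s q x - move n k s q' x) = \<bar>(\<mu> n k s q / real n - \<mu> n k s q' / real n) + (\<tau> n k q / sqrt (real n) * x - \<tau> n k q' / sqrt (real n) * x)\<bar>"
          by (simp add: norm_axis_1)
        also have "\<dots> \<le> 2 * C * wt s * norm (q - q') / real n + (2 * C * wt s * norm (q - q') / real n) * \<bar>x\<bar>"
          using 1 t by (intro order_trans[OF abs_triangle_ineq] add_mono)
        finally show ?thesis by (simp add: distrib_left)
      qed
      have 3: "\<bar>u n j (move n k s q x) (?e k q) - u n j (move n k s q' x) (?e k q')\<bar>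
         \<le> gr n j * norm (q - q') * wt (move n k s q x) + gr n j * (2 * C * wt s * norm (q - q') / real n) * (1 + \<bar>x\<bar>) ^ 1" for x
        using IH3[of "move n k s q x" "?e k q" "?e k q'"] order_trans[OF IH2[of "move n k s q x" "?e k q'" "move n k s q' x"] mult_left_mono[OF 2 g]]
        by (simp add: mult_ac)
      have "\<bar>step n k (u n j) s q - step n k (u n j) s q'\<bar>
          = \<bar>\<integral>x. u n j (move n k s q x) (?e k q) - u n j (move n k s q' x) (?e k q') \<partial>std_normal_distribution\<bar>"
        unfolding step_def by simp
      also have "\<dots> \<le> (\<integral>x. \<bar>u n j (move n k s q x) (?e k q) - u n j (move n k s q' x) (?e k q')\<bar> \<partial>std_normal_distribution)"
        by (rule integral_abs_bound)
      also have "\<dots> \<le> (\<integral>x. gr n j * norm (q - q') * wt (move n k s q x) + gr n j * (2 * C * wt s * norm (q - q') / real n) * (1 + \<bar>x\<bar>) ^ 1 \<partial>std_normal_distribution)"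
        using 3 by (intro integral_mono Bochner_Integration.integrable_add integrable_mult_right integrable_std_normal_weight intw) auto
      also have "\<dots> = gr n j * norm (q - q') * (\<integral>x. wt (move n k s q x) \<partial>std_normal_distribution) + gr n j * (2 * C * wt s * norm (q - q') / real n) * normal_weight 1"
        unfolding normal_weight_def
        by (subst Bochner_Integration.integral_add) (auto intro!: integrable_mult_right intw integrable_std_normal_weight[of 1, simplified])
      also have "\<dots> \<le> gr n j * norm (q - q') * ((1 + cw / real n) * wt s) + gr n j * (2 * C * wt s * norm (q - q') / real n) * normal_weight 1"
        using integral_wt_move[OF n, of k s q] g C by (intro add_mono mult_left_mono) auto
      finally have "\<bar>step n k (u n j) s q - step n k (u n j) s q'\<bar> \<le> \<dots>" .
      with 1 have "\<bar>(\<mu> n k s q / real n + step n k (u n j) s q) - (\<mu> n k s q' / real n + step n k (u n j) s q')\<bar>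
        \<le> (gr n j * (1 + (cw + 2 * C * normal_weight 1) / real n) + 2 * C / real n) * (wt s * norm (q - q'))" 
        by (simp add: algebra_simps add_divide_distrib)
      also have "gr n j * (1 + (cw + 2 * C * normal_weight 1) / real n) + 2 * C / real n \<le> gr n (Suc j)"
        unfolding gr_Suc using cu_ge C N g cw_ge by (intro add_mono mult_left_mono divide_right_mono) (auto simp: cu_def intro!: divide_right_mono)
      finally show ?thesis by (simp add: mult_right_mono mult.assoc)
    qed
    from Max_range_diff_le[OF this] show ?thesis by simp
  qed
  ultimately show ?case by blast
qed

lemma u_continuous:
  assumes "n0 \<le> n" shows "continuous_on UNIV (\<lambda>p. u n j (fst p) (snd p))"
  using u_estimates[OF assms, of j] by (intro continuous_of_lip[of "u n j" "gr n j"]) blast+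

lemma u_measurable:
  assumes n: "n0 \<le> n" shows "(\<lambda>s. u n j s q) \<in> borel_measurable borel"
  by (intro borel_measurable_continuous_onI
      continuous_on_compose2[OF u_continuous[OF n], of _ "\<lambda>s. (s, q)", simplified] continuous_intros)

lemma u_integrable:
  assumes n: "n0 \<le> n" shows "integrable std_normal_distribution (\<lambda>x. u n j (move n k s q x) q')"
  using u_estimates[OF n, of j] by (intro integrable_move1[OF n u_measurable[OF n], of _ _ "gr n j"]) auto

lemma wt_integrable:
  assumes n: "n0 \<le> n"
  shows "integrable std_normal_distribution (\<lambda>x. wt (move n k s q x))"
    and "integrable std_normal_distribution (\<lambda>x. wt (move n k s q x) ^ 3)"
proof -
  show "integrable std_normal_distribution (\<lambda>x. wt (move n k s q x))"
    using integrable_move1[OF n wt_measurable, of 1] by simp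
  have [measurable]: "(\<lambda>s. wt s ^ 3) \<in> borel_measurable (borel :: (real^'k) measure)" by measurable
  show "integrable std_normal_distribution (\<lambda>x. wt (move n k s q x) ^ 3)"
    by (rule integrable_move[OF n, of "\<lambda>s. wt s ^ 3" 1]) auto
qed

text \<open>The coefficients do not depend on the round, so the bound for one step propagates:
  this is what makes the value functions Lipschitz in time.\<close>

lemma u_time_step:
  assumes n: "n0 \<le> n"
  shows "\<bar>u n (Suc j) s q - u n j s q\<bar> \<le> (1 + cu / real n) ^ j * (cu / real n) * wt s"
proof (induction j arbitrary: s q)
  case 0
  note N = n_pos[OF n]
  have "\<bar>\<mu> n k s q / real n + step n k (u n 0) s q - 0\<bar> \<le> cu / real n * wt s" for k
  proof -
    have "\<bar>\<mu> n k s q\<bar> \<le> C * (2 * wt s)"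
      using order_trans[OF mu_growth[OF n, of k s q] mult_left_mono[OF norm_le_wt(1)[of s]]] C by simp
    also have "\<dots> = (2 * C) * wt s" by simp
    also have "\<dots> \<le> cu * wt s" using cu_ge cw_ge by (intro mult_right_mono) auto
    finally show ?thesis using N by (simp add: step_def divide_right_mono)
  qed
  from Max_range_diff_le[of "\<lambda>k. \<mu> n k s q / real n + step n k (u n 0) s q" "\<lambda>k. 0", OF this]
  show ?case by simp
next
  case (Suc j)
  note N = n_pos[OF n]
  let ?c = "(1 + cu / real n) ^ j * (cu / real n)"
  have c: "0 \<le> ?c" using cu_ge by simp
  have "\<bar>(\<mu> n k s q / real n + step n k (u n (Suc j)) s q) - (\<mu> n k s q / real n + step n k (u n j) s q)\<bar>
    \<le> (1 + cu / real n) ^ Suc j * (cu / real n) * wt s" for k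
  proof -
    let ?q = "q + (1 / real n) *\<^sub>R axis k 1"
    have "\<bar>(\<mu> n k s q / real n + step n k (u n (Suc j)) s q) - (\<mu> n k s q / real n + step n k (u n j) s q)\<bar>
      = \<bar>\<integral>x. u n (Suc j) (move n k s q x) ?q - u n j (move n k s q x) ?q \<partial>std_normal_distribution\<bar>"
      unfolding step_def using u_integrable[OF n] by (subst Bochner_Integration.integral_diff) (auto simp del: u.simps)
    also have "\<dots> \<le> (\<integral>x. \<bar>u n (Suc j) (move n k s q x) ?q - u n j (move n k s q x) ?q\<bar> \<partial>std_normal_distribution)"
      by (rule integral_abs_bound)
    also have "\<dots> \<le> (\<integral>x. ?c * wt (move n k s q x) \<partial>std_normal_distribution)"
      using Suc.IH by (intro integral_mono integrable_abs Bochner_Integration.integrable_diff u_integrable[OF n] integrable_mult_right wt_integrable[OF n]) auto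
    also have "\<dots> \<le> ?c * ((1 + cw / real n) * wt s)"
      using mult_left_mono[OF integral_wt_move[OF n, of k s q] c] by simp
    also have "\<dots> \<le> ?c * ((1 + cu / real n) * wt s)"
      using c N cu_ge C by (intro mult_left_mono mult_right_mono add_left_mono divide_right_mono) auto
    finally show ?thesis by (simp add: mult_ac)
  qed
  from Max_range_diff_le[OF this] show ?case by simp
qed

text \<open>\<open>exp (2 * cu)\<close> bounds the Gronwall factor over \<open>2 * n\<close> steps,
  and the factor \<open>cu\<close> comes from the size of one time step. The range extends beyond
  \<open>n\<close> because mollification in time looks past the horizon.\<close>

definition G :: real where "G = cu * exp (2 * cu)"

lemma G_ge: "exp (2 * cu) \<le> G" "1 \<le> G"
proof -
  have "1 * exp (2 * cu) \<le> G" unfolding G_def using cu_ge by (intro mult_right_mono) auto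
  then show "exp (2 * cu) \<le> G" "1 \<le> G" using cu_ge one_le_exp_iff[of "2 * cu"] by linarith+
qed

lemma power_le_exp2:
  assumes "j \<le> 2 * n" "0 \<le> c" "0 < n" shows "(1 + c / real n) ^ j \<le> exp (2 * c)"
proof -
  have "(1 + c / real n) ^ j \<le> exp (c / real n) ^ j"
    using assms by (intro power_mono exp_ge_add_one_self) auto
  also have "\<dots> = exp (real j * (c / real n))" by (rule exp_of_nat_mult[symmetric])
  also have "\<dots> \<le> exp (2 * c)"
  proof -
    have "real j * (c / real n) \<le> (2 * real n) * (c / real n)" using assms by (intro mult_right_mono) auto
    then show ?thesis using assms by simp
  qed
  finally show ?thesis .
qed

lemma u_growth:
  assumes n: "n0 \<le> n" and j: "j \<le> 2 * n"
  shows "\<bar>u n j s q\<bar> \<le> G * wt s"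
proof -
  have "gr n j \<le> G" using power_le_exp2[OF j cu_ge(3)] n_pos[OF n] G_ge(1) by (simp add: gr_def)
  then have "gr n j * wt s \<le> G * wt s" by (intro mult_right_mono) auto
  then show ?thesis using u_estimates[OF n, of j] by (meson order_trans)
qed

lemma u_time:
  assumes n: "n0 \<le> n" and j: "j \<le> 2 * n" "j' \<le> 2 * n"
  shows "\<bar>u n j s q - u n j' s q\<bar> \<le> G * (\<bar>real j - real j'\<bar> / real n) * wt s"
proof -
  have *: "\<bar>u n (j + p) s q - u n j s q\<bar> \<le> G * (real p / real n) * wt s" if "j + p \<le> 2 * n" for j p
    using that
  proof (induction p)
    case (Suc p)
    have "(1 + cu / real n) ^ (j + p) * (cu / real n) * wt s \<le> exp (2 * cu) * (cu / real n) * wt s"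
      using Suc.prems cu_ge n_pos[OF n] by (intro mult_right_mono power_le_exp2) auto
    then have "\<bar>u n (j + Suc p) s q - u n (j + p) s q\<bar> \<le> G / real n * wt s"
      using u_time_step[OF n, of "j + p" s q] by (simp add: G_def mult_ac)
    moreover have "\<bar>u n (j + p) s q - u n j s q\<bar> \<le> G * (real p / real n) * wt s" using Suc by simp
    moreover have "G * (real (Suc p) / real n) * wt s = G * (real p / real n) * wt s + G / real n * wt s"
      by (simp add: algebra_simps add_divide_distrib)
    ultimately show ?case by linarith
  qed simp
  show ?thesis
  proof (cases "j \<le> j'")
    case True
    then show ?thesis using *[of j "j' - j"] j by (simp add: abs_minus_commute of_nat_diff)
  next
    case False
    then show ?thesis using *[of j' "j - j'"] j by (simp add: of_nat_diff)
  qed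
qed

lemma u_lip:
  assumes n: "n0 \<le> n" and j: "j \<le> 2 * n" "j' \<le> 2 * n"
  shows "\<bar>u n j s q - u n j' s' q'\<bar>
    \<le> G * (\<bar>real j - real j'\<bar> / real n) * wt s + G * norm (s - s') + G * wt s * norm (q - q')"
proof -
  have g: "gr n j' \<le> G" using power_le_exp2[OF j(2) cu_ge(3)] n_pos[OF n] G_ge(1) by (simp add: gr_def)
  have "\<bar>u n j' s q - u n j' s q'\<bar> \<le> gr n j' * (wt s * norm (q - q'))"
    using u_estimates[OF n, of j'] by (simp add: mult.assoc)
  also have "\<dots> \<le> G * (wt s * norm (q - q'))" using g by (intro mult_right_mono) auto
  finally have 1: "\<bar>u n j' s q - u n j' s q'\<bar> \<le> G * wt s * norm (q - q')" by (simp add: mult.assoc)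
  have "\<bar>u n j' s q' - u n j' s' q'\<bar> \<le> gr n j' * norm (s - s')"
    using u_estimates[OF n, of j'] by blast
  also have "\<dots> \<le> G * norm (s - s')" using g by (intro mult_right_mono) auto
  finally have 2: "\<bar>u n j' s q' - u n j' s' q'\<bar> \<le> G * norm (s - s')" .
  show ?thesis using 1 2 u_time[OF n j, of s q] by linarith
qed

end

subsection \<open>Mollification\<close>

text \<open>If \<open>t\<close> and \<open>t + y\<close> are nonnegative, this is the exact
  expansion of a fourth power. If \<open>t\<close> is nonnegative and \<open>t + y\<close> negative,
  the polynomial \<open>(m + y)^4\<close> is replaced by 0, an error of at most \<open>y^4\<close>;
  if \<open>t\<close> is negative, the value itself is at most \<open>y^4\<close>.\<close>

lemma pos_part_pow4_expand:
  fixes t y :: real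
  defines "m \<equiv> max 0 t"
  shows "\<bar>max 0 (t + y) ^ 4 - m ^ 4 - 4 * m ^ 3 * y - 6 * m\<^sup>2 * y\<^sup>2\<bar> \<le> 4 * m * \<bar>y\<bar> ^ 3 + 2 * y ^ 4"
proof -
  have ex: "(m + y) ^ 4 = m ^ 4 + 4 * m ^ 3 * y + 6 * m\<^sup>2 * y\<^sup>2 + 4 * m * y ^ 3 + y ^ 4"
    by (simp add: power2_eq_square power3_eq_cube power4_eq_xxxx algebra_simps)
  have m0: "0 \<le> m" by (simp add: m_def)
  have y4: "0 \<le> y ^ 4" by simp
  have m3: "\<bar>4 * m * y ^ 3\<bar> = 4 * m * \<bar>y\<bar> ^ 3" using m0 by (simp add: abs_mult power_abs)
  consider "0 \<le> t" "0 \<le> t + y" | "0 \<le> t" "t + y < 0" | "t < 0" by linarith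
  then show ?thesis
  proof cases
    case 1
    then have "max 0 (t + y) = m + y" by (simp add: m_def)
    then have "max 0 (t + y) ^ 4 = (m + y) ^ 4" by simp
    then show ?thesis using ex m3 y4 abs_le_iff[of "4 * m * y ^ 3 + y ^ 4"] by linarith
  next
    case 2
    then have "m + y < 0" "max 0 (t + y) = 0" by (auto simp: m_def)
    moreover have "\<bar>m + y\<bar> ^ 4 \<le> \<bar>y\<bar> ^ 4" using \<open>m + y < 0\<close> m0 by (intro power_mono) auto
    then have "(m + y) ^ 4 \<le> y ^ 4" by simp
    moreover have "0 \<le> (m + y) ^ 4" by simp
    ultimately show ?thesis using ex m3 y4 by simp
  next
    case 3
    then have m: "m = 0" by (simp add: m_def)
    have "max 0 (t + y) ^ 4 \<le> \<bar>y\<bar> ^ 4" using 3 by (intro power_mono) auto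
    then have "max 0 (t + y) ^ 4 \<le> y ^ 4" by simp
    moreover have "0 \<le> max 0 (t + y) ^ 4" by simp
    ultimately have "\<bar>max 0 (t + y) ^ 4\<bar> \<le> 2 * y ^ 4" using y4 by linarith
    then show ?thesis by (simp add: m)
  qed
qed

text \<open>The fourth power of the positive part is regular enough for a second-order expansion
  with cubic remainder, and close enough to a polynomial for explicit bounds.\<close>

definition bump :: "real \<Rightarrow> 'a::euclidean_space \<Rightarrow> real" where
  "bump e x = max 0 (e\<^sup>2 - (norm x)\<^sup>2) ^ 4"

text \<open>The derivative of \<open>bump e (x - d)\<close> in \<open>d\<close> at 0, that is, minus
  the gradient of \<open>bump e\<close>: with this sign derivatives of a mollified function fall on
  the kernel.\<close>

definition bump_grad :: "real \<Rightarrow> 'a::euclidean_space \<Rightarrow> 'a" where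
  "bump_grad e x = (8 * max 0 (e\<^sup>2 - (norm x)\<^sup>2) ^ 3) *\<^sub>R x"

definition bump_hess :: "real \<Rightarrow> 'a::euclidean_space \<Rightarrow> 'a \<Rightarrow> 'a \<Rightarrow> real" where
  "bump_hess e x a b = 48 * max 0 (e\<^sup>2 - (norm x)\<^sup>2) ^ 2 * (x \<bullet> a) * (x \<bullet> b) - 8 * max 0 (e\<^sup>2 - (norm x)\<^sup>2) ^ 3 * (a \<bullet> b)"

lemma bump_zero:
  assumes "0 < e" "e \<le> norm x"
  shows "bump e x = 0" "bump_grad e x = 0" "bump_hess e x a b = 0"
proof -
  have "e\<^sup>2 \<le> (norm x)\<^sup>2" using assms by (intro power_mono) auto
  then have "max 0 (e\<^sup>2 - (norm x)\<^sup>2) = 0" by simp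
  then show "bump e x = 0" "bump_grad e x = 0" "bump_hess e x a b = 0"
    by (simp_all add: bump_def bump_grad_def bump_hess_def)
qed

lemma bump_nonneg: "0 \<le> bump e x" by (simp add: bump_def)

lemma bump_measurable [measurable]: "bump e \<in> borel_measurable borel"
  "bump_grad e \<in> borel_measurable borel" "(\<lambda>x. bump_hess e x a b) \<in> borel_measurable borel"
  unfolding bump_def[abs_def] bump_grad_def[abs_def] bump_hess_def by measurable

lemma bump_bounds:
  assumes e: "0 < e" "e \<le> 1"
  shows "\<bar>bump e x\<bar> \<le> 1" "norm (bump_grad e x) \<le> 8" "\<bar>bump_hess e x a b\<bar> \<le> 56 * norm a * norm b"
proof -
  let ?m = "max 0 (e\<^sup>2 - (norm x)\<^sup>2)"
  have m: "0 \<le> ?m" "?m \<le> 1" using e power_le_one[of e 2] by (auto simp: le_max_iff_disj intro: order_trans[of _ "e\<^sup>2"])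
  have mp: "0 \<le> ?m ^ i" "?m ^ i \<le> 1" for i using m by (auto intro: power_le_one)
  show "\<bar>bump e x\<bar> \<le> 1" using mp[of 4] by (simp add: bump_def)
  show "norm (bump_grad e x) \<le> 8"
  proof (cases "norm x \<le> 1")
    case True
    then show ?thesis using mult_mono[OF mp(2)[of 3] True] mp[of 3] by (simp add: bump_grad_def abs_mult)
  next
    case False
    then show ?thesis using bump_zero(2)[of e x] e by simp
  qed
  show "\<bar>bump_hess e x a b\<bar> \<le> 56 * norm a * norm b"
  proof (cases "norm x \<le> 1")
    case True
    have xa: "\<bar>x \<bullet> v\<bar> \<le> norm v" for v
      using Cauchy_Schwarz_ineq2[of x v] mult_right_mono[OF True, of "norm v"] by simp
    have "\<bar>?m ^ 2 * ((x \<bullet> a) * (x \<bullet> b))\<bar> \<le> 1 * (norm a * norm b)"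
      unfolding abs_mult using xa[of a] xa[of b] mp[of 2] by (intro mult_mono) auto
    moreover have "\<bar>?m ^ 3 * (a \<bullet> b)\<bar> \<le> 1 * (norm a * norm b)"
      unfolding abs_mult using Cauchy_Schwarz_ineq2[of a b] mp[of 3] by (intro mult_mono) auto
    moreover have "bump_hess e x a b = 48 * (?m ^ 2 * ((x \<bullet> a) * (x \<bullet> b))) - 8 * (?m ^ 3 * (a \<bullet> b))"
      by (simp add: bump_hess_def)
    ultimately show ?thesis by linarith
  next
    case False
    then show ?thesis using bump_zero(3)[of e x a b] e by simp
  qed
qed

text \<open>With \<open>t = e^2 - norm x ^ 2\<close>, the shift by \<open>d\<close> changes
  \<open>t\<close> by \<open>y = 2 * (x \<bullet> d) - norm d ^ 2\<close>, and
  \<open>pos_part_pow4_expand\<close> applies. The constant is 1750 from the remainder in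
  \<open>y\<close>, where \<open>\<bar>y\<bar> \<le> 5 * norm d\<close>, plus 54 from the parts of
  \<open>y^2\<close> beyond second order in \<open>d\<close>. For \<open>norm x > 2\<close> the
  shifted and the unshifted bump both vanish.\<close>

lemma bump_expand:
  assumes e: "0 < e" "e \<le> 1" and d: "norm d \<le> 1"
  shows "\<bar>bump e (x - d) - bump e x - bump_grad e x \<bullet> d - bump_hess e x d d / 2\<bar>
    \<le> 1804 * norm d ^ 3 * indicator (cball 0 2) x"
proof (cases "norm x \<le> 2")
  case False
  have "norm x \<le> norm (x - d) + norm d" using norm_triangle_ineq[of "x - d" d] by simp
  then show ?thesis using False bump_zero[of e x] bump_zero(1)[of e "x - d"] e d by simp
next
  case True
  define t where "t = e\<^sup>2 - (norm x)\<^sup>2"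
  define m where "m = max 0 t"
  define y where "y = 2 * (x \<bullet> d) - (norm d)\<^sup>2"
  have m: "0 \<le> m" "m \<le> 1" using e power_le_one[of e 2]
    by (auto simp: m_def t_def le_max_iff_disj intro: order_trans[of _ "e\<^sup>2"])
  let ?D = "norm d"
  have Dp: "?D ^ Suc i \<le> ?D ^ j" if "j \<le> Suc i" for i j using d that by (intro power_decreasing) auto
  have xd: "\<bar>x \<bullet> d\<bar> \<le> 2 * ?D" using Cauchy_Schwarz_ineq2[of x d] mult_right_mono[OF True, of ?D] by simp
  have y: "\<bar>y\<bar> \<le> 5 * ?D" 
  proof -
    have "?D\<^sup>2 \<le> ?D" using Dp[of 1 1] by (simp add: numeral_2_eq_2)
    moreover have "0 \<le> ?D\<^sup>2" by simp
    ultimately show ?thesis unfolding y_def using xd by linarith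
  qed
  have b: "bump e (x - d) = max 0 (t + y) ^ 4"
    by (simp add: bump_def t_def y_def power2_norm_eq_inner inner_diff inner_commute algebra_simps)
  have y2: "y\<^sup>2 = 4 * (x \<bullet> d)\<^sup>2 - 4 * ((x \<bullet> d) * ?D\<^sup>2) + ?D ^ 4"
    by (simp add: y_def power2_eq_square power4_eq_xxxx algebra_simps)
  have e1: "bump e (x - d) - bump e x - bump_grad e x \<bullet> d - bump_hess e x d d / 2
     = (max 0 (t + y) ^ 4 - m ^ 4 - 4 * m ^ 3 * y - 6 * m\<^sup>2 * y\<^sup>2) + (6 * m\<^sup>2) * (?D ^ 4 - 4 * ((x \<bullet> d) * ?D\<^sup>2))"
  proof -
    have 1: "bump e x = m ^ 4" by (simp add: bump_def m_def t_def)
    have 2: "bump_grad e x \<bullet> d = 8 * m ^ 3 * (x \<bullet> d)" by (simp add: bump_grad_def m_def t_def)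
    have 3: "bump_hess e x d d = 48 * m\<^sup>2 * (x \<bullet> d)\<^sup>2 - 8 * m ^ 3 * ?D\<^sup>2"
      by (simp add: bump_hess_def m_def t_def power2_norm_eq_inner) (simp add: power2_eq_square)
    show ?thesis unfolding b 1 2 3 y2 by (simp add: y_def algebra_simps diff_divide_distrib)
  qed
  have "\<bar>max 0 (t + y) ^ 4 - m ^ 4 - 4 * m ^ 3 * y - 6 * m\<^sup>2 * y\<^sup>2\<bar> \<le> 4 * m * \<bar>y\<bar> ^ 3 + 2 * y ^ 4"
    using pos_part_pow4_expand[of t y] by (simp add: m_def)
  also have "\<dots> \<le> 4 * 1 * (5 * ?D) ^ 3 + 2 * (5 * ?D) ^ 4"
  proof -
    have "\<bar>y\<bar> ^ 4 \<le> (5 * ?D) ^ 4" using y by (intro power_mono) auto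
    moreover have "4 * m * \<bar>y\<bar> ^ 3 \<le> 4 * 1 * (5 * ?D) ^ 3" using m y by (intro mult_mono power_mono) auto
    moreover have "\<bar>y\<bar> ^ 4 = y ^ 4" by simp
    ultimately show ?thesis by linarith
  qed
  also have "\<dots> \<le> 1750 * ?D ^ 3" using Dp[of 3 3] by (simp add: power_mult_distrib)
  finally have 1: "\<bar>max 0 (t + y) ^ 4 - m ^ 4 - 4 * m ^ 3 * y - 6 * m\<^sup>2 * y\<^sup>2\<bar> \<le> 1750 * ?D ^ 3" .
  have "\<bar>(x \<bullet> d) * ?D\<^sup>2\<bar> \<le> (2 * ?D) * ?D\<^sup>2" unfolding abs_mult using xd by (intro mult_mono) auto
  moreover have "(2 * ?D) * ?D\<^sup>2 = 2 * ?D ^ 3" by (simp add: power2_eq_square power3_eq_cube)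
  moreover have "?D ^ 4 \<le> ?D ^ 3" by (rule power_decreasing) (use d in auto)
  moreover have "0 \<le> ?D ^ 4" by simp
  ultimately have "\<bar>?D ^ 4 - 4 * ((x \<bullet> d) * ?D\<^sup>2)\<bar> \<le> 9 * ?D ^ 3" by linarith
  moreover have "m\<^sup>2 \<le> 1" using m by (simp add: power_le_one)
  ultimately have "\<bar>(6 * m\<^sup>2) * (?D ^ 4 - 4 * ((x \<bullet> d) * ?D\<^sup>2))\<bar> \<le> 6 * (9 * ?D ^ 3)"
    unfolding abs_mult[of "6 * m\<^sup>2"] by (intro mult_mono) auto
  with 1 have "\<bar>bump e (x - d) - bump e x - bump_grad e x \<bullet> d - bump_hess e x d d / 2\<bar> \<le> 1804 * ?D ^ 3"
    unfolding e1 by linarith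
  then show ?thesis using True by simp
qed

text \<open>The type argument records the space of integration, which \<open>e\<close> does not
  determine.\<close>

definition bump_mass :: "'a::euclidean_space itself \<Rightarrow> real \<Rightarrow> real" where
  "bump_mass T e = (\<integral>x. bump e (x :: 'a) \<partial>lborel)"

definition moll :: "real \<Rightarrow> 'a::euclidean_space measure" where
  "moll e = density lborel (\<lambda>x. ennreal (bump e x / bump_mass TYPE('a) e))"

lemma integrable_cball_bound:
  fixes g :: "'a::euclidean_space \<Rightarrow> real"
  assumes [measurable]: "g \<in> borel_measurable borel" and b: "\<And>x. \<bar>g x\<bar> \<le> M * indicator (cball 0 2) x"
  shows "integrable lborel g" "\<bar>\<integral>x. g x \<partial>lborel\<bar> \<le> M * measure lborel (cball (0::'a) 2)"
proof -
  have c: "emeasure lborel (cball (0::'a) 2) < \<infinity>" using emeasure_bounded_finite[of "cball (0::'a) 2"] by simp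
  have i: "integrable lborel (\<lambda>x. M * indicator (cball (0::'a) 2) x)" using c by simp
  have M: "0 \<le> M" using b[of 0] by simp
  show g: "integrable lborel g"
    by (rule Bochner_Integration.integrable_bound[OF i]) (use b M in \<open>auto simp: abs_mult\<close>)
  have "\<bar>\<integral>x. g x \<partial>lborel\<bar> \<le> (\<integral>x. \<bar>g x\<bar> \<partial>lborel)" by (rule integral_abs_bound)
  also have "\<dots> \<le> (\<integral>x. M * indicator (cball (0::'a) 2) x \<partial>lborel)"
    by (intro integral_mono integrable_abs g i b)
  finally show "\<bar>\<integral>x. g x \<partial>lborel\<bar> \<le> M * measure lborel (cball (0::'a) 2)" using c by simp
qed

lemma bump_integrable:
  assumes e: "0 < e" "e \<le> 1" shows "integrable lborel (bump e :: 'a::euclidean_space \<Rightarrow> real)"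
proof (rule integrable_cball_bound(1))
  fix x :: 'a
  show "\<bar>bump e x\<bar> \<le> 1 * indicator (cball 0 2) x"
    using bump_bounds(1)[OF e, of x] bump_zero(1)[of e x] e by (cases "norm x \<le> 2") auto
qed simp

lemma bump_mass_pos:
  assumes e: "0 < e" "e \<le> 1" shows "0 < bump_mass TYPE('a::euclidean_space) e"
proof -
  let ?c = "(3 / 4 * e\<^sup>2) ^ 4" and ?S = "ball (0::'a) (e / 2)"
  have "integrable lborel (\<lambda>x. ?c * indicator ?S x)" using emeasure_bounded_finite[of ?S] by simp
  moreover have "?c * indicator ?S x \<le> bump e x" for x
  proof (cases "norm x < e / 2")
    case True
    then have "(norm x)\<^sup>2 \<le> (e / 2)\<^sup>2" by (intro power_mono) auto
    then have "3 / 4 * e\<^sup>2 \<le> e\<^sup>2 - (norm x)\<^sup>2" by (simp add: power2_eq_square)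
    then have "3 / 4 * e\<^sup>2 \<le> max 0 (e\<^sup>2 - (norm x)\<^sup>2)" by (rule max.coboundedI2)
    then show ?thesis using True by (simp add: bump_def power_mono)
  qed (simp add: bump_nonneg)
  ultimately have "(\<integral>x. ?c * indicator ?S x \<partial>lborel) \<le> bump_mass TYPE('a) e"
    unfolding bump_mass_def by (intro integral_mono bump_integrable[OF e]) auto
  moreover have "0 < measure lborel ?S" using e by (intro content_ball_pos) simp
  then have "0 < (\<integral>x. ?c * indicator ?S x \<partial>lborel)"
    using e emeasure_bounded_finite[of ?S] by simp
  ultimately show ?thesis by linarith
qed

context
  fixes e :: real
  assumes e: "0 < e" "e \<le> 1"
begin

lemma moll_measurable_cong [measurable_cong, simp]: "sets (moll e :: 'a::euclidean_space measure) = sets borel"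
  by (simp add: moll_def)

lemma moll_prob: "prob_space (moll e :: 'a::euclidean_space measure)"
proof
  let ?Z = "bump_mass TYPE('a) e"
  have Z: "0 < ?Z" by (rule bump_mass_pos[OF e])
  have "emeasure (moll e :: 'a measure) (space (moll e)) = (\<integral>\<^sup>+x. ennreal (bump e (x :: 'a) / ?Z) \<partial>lborel)"
    unfolding moll_def by (subst emeasure_density) auto
  also have "\<dots> = ennreal (\<integral>x. bump e (x :: 'a) / ?Z \<partial>lborel)"
    using Z bump_integrable[OF e, where 'a='a] by (intro nn_integral_eq_integral) (auto simp: bump_nonneg)
  also have "(\<integral>x. bump e (x :: 'a) / ?Z \<partial>lborel) = 1"
    using Z by (simp add: bump_mass_def)
  finally show "emeasure (moll e :: 'a measure) (space (moll e)) = 1" by simp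
qed

lemma moll_AE: "AE x in (moll e :: 'a::euclidean_space measure). norm x < e"
proof -
  have "norm x < e" if "0 < ennreal (bump e (x::'a) / bump_mass TYPE('a) e)" for x
    using that bump_zero(1)[OF e(1), of x] by (cases "norm x < e") auto
  then show ?thesis unfolding moll_def by (subst AE_density) auto
qed

lemma moll_integral_eq:
  fixes f :: "'a::euclidean_space \<Rightarrow> real"
  assumes [measurable]: "f \<in> borel_measurable borel"
  shows "(\<integral>x. f x \<partial>moll e) = (\<integral>x. f x * bump e x \<partial>lborel) / bump_mass TYPE('a) e"
proof -
  have Z: "0 < bump_mass TYPE('a) e" by (rule bump_mass_pos[OF e])
  have "(\<integral>x. f x \<partial>moll e) = (\<integral>x. bump e x / bump_mass TYPE('a) e * f x \<partial>lborel)"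
    unfolding moll_def using Z by (subst integral_density) (auto simp: bump_nonneg)
  also have "\<dots> = (\<integral>x. f x * bump e x / bump_mass TYPE('a) e \<partial>lborel)"
    by (intro Bochner_Integration.integral_cong) auto
  finally show ?thesis by simp
qed

lemma moll_bounded:
  fixes f :: "'a::euclidean_space \<Rightarrow> real"
  assumes [measurable]: "f \<in> borel_measurable borel" and b: "\<And>x. norm x < e \<Longrightarrow> \<bar>f x\<bar> \<le> M"
  shows "integrable (moll e) f" "\<bar>\<integral>x. f x \<partial>moll e\<bar> \<le> M"
proof -
  interpret prob_space "moll e :: 'a measure" by (rule moll_prob)
  have AE: "AE x in (moll e :: 'a measure). norm (f x) \<le> M" using moll_AE b by (auto elim: AE_mp)
  show i: "integrable (moll e) f" by (rule integrable_const_bound[OF AE]) simp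
  have "\<bar>\<integral>x. f x \<partial>moll e\<bar> \<le> (\<integral>x. \<bar>f x\<bar> \<partial>moll e)" by (rule integral_abs_bound)
  also have "\<dots> \<le> (\<integral>x. M \<partial>(moll e :: 'a measure))" using AE i by (intro integral_mono_AE) auto
  finally show "\<bar>\<integral>x. f x \<partial>moll e\<bar> \<le> M" by (simp add: prob_space)
qed

text \<open>All derivatives are put on the kernel: \<open>p\<close> and \<open>B\<close> integrate
  \<open>V\<close> against \<open>bump_grad\<close> and \<open>bump_hess\<close>, so measurability
  and quadratic growth of \<open>V\<close> suffice. The constant depends on \<open>e\<close> and the
  space, but not on \<open>V\<close>, \<open>z\<close> or \<open>R\<close>. The remainder is cubic
  for every \<open>d\<close>, large ones included, because the increments of the scheme are Gaussian
  and hence unbounded.\<close>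

lemma moll_jet:
  "\<exists>c\<ge>0. \<forall>(V :: 'a::euclidean_space \<Rightarrow> real) z R. V \<in> borel_measurable borel \<longrightarrow> (\<forall>x. \<bar>V (z + x)\<bar> \<le> R * (1 + (norm x)\<^sup>2)) \<longrightarrow>
    (\<exists>p B. bilinear B \<and> norm p \<le> c * R \<and> (\<forall>a b. \<bar>B a b\<bar> \<le> c * R * norm a * norm b) \<and>
      (\<forall>d. \<bar>(\<integral>x. V (z + d + x) \<partial>moll e) - (\<integral>x. V (z + x) \<partial>moll e) - p \<bullet> d - B d d / 2\<bar> \<le> c * R * norm d ^ 3))"
proof -
  define Z where "Z = bump_mass TYPE('a) e"
  have Z: "0 < Z" unfolding Z_def by (rule bump_mass_pos[OF e])
  define vol where "vol = measure lborel (cball (0::'a) 2)"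
  have vol: "0 \<le> vol" by (simp add: vol_def)
  \<comment> \<open>5 bounds \<open>1 + norm x ^ 2\<close> on the ball of radius 2.\<close>
  define c1 where "c1 = 5 * vol / Z"
  have c1: "0 \<le> c1" using vol Z by (simp add: c1_def)
  \<comment> \<open>1804 belongs to \<open>norm d \<le> 1\<close>. The other terms belong to
    \<open>norm d > 1\<close>: 7 = 5 + 2 from the two averages of \<open>V\<close>, and 36 = 8 + 56
    / 2 from \<open>p\<close> and \<open>B\<close>.\<close>
  define c where "c = 1804 * c1 + 7 + 36 * c1"
  have c: "0 \<le> c" using c1 by (simp add: c_def)
  show ?thesis
  proof (intro exI[of _ c] conjI allI impI c)
    fix V :: "'a \<Rightarrow> real" and z :: 'a and R :: real
    assume V[measurable]: "V \<in> borel_measurable borel" and b: "\<forall>x. \<bar>V (z + x)\<bar> \<le> R * (1 + (norm x)\<^sup>2)"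
    have R: "0 \<le> R" using b[rule_format, of 0] by simp
    have key: "integrable lborel (\<lambda>x. V (z + x) * g x)"
      "\<bar>(\<integral>x. V (z + x) * g x \<partial>lborel) / Z\<bar> \<le> c1 * R * M"
      if [measurable]: "g \<in> borel_measurable borel" and g: "\<And>x. \<bar>g x\<bar> \<le> M * indicator (cball 0 2) x" for g :: "'a \<Rightarrow> real" and M
    proof -
      have M: "0 \<le> M" using g[of 0] by simp
      have bb: "\<bar>V (z + x) * g x\<bar> \<le> (5 * R * M) * indicator (cball 0 2) x" for x
      proof (cases "norm x \<le> 2")
        case True
        have "(norm x)\<^sup>2 \<le> 2\<^sup>2" using True by (intro power_mono) auto
        then have "R * (1 + (norm x)\<^sup>2) \<le> R * 5" using R by (intro mult_left_mono) auto
        then have "\<bar>V (z + x)\<bar> \<le> 5 * R" using b[rule_format, of x] by linarith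
        then show ?thesis unfolding abs_mult using g[of x] True R by (simp add: mult_mono)
      next
        case False
        then show ?thesis using g[of x] by simp
      qed
      have m: "(\<lambda>x. V (z + x) * g x) \<in> borel_measurable borel" by measurable
      show "integrable lborel (\<lambda>x. V (z + x) * g x)" by (rule integrable_cball_bound(1)[OF m bb])
      have "\<bar>\<integral>x. V (z + x) * g x \<partial>lborel\<bar> \<le> 5 * R * M * vol"
        unfolding vol_def by (rule integrable_cball_bound(2)[OF m bb])
      then show "\<bar>(\<integral>x. V (z + x) * g x \<partial>lborel) / Z\<bar> \<le> c1 * R * M"
        using Z by (simp add: c1_def divide_right_mono mult_ac)
    qed
    have cut: "\<bar>g x\<bar> \<le> M * indicator (cball 0 2) x" if "norm x > 2 \<Longrightarrow> g x = 0" "\<bar>g x\<bar> \<le> M" for g :: "'a \<Rightarrow> real" and x M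
      using that by (cases "norm x \<le> 2") auto
    have kG: "integrable lborel (\<lambda>x. V (z + x) * (bump_grad e x \<bullet> d))"
      "\<bar>(\<integral>x. V (z + x) * (bump_grad e x \<bullet> d) \<partial>lborel) / Z\<bar> \<le> c1 * R * (8 * norm d)" for d
    proof -
      have "\<bar>bump_grad e x \<bullet> d\<bar> \<le> (8 * norm d) * indicator (cball 0 2) x" for x
        using bump_zero(2)[of e x] e order_trans[OF Cauchy_Schwarz_ineq2 mult_right_mono[OF bump_bounds(2)[OF e]]]
        by (intro cut) auto
      then show "integrable lborel (\<lambda>x. V (z + x) * (bump_grad e x \<bullet> d))"
        "\<bar>(\<integral>x. V (z + x) * (bump_grad e x \<bullet> d) \<partial>lborel) / Z\<bar> \<le> c1 * R * (8 * norm d)"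
        using key[of "\<lambda>x. bump_grad e x \<bullet> d" "8 * norm d"] by auto
    qed
    have kH: "integrable lborel (\<lambda>x. V (z + x) * bump_hess e x a d)"
      "\<bar>(\<integral>x. V (z + x) * bump_hess e x a d \<partial>lborel) / Z\<bar> \<le> c1 * R * (56 * norm a * norm d)" for a d
    proof -
      have "\<bar>bump_hess e x a d\<bar> \<le> (56 * norm a * norm d) * indicator (cball 0 2) x" for x
        using bump_zero(3)[of e x] e bump_bounds(3)[OF e] by (intro cut) auto
      then show "integrable lborel (\<lambda>x. V (z + x) * bump_hess e x a d)"
      "\<bar>(\<integral>x. V (z + x) * bump_hess e x a d \<partial>lborel) / Z\<bar> \<le> c1 * R * (56 * norm a * norm d)"
        using key[of "\<lambda>x. bump_hess e x a d" "56 * norm a * norm d"] by auto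
    qed
    define p where "p = (\<Sum>i\<in>Basis. ((\<integral>x. V (z + x) * (bump_grad e x \<bullet> i) \<partial>lborel) / Z) *\<^sub>R i)"
    define B where "B a d = (\<integral>x. V (z + x) * bump_hess e x a d \<partial>lborel) / Z" for a d
    have pd: "p \<bullet> d = (\<integral>x. V (z + x) * (bump_grad e x \<bullet> d) \<partial>lborel) / Z" for d
    proof -
      have "(\<integral>x. V (z + x) * (bump_grad e x \<bullet> d) \<partial>lborel) = (\<integral>x. (\<Sum>i\<in>Basis. (V (z + x) * (bump_grad e x \<bullet> i)) * (d \<bullet> i)) \<partial>lborel)"
        by (subst euclidean_inner) (simp add: sum_distrib_left mult_ac)
      also have "\<dots> = (\<Sum>i\<in>Basis. (\<integral>x. V (z + x) * (bump_grad e x \<bullet> i) \<partial>lborel) * (d \<bullet> i))"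
        using kG(1) by (subst Bochner_Integration.integral_sum) auto
      finally show ?thesis
        unfolding p_def inner_sum_left inner_scaleR_left sum_divide_distrib
        by simp (metis (no_types, lifting) inner_commute sum.cong sum_divide_distrib)
    qed
    have pb: "\<bar>p \<bullet> d\<bar> \<le> c * R * norm d" for d
    proof -
      have "\<bar>p \<bullet> d\<bar> \<le> c1 * R * (8 * norm d)" unfolding pd by (rule kG(2))
      also have "\<dots> = (8 * c1) * (R * norm d)" by simp
      also have "\<dots> \<le> c * (R * norm d)" using c1 R by (intro mult_right_mono) (auto simp: c_def)
      finally show ?thesis by simp
    qed
    have Bb: "\<bar>B a d\<bar> \<le> c * R * norm a * norm d" for a d
    proof -
      have "\<bar>B a d\<bar> \<le> c1 * R * (56 * norm a * norm d)" unfolding B_def by (rule kH(2))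
      also have "\<dots> = (56 * c1) * (R * norm a * norm d)" by simp
      also have "\<dots> \<le> c * (R * norm a * norm d)" using c1 R by (intro mult_right_mono) (auto simp: c_def)
      finally show ?thesis by (simp add: mult.assoc)
    qed
    have lin: "bilinear B"
    proof -
      have "B (a + a') d = B a d + B a' d" "B d (a + a') = B d a + B d a'" for a a' d
      proof -
        have "(\<integral>x. V (z + x) * bump_hess e x (a + a') d \<partial>lborel) = (\<integral>x. V (z + x) * bump_hess e x a d + V (z + x) * bump_hess e x a' d \<partial>lborel)"
          by (intro Bochner_Integration.integral_cong) (auto simp: bump_hess_def inner_add algebra_simps)
        then show "B (a + a') d = B a d + B a' d" using kH(1) by (simp add: B_def add_divide_distrib)
        have "(\<integral>x. V (z + x) * bump_hess e x d (a + a') \<partial>lborel) = (\<integral>x. V (z + x) * bump_hess e x d a + V (z + x) * bump_hess e x d a' \<partial>lborel)"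
          by (intro Bochner_Integration.integral_cong) (auto simp: bump_hess_def inner_add algebra_simps)
        then show "B d (a + a') = B d a + B d a'" using kH(1) by (simp add: B_def add_divide_distrib)
      qed
      moreover have "B (r *\<^sub>R a) d = r *\<^sub>R B a d" "B d (r *\<^sub>R a) = r *\<^sub>R B d a" for r a d
      proof -
        have "(\<integral>x. V (z + x) * bump_hess e x (r *\<^sub>R a) d \<partial>lborel) = (\<integral>x. r * (V (z + x) * bump_hess e x a d) \<partial>lborel)"
          by (intro Bochner_Integration.integral_cong) (auto simp: bump_hess_def algebra_simps)
        then show "B (r *\<^sub>R a) d = r *\<^sub>R B a d" by (simp add: B_def)
        have "(\<integral>x. V (z + x) * bump_hess e x d (r *\<^sub>R a) \<partial>lborel) = (\<integral>x. r * (V (z + x) * bump_hess e x d a) \<partial>lborel)"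
          by (intro Bochner_Integration.integral_cong) (auto simp: bump_hess_def algebra_simps)
        then show "B d (r *\<^sub>R a) = r *\<^sub>R B d a" by (simp add: B_def)
      qed
      ultimately show ?thesis unfolding bilinear_def by (auto intro!: linearI)
    qed
    have W: "(\<integral>x. V (y + x) \<partial>moll e) = (\<integral>x. V (y + x) * bump e x \<partial>lborel) / Z" for y
      unfolding Z_def by (rule moll_integral_eq) measurable
    have "\<bar>(\<integral>x. V (z + d + x) \<partial>moll e) - (\<integral>x. V (z + x) \<partial>moll e) - p \<bullet> d - B d d / 2\<bar> \<le> c * R * norm d ^ 3" for d
    proof (cases "norm d \<le> 1")
      case True
      have shift: "(\<integral>x. V (z + d + x) * bump e x \<partial>lborel) = (\<integral>x. V (z + x) * bump e (x - d) \<partial>lborel)"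
      proof -
        have "(\<integral>x. V (z + x) * bump e (x - d) \<partial>lborel) = (\<integral>x. V (z + x) * bump e (x - d) \<partial>distr lborel borel ((+) d))"
          by (simp add: lborel_distr_plus)
        also have "\<dots> = (\<integral>x. V (z + d + x) * bump e x \<partial>lborel)"
          by (subst integral_distr) (auto simp: add.assoc)
        finally show ?thesis ..
      qed
      let ?g = "\<lambda>x. bump e (x - d) - bump e x - bump_grad e x \<bullet> d - bump_hess e x d d / 2"
      have k1: "integrable lborel (\<lambda>x. V (z + x) * bump e x)"
        using bump_zero(1)[OF e(1)] order_trans[OF e(2), of "norm _"] bump_bounds(1)[OF e] by (intro key(1)[of _ 1] cut) force+
      have k2: "integrable lborel (\<lambda>x. V (z + x) * bump e (x - d))"
      proof (intro key(1)[of _ 1] cut)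
        fix x :: 'a assume "2 < norm x"
        then show "bump e (x - d) = 0"
          using bump_zero(1)[of e "x - d"] e True norm_triangle_ineq[of "x - d" d] by simp
      qed (use bump_bounds(1)[OF e] in auto)
      have k3: "\<bar>(\<integral>x. V (z + x) * ?g x \<partial>lborel) / Z\<bar> \<le> c1 * R * (1804 * norm d ^ 3)"
        using bump_expand[OF e True] by (intro key(2)) (auto simp: mult_ac)
      have "(\<integral>x. V (z + x) * ?g x \<partial>lborel) = (\<integral>x. V (z + x) * bump e (x - d) - V (z + x) * bump e x - V (z + x) * (bump_grad e x \<bullet> d) - V (z + x) * bump_hess e x d d / 2 \<partial>lborel)"
        by (intro Bochner_Integration.integral_cong) (auto simp: algebra_simps)
      also have "\<dots> = (\<integral>x. V (z + x) * bump e (x - d) \<partial>lborel) - (\<integral>x. V (z + x) * bump e x \<partial>lborel) - (\<integral>x. V (z + x) * (bump_grad e x \<bullet> d) \<partial>lborel) - (\<integral>x. V (z + x) * bump_hess e x d d \<partial>lborel) / 2"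
        using k1 k2 kG(1)[of d] kH(1)[of d d] by simp
      finally have "(\<integral>x. V (z + d + x) \<partial>moll e) - (\<integral>x. V (z + x) \<partial>moll e) - p \<bullet> d - B d d / 2 = (\<integral>x. V (z + x) * ?g x \<partial>lborel) / Z"
        unfolding W shift pd B_def by (simp add: diff_divide_distrib)
      then have "\<bar>(\<integral>x. V (z + d + x) \<partial>moll e) - (\<integral>x. V (z + x) \<partial>moll e) - p \<bullet> d - B d d / 2\<bar> \<le> (1804 * c1) * (R * norm d ^ 3)"
        using k3 by (simp add: mult_ac)
      also have "\<dots> \<le> c * (R * norm d ^ 3)" using c1 R by (intro mult_right_mono) (auto simp: c_def)
      finally show ?thesis by simp
    next
      case False
      \<comment> \<open>For \<open>norm d > 1\<close> there is nothing to expand: each of the four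
        terms is at most a constant times \<open>R * norm d ^ 3\<close>.\<close>
      let ?D = "norm d"
      have D: "?D ^ i \<le> ?D ^ 3" if "i \<le> 3" for i using False that by (intro power_increasing) auto
      have W1: "\<bar>\<integral>x. V (z + d + x) \<partial>moll e\<bar> \<le> 5 * R * ?D ^ 3"
      proof (rule moll_bounded(2))
        fix x :: 'a assume x: "norm x < e"
        have "norm (d + x) \<le> 2 * ?D" using norm_triangle_ineq[of d x] x e False by simp
        then have "(norm (d + x))\<^sup>2 \<le> (2 * ?D)\<^sup>2" by (intro power_mono) auto
        then have "1 + (norm (d + x))\<^sup>2 \<le> 5 * ?D ^ 3" using D[of 0] D[of 2] by (simp add: power_mult_distrib)
        then have "R * (1 + (norm (d + x))\<^sup>2) \<le> R * (5 * ?D ^ 3)" using R by (rule mult_left_mono)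
        then show "\<bar>V (z + d + x)\<bar> \<le> 5 * R * ?D ^ 3" using b[rule_format, of "d + x"] by (simp add: add.assoc mult_ac)
      qed measurable
      have W2: "\<bar>\<integral>x. V (z + x) \<partial>moll e\<bar> \<le> 2 * R"
      proof (rule moll_bounded(2))
        fix x :: 'a assume x: "norm x < e"
        then have "(norm x)\<^sup>2 \<le> 1" using e by (simp add: power_le_one)
        then have "R * (1 + (norm x)\<^sup>2) \<le> R * 2" using R by (intro mult_left_mono) auto
        then show "\<bar>V (z + x)\<bar> \<le> 2 * R" using b[rule_format, of x] by simp
      qed measurable
      have "2 * R \<le> 2 * R * ?D ^ 3" using D[of 0] R by (simp add: mult_le_cancel_left1)
      moreover have "\<bar>p \<bullet> d\<bar> \<le> 8 * c1 * (R * ?D ^ 3)"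
      proof -
        have "\<bar>p \<bullet> d\<bar> \<le> c1 * R * (8 * norm d)" unfolding pd by (rule kG(2))
        also have "\<dots> = 8 * c1 * (R * ?D ^ 1)" by simp
        also have "\<dots> \<le> 8 * c1 * (R * ?D ^ 3)" using c1 R by (intro mult_left_mono D) auto
        finally show ?thesis .
      qed
      moreover have "\<bar>B d d\<bar> \<le> 56 * c1 * (R * ?D ^ 3)"
      proof -
        have "\<bar>B d d\<bar> \<le> c1 * R * (56 * norm d * norm d)" unfolding B_def by (rule kH(2))
        also have "\<dots> = 56 * c1 * (R * ?D ^ 2)" by (simp add: power2_eq_square)
        also have "\<dots> \<le> 56 * c1 * (R * ?D ^ 3)" using c1 R by (intro mult_left_mono D) auto
        finally show ?thesis .
      qed
      ultimately have "\<bar>(\<integral>x. V (z + d + x) \<partial>moll e) - (\<integral>x. V (z + x) \<partial>moll e) - p \<bullet> d - B d d / 2\<bar>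
        \<le> 7 * (R * ?D ^ 3) + 36 * c1 * (R * ?D ^ 3)" using W1 W2 by linarith
      also have "\<dots> = (7 + 36 * c1) * (R * ?D ^ 3)" by (simp add: algebra_simps)
      also have "\<dots> \<le> c * (R * ?D ^ 3)" using c1 R by (intro mult_right_mono) (auto simp: c_def)
      finally show ?thesis by simp
    qed
    moreover have "norm p \<le> c * R"
    proof (cases "p = 0")
      case False
      have "norm p * norm p \<le> c * R * norm p" using pb[of p] by (simp add: power2_eq_square flip: power2_norm_eq_inner)
      then show ?thesis using False by simp
    qed (use c R in simp)
    ultimately show "\<exists>p B. bilinear B \<and> norm p \<le> c * R \<and> (\<forall>a b. \<bar>B a b\<bar> \<le> c * R * norm a * norm b) \<and>
      (\<forall>d. \<bar>(\<integral>x. V (z + d + x) \<partial>moll e) - (\<integral>x. V (z + x) \<partial>moll e) - p \<bullet> d - B d d / 2\<bar> \<le> c * R * norm d ^ 3)"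
      using lin Bb by blast
  qed
qed

end

subsection \<open>Consistency\<close>

context bandit_scheme
begin

text \<open>9 bounds the second-order terms other than the variance, by
  \<open>\<bar>\<mu>\<bar> + 2 \<le> 3 * C * (1 + norm s)\<close>. The factor 648 = 2 * 81 * 4 comes
  from the cubic and the quartic remainder, a step having length at most
  \<open>3 * C * (1 + norm s) * (1 + \<bar>\<zeta>\<bar>) / sqrt n\<close>, and from
  \<open>(1 + norm s) ^ 4 \<le> 4 * wt s ^ 2\<close>.\<close>

definition cc :: real where "cc = 9 * C\<^sup>2 + 648 * C ^ 4 * normal_weight 4"

lemma cc_nonneg: "0 \<le> cc"
  using C normal_weight_ge_1[of 4] by (auto simp: cc_def intro!: add_nonneg_nonneg mult_nonneg_nonneg)

text \<open>The mean of the increment yields the first-order term and its variance the second-order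
  term. The other quadratic terms are of order \<open>1 / n^2\<close>, and the third moment gives
  the rate \<open>1 / (n * sqrt n)\<close>. Space and directions are left general: for mollified
  functions \<open>y\<close> moves the pull count alone, for the quartic test polynomial it also
  moves time. This is the reason for \<open>norm y \<le> 2\<close> and for the quartic
  remainder.\<close>

lemma consistency:
  fixes W :: "'a::euclidean_space \<Rightarrow> real" and k :: 'k and s q :: "real^'k"
  assumes n: "n0 \<le> n" and W[measurable]: "W \<in> borel_measurable borel"
    and B: "bilinear B" and p: "norm p \<le> b" and Bb: "\<And>a d. \<bar>B a d\<bar> \<le> b * norm a * norm d"
    and jet: "\<And>d. \<bar>W (z + d) - W z - p \<bullet> d - B d d / 2\<bar> \<le> b * (norm d ^ 3 + norm d ^ 4)"
    and x: "norm x \<le> 1" and y: "norm y \<le> 2"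
  defines "\<delta> \<equiv> \<lambda>\<zeta>. incr n k s q \<zeta> *\<^sub>R x + (1 / real n) *\<^sub>R y"
  shows "integrable std_normal_distribution (\<lambda>\<zeta>. W (z + \<delta> \<zeta>))"
    and "\<bar>(\<integral>\<zeta>. W (z + \<delta> \<zeta>) \<partial>std_normal_distribution) - W z
        - (\<mu> n k s q * (p \<bullet> x) + p \<bullet> y + (\<tau> n k q)\<^sup>2 / 2 * B x x) / real n\<bar>
      \<le> cc * b * (wt s)\<^sup>2 / (real n * sqrt (real n))"
proof -
  interpret prob_space std_normal_distribution by (rule prob_space_std_normal)
  note N = n_pos[OF n]
  let ?r = "sqrt (real n)" and ?i = "incr n k s q" and ?m = "\<mu> n k s q" and ?t = "\<tau> n k q"
  have b: "0 \<le> b" using p norm_ge_zero[of p] by linarith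
  have [measurable]: "\<delta> \<in> borel_measurable borel" unfolding \<delta>_def by measurable
  have quad: "p \<bullet> \<delta> \<zeta> + B (\<delta> \<zeta>) (\<delta> \<zeta>) / 2 = ?i \<zeta> * (p \<bullet> x + (B x y + B y x) / (2 * real n))
      + (?i \<zeta>)\<^sup>2 * (B x x / 2) + ((p \<bullet> y) / real n + B y y / (2 * (real n)\<^sup>2))" for \<zeta>
    unfolding \<delta>_def using N
    by (simp add: bilinear_ladd[OF B] bilinear_radd[OF B] bilinear_lmul[OF B] bilinear_rmul[OF B]
        inner_add_right power2_eq_square field_simps)
  define rem where "rem \<zeta> = W (z + \<delta> \<zeta>) - W z - p \<bullet> \<delta> \<zeta> - B (\<delta> \<zeta>) (\<delta> \<zeta>) / 2" for \<zeta>
  have rem_eq: "rem \<zeta> = W (z + \<delta> \<zeta>) - W z - (?i \<zeta> * (p \<bullet> x + (B x y + B y x) / (2 * real n))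
      + (?i \<zeta>)\<^sup>2 * (B x x / 2) + ((p \<bullet> y) / real n + B y y / (2 * (real n)\<^sup>2)))" for \<zeta>
    unfolding rem_def quad[symmetric] by simp
  have [measurable]: "rem \<in> borel_measurable borel" unfolding rem_eq[abs_def] by measurable
  have rb: "\<bar>rem \<zeta>\<bar> \<le> (648 * C ^ 4 * b * (wt s)\<^sup>2 / (real n * ?r)) * (1 + \<bar>\<zeta>\<bar>) ^ 4" for \<zeta>
  proof -
    let ?D = "3 * C * (1 + norm s) * (1 + \<bar>\<zeta>\<bar>)"
    have 1: "norm (\<delta> \<zeta>) \<le> ?D / ?r"
    proof -
      have "norm (\<delta> \<zeta>) \<le> \<bar>?i \<zeta>\<bar> * norm x + norm y / real n"
        unfolding \<delta>_def using N by (intro order_trans[OF norm_triangle_ineq]) simp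
      also have "\<dots> \<le> \<bar>?i \<zeta>\<bar> * 1 + 2 / ?r"
        using x y N by (intro add_mono mult_left_mono frac_le) auto
      also have "\<dots> \<le> C * (1 + norm s) * (1 + \<bar>\<zeta>\<bar>) / ?r + 2 * (C * (1 + norm s) * (1 + \<bar>\<zeta>\<bar>)) / ?r"
      proof -
        have "1 * 1 * 1 \<le> C * (1 + norm s) * (1 + \<bar>\<zeta>\<bar>)" using C by (intro mult_mono) auto
        then show ?thesis using incr_bound[OF n, of k s q \<zeta>] N by (intro add_mono divide_right_mono) auto
      qed
      also have "\<dots> = ?D / ?r" by (simp flip: add_divide_distrib)
      finally show ?thesis .
    qed
    have D1: "1 \<le> ?D"
    proof -
      have "1 * 1 * 1 * 1 \<le> 3 * C * (1 + norm s) * (1 + \<bar>\<zeta>\<bar>)" using C by (intro mult_mono) auto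
      then show ?thesis by simp
    qed
    have n3: "real n * ?r = ?r ^ 3" "real n * ?r \<le> ?r ^ 4" using N by (auto simp: power3_eq_cube power4_eq_xxxx)
    have "norm (\<delta> \<zeta>) ^ 3 \<le> (?D / ?r) ^ 3" using 1 by (intro power_mono) auto
    also have "\<dots> = ?D ^ 3 / (real n * ?r)" by (simp only: power_divide n3(1))
    also have "\<dots> \<le> ?D ^ 4 / (real n * ?r)" using D1 N by (intro divide_right_mono power_increasing) auto
    finally have 3: "norm (\<delta> \<zeta>) ^ 3 \<le> ?D ^ 4 / (real n * ?r)" .
    have "norm (\<delta> \<zeta>) ^ 4 \<le> (?D / ?r) ^ 4" using 1 by (intro power_mono) auto
    also have "\<dots> = ?D ^ 4 / ?r ^ 4" by (simp only: power_divide)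
    also have "\<dots> \<le> ?D ^ 4 / (real n * ?r)" using N n3 by (intro divide_left_mono) auto
    finally have 4: "norm (\<delta> \<zeta>) ^ 4 \<le> ?D ^ 4 / (real n * ?r)" .
    have "\<bar>rem \<zeta>\<bar> \<le> b * (norm (\<delta> \<zeta>) ^ 3 + norm (\<delta> \<zeta>) ^ 4)" unfolding rem_def by (rule jet)
    also have "\<dots> \<le> b * (?D ^ 4 / (real n * ?r) + ?D ^ 4 / (real n * ?r))"
      using 3 4 b by (intro mult_left_mono add_mono) auto
    also have "\<dots> = (b / (real n * ?r)) * (2 * ?D ^ 4)" by simp
    also have "\<dots> \<le> (b / (real n * ?r)) * (648 * C ^ 4 * (wt s)\<^sup>2 * (1 + \<bar>\<zeta>\<bar>) ^ 4)"
    proof -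
      have "(1 + norm s) ^ 4 = ((1 + norm s)\<^sup>2)\<^sup>2" by simp
      also have "\<dots> \<le> (2 * wt s)\<^sup>2" using norm_le_wt(2)[of s] by (intro power_mono) auto
      finally have "(1 + norm s) ^ 4 \<le> 4 * (wt s)\<^sup>2" by (simp add: power_mult_distrib)
      then have "2 * ?D ^ 4 \<le> 2 * (81 * C ^ 4 * (4 * (wt s)\<^sup>2) * (1 + \<bar>\<zeta>\<bar>) ^ 4)"
        unfolding power_mult_distrib by (intro mult_left_mono mult_right_mono mult_mono) (use C in auto)
      then show ?thesis using b N by (intro mult_left_mono) auto
    qed
    finally show ?thesis by (simp add: mult_ac)
  qed
  have ir: "integrable std_normal_distribution rem"
    "\<bar>\<integral>\<zeta>. rem \<zeta> \<partial>std_normal_distribution\<bar> \<le> 648 * C ^ 4 * b * (wt s)\<^sup>2 / (real n * ?r) * normal_weight 4"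
    using std_normal_bound[OF _ rb] by auto
  define Q where "Q \<zeta> = ?i \<zeta> * (p \<bullet> x + (B x y + B y x) / (2 * real n))
      + (?i \<zeta>)\<^sup>2 * (B x x / 2) + ((p \<bullet> y) / real n + B y y / (2 * (real n)\<^sup>2))" for \<zeta>
  have iQ: "integrable std_normal_distribution Q"
    unfolding Q_def using integral_incr(1)[of n k s q] integral_incr_sq(1)[OF n, of k s q] by simp
  have EQ: "(\<integral>\<zeta>. Q \<zeta> \<partial>std_normal_distribution) = (?m / real n) * (p \<bullet> x + (B x y + B y x) / (2 * real n))
      + ((?m / real n)\<^sup>2 + ?t\<^sup>2 / real n) * (B x x / 2) + ((p \<bullet> y) / real n + B y y / (2 * (real n)\<^sup>2))"
    unfolding Q_def using integral_incr[of n k s q] integral_incr_sq[OF n, of k s q] by simp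
  have dec: "(\<lambda>\<zeta>. W (z + \<delta> \<zeta>)) = (\<lambda>\<zeta>. W z + Q \<zeta> + rem \<zeta>)"
    unfolding rem_eq Q_def by auto
  show "integrable std_normal_distribution (\<lambda>\<zeta>. W (z + \<delta> \<zeta>))"
    unfolding dec using ir(1) iQ by simp
  have EW: "(\<integral>\<zeta>. W (z + \<delta> \<zeta>) \<partial>std_normal_distribution) = W z + (\<integral>\<zeta>. Q \<zeta> \<partial>std_normal_distribution) + (\<integral>\<zeta>. rem \<zeta> \<partial>std_normal_distribution)"
    unfolding dec using ir(1) iQ by simp
  define e2 where "e2 = (?m * (B x y + B y x) + ?m\<^sup>2 * B x x + B y y) / (2 * (real n)\<^sup>2)"
  have EQ': "(\<integral>\<zeta>. Q \<zeta> \<partial>std_normal_distribution) = (?m * (p \<bullet> x) + p \<bullet> y + ?t\<^sup>2 / 2 * B x x) / real n + e2"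
    unfolding EQ e2_def using N by (simp add: field_simps power2_eq_square)
  have e2b: "\<bar>e2\<bar> \<le> 9 * C\<^sup>2 * b * (wt s)\<^sup>2 / (real n * ?r)"
  proof -
    have Bxx: "\<bar>B x x\<bar> \<le> b" using Bb[of x x] mult_mono[OF mult_mono[OF order_refl x b] x] b by (simp add: order_trans[OF Bb])
    have Bxy: "\<bar>B x y\<bar> \<le> 2 * b" using order_trans[OF Bb mult_mono[OF mult_mono[OF order_refl x b] y]] b by simp
    have Byx: "\<bar>B y x\<bar> \<le> 2 * b" using order_trans[OF Bb mult_mono[OF mult_mono[OF order_refl y b] x]] b by simp
    have Byy: "\<bar>B y y\<bar> \<le> 4 * b" using order_trans[OF Bb mult_mono[OF mult_mono[OF order_refl y b] y]] b by simp
    have "\<bar>?m * (B x y + B y x)\<bar> \<le> \<bar>?m\<bar> * (4 * b)" unfolding abs_mult using Bxy Byx by (intro mult_left_mono) auto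
    moreover have "\<bar>?m\<^sup>2 * B x x\<bar> \<le> ?m\<^sup>2 * b" unfolding abs_mult using Bxx by (simp add: mult_left_mono)
    ultimately have "\<bar>?m * (B x y + B y x) + ?m\<^sup>2 * B x x + B y y\<bar> \<le> \<bar>?m\<bar> * (4 * b) + ?m\<^sup>2 * b + 4 * b" using Byy by linarith
    also have "\<dots> = b * (\<bar>?m\<bar> + 2)\<^sup>2" by (simp add: power2_eq_square algebra_simps)
    also have "\<dots> \<le> b * (3 * C * (1 + norm s))\<^sup>2"
    proof -
      have "1 * 1 \<le> C * (1 + norm s)" using C by (intro mult_mono) auto
      then have "\<bar>?m\<bar> + 2 \<le> 3 * C * (1 + norm s)" using mu_growth[OF n, of k s q] by simp
      then show ?thesis using b by (intro mult_left_mono power_mono) auto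
    qed
    also have "\<dots> = b * (9 * C\<^sup>2) * (1 + norm s)\<^sup>2" by (simp add: power_mult_distrib)
    also have "\<dots> \<le> b * (9 * C\<^sup>2) * (2 * (wt s)\<^sup>2)"
    proof -
      have "wt s \<le> (wt s)\<^sup>2" by (rule self_le_power) auto
      then show ?thesis using norm_le_wt(2)[of s] b by (intro mult_left_mono) auto
    qed
    finally have "\<bar>e2\<bar> \<le> (b * (9 * C\<^sup>2) * (2 * (wt s)\<^sup>2)) / (2 * (real n)\<^sup>2)"
      unfolding e2_def abs_divide using N by (intro frac_le) auto
    also have "\<dots> = 9 * C\<^sup>2 * b * (wt s)\<^sup>2 / (real n * real n)" by (simp add: power2_eq_square)
    also have "\<dots> \<le> 9 * C\<^sup>2 * b * (wt s)\<^sup>2 / (real n * ?r)"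
      using N b by (intro divide_left_mono mult_left_mono) auto
    finally show ?thesis .
  qed
  have "(\<integral>\<zeta>. W (z + \<delta> \<zeta>) \<partial>std_normal_distribution) - W z
        - (\<mu> n k s q * (p \<bullet> x) + p \<bullet> y + (\<tau> n k q)\<^sup>2 / 2 * B x x) / real n = e2 + (\<integral>\<zeta>. rem \<zeta> \<partial>std_normal_distribution)"
    unfolding EW EQ' by simp
  then have "\<bar>(\<integral>\<zeta>. W (z + \<delta> \<zeta>) \<partial>std_normal_distribution) - W z
        - (\<mu> n k s q * (p \<bullet> x) + p \<bullet> y + (\<tau> n k q)\<^sup>2 / 2 * B x x) / real n\<bar>
      \<le> 9 * C\<^sup>2 * b * (wt s)\<^sup>2 / (real n * ?r) + 648 * C ^ 4 * b * (wt s)\<^sup>2 / (real n * ?r) * normal_weight 4"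
    using ir(2) e2b by linarith
  also have "\<dots> = cc * b * (wt s)\<^sup>2 / (real n * ?r)" by (simp add: cc_def algebra_simps add_divide_distrib)
  finally show "\<bar>(\<integral>\<zeta>. W (z + \<delta> \<zeta>) \<partial>std_normal_distribution) - W z
        - (\<mu> n k s q * (p \<bullet> x) + p \<bullet> y + (\<tau> n k q)\<^sup>2 / 2 * B x x) / real n\<bar>
      \<le> cc * b * (wt s)\<^sup>2 / (real n * sqrt (real n))" .
qed

end

subsection \<open>Comparison of two horizons and convergence\<close>

lemma abs_nat_floor_diff_le: "\<bar>real (nat \<lfloor>x\<rfloor>) - real (nat \<lfloor>y\<rfloor>)\<bar> \<le> \<bar>x - y\<bar> + 1" for x y :: real
proof -
  have *: "real (nat \<lfloor>x\<rfloor>) = of_int (max 0 \<lfloor>x\<rfloor>)" for x :: real by (simp add: of_nat_nat max_def)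
  show ?thesis unfolding * by (simp add: max_def) linarith
qed

context bandit_scheme
begin

text \<open>\<open>V n (T, s, q)\<close> extends \<open>u n\<close> to real times-to-go \<open>T\<close>; cutting off at \<open>2 * n\<close> rounds keeps the
  bounds uniform in \<open>T\<close>.\<close>

definition V :: "nat \<Rightarrow> 'k hjb_point \<Rightarrow> real" where
  "V n y = u n (min (nat \<lfloor>real n * fst y\<rfloor>) (2 * n)) (fst (snd y)) (snd (snd y))"

lemma V_measurable [measurable]:
  assumes n: "n0 \<le> n" shows "V n \<in> borel_measurable borel"
proof -
  have 1: "(\<lambda>y :: 'k hjb_point. u n j (fst (snd y)) (snd (snd y))) \<in> borel_measurable borel" for j
    by (intro borel_measurable_continuous_onI
      continuous_on_compose2[OF u_continuous[OF n], of _ "\<lambda>y. (fst (snd y), snd (snd y))", simplified] continuous_intros)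
  have [measurable]: "(\<lambda>y :: 'k hjb_point. real n * fst y) \<in> borel_measurable borel"
    by (intro borel_measurable_continuous_onI continuous_intros)
  have "(\<lambda>y :: 'k hjb_point. \<lfloor>real n * fst y\<rfloor>) \<in> borel \<rightarrow>\<^sub>M count_space UNIV" by measurable
  from measurable_compose[OF this, of "\<lambda>j. min (nat j) (2 * n)" "count_space UNIV"]
  have "(\<lambda>y :: 'k hjb_point. min (nat \<lfloor>real n * fst y\<rfloor>) (2 * n)) \<in> borel \<rightarrow>\<^sub>M count_space UNIV" by simp
  from measurable_compose_countable[OF 1 this] show ?thesis unfolding V_def[abs_def] .
qed

lemma V_growth:
  assumes n: "n0 \<le> n" shows "\<bar>V n (T, s, q)\<bar> \<le> G * wt s"
  unfolding V_def by (simp add: u_growth[OF n])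

text \<open>The additional \<open>1 / n\<close> accounts for the jumps of \<open>V n\<close> in
  time.\<close>

lemma V_lip:
  assumes n: "n0 \<le> n"
  shows "\<bar>V n (T, s, q) - V n (T', s', q')\<bar>
    \<le> G * (\<bar>T - T'\<bar> + 1 / real n) * wt s + G * norm (s - s') + G * wt s * norm (q - q')"
proof -
  note N = n_pos[OF n]
  let ?j = "\<lambda>T. min (nat \<lfloor>real n * T\<rfloor>) (2 * n)"
  have "\<bar>real (?j T) - real (?j T')\<bar> \<le> \<bar>real (nat \<lfloor>real n * T\<rfloor>) - real (nat \<lfloor>real n * T'\<rfloor>)\<bar>"
    by (auto simp: min_def)
  also have "\<dots> \<le> \<bar>real n * T - real n * T'\<bar> + 1" by (rule abs_nat_floor_diff_le)
  also have "\<bar>real n * T - real n * T'\<bar> = real n * \<bar>T - T'\<bar>"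
    by (simp add: abs_mult flip: right_diff_distrib)
  finally have "\<bar>real (?j T) - real (?j T')\<bar> / real n \<le> (real n * \<bar>T - T'\<bar> + 1) / real n"
    by (simp add: divide_right_mono)
  also have "\<dots> = \<bar>T - T'\<bar> + 1 / real n" using N by (simp add: add_divide_distrib)
  finally have "G * (\<bar>real (?j T) - real (?j T')\<bar> / real n) * wt s \<le> G * (\<bar>T - T'\<bar> + 1 / real n) * wt s"
    using G_ge by (intro mult_right_mono mult_left_mono) auto
  moreover have "\<bar>V n (T, s, q) - V n (T', s', q')\<bar> \<le> G * (\<bar>real (?j T) - real (?j T')\<bar> / real n) * wt s
      + G * norm (s - s') + G * wt s * norm (q - q')"
    unfolding V_def by (simp only: fst_conv snd_conv) (rule u_lip[OF n], auto)
  ultimately show ?thesis by linarith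
qed

text \<open>The shift by \<open>e\<close> in time keeps the time to go nonnegative on the support of
  the kernel, also at \<open>T = 0\<close>.\<close>

definition W :: "real \<Rightarrow> nat \<Rightarrow> 'k hjb_point \<Rightarrow> real" where
  "W e n z = (\<integral>x. V n (z + (e, 0, 0) + x) \<partial>moll e)"

text \<open>Split along two fixed directions to match \<open>consistency\<close>. Time is not moved:
  the supersolution inequality has the time step on its other side.\<close>

definition shift :: "nat \<Rightarrow> 'k \<Rightarrow> real^'k \<Rightarrow> real^'k \<Rightarrow> real \<Rightarrow> 'k hjb_point" where
  "shift n k s q \<zeta> = incr n k s q \<zeta> *\<^sub>R (0, axis k 1, 0) + (1 / real n) *\<^sub>R (0, 0, axis k 1)"

lemma shift_eq: "shift n k s q \<zeta> = (0, incr n k s q \<zeta> *\<^sub>R axis k 1, (1 / real n) *\<^sub>R axis k 1)"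
  by (simp add: shift_def)

lemma shift_measurable [measurable]: "shift n k s q \<in> borel_measurable borel"
  unfolding shift_def[abs_def] by measurable

lemma wt_add_le:
  assumes "norm x \<le> 1" shows "wt (s + x) \<le> 4 * wt s"
proof -
  have "(norm x)\<^sup>2 \<le> 1" using assms by (simp add: power_le_one)
  then have "2 * wt s * (1 + (norm x)\<^sup>2) \<le> 2 * wt s * 2" by (intro mult_left_mono) auto
  then show ?thesis using wt_add[of s x] by linarith
qed

lemma norm_triple: "\<bar>fst x\<bar> \<le> norm x" "norm (fst (snd x)) \<le> norm x" "norm (snd (snd x)) \<le> norm x"
  for x :: "'k hjb_point"
  using norm_fst_le[of "fst x" "snd x"] norm_snd_le[of "snd x" "fst x"]
    norm_fst_le[of "fst (snd x)" "snd (snd x)"] norm_snd_le[of "snd (snd x)" "fst (snd x)"]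
  by auto

context
  fixes e :: real
  assumes e: "0 < e" "e \<le> 1 / 4"
begin

lemma e1: "0 < e" "e \<le> 1" using e by auto

lemma moll_V_measurable [measurable]:
  assumes n: "n0 \<le> n" shows "(\<lambda>x. V n (z + x)) \<in> borel_measurable borel"
  using V_measurable[OF n] by measurable

lemma W_measurable [measurable]:
  assumes n: "n0 \<le> n" shows "W e n \<in> borel_measurable borel"
proof -
  interpret prob_space "moll e :: 'k hjb_point measure" by (rule moll_prob[OF e1])
  note [measurable] = V_measurable[OF n] and [measurable_cong] = moll_measurable_cong[OF e1]
  show ?thesis unfolding W_def[abs_def] by measurable
qed

lemma W_near:
  assumes n: "n0 \<le> n" shows "\<bar>W e n (T, s, q) - V n (T, s, q)\<bar> \<le> G * (4 * e + 1 / real n) * wt s"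
proof -
  interpret prob_space "moll e :: 'k hjb_point measure" by (rule moll_prob[OF e1])
  note N = n_pos[OF n]
  let ?z = "(T, s, q)"
  let ?f = "\<lambda>x. V n (?z + (e, 0, 0) + x)"
  have d: "\<bar>?f x - V n ?z\<bar> \<le> G * (4 * e + 1 / real n) * wt s" if x: "norm x < e" for x
  proof -
    obtain xt xs xq where xx: "x = (xt, xs, xq)" by (metis surj_pair)
    have b: "\<bar>xt\<bar> \<le> e" "norm xs \<le> e" "norm xq \<le> e" using norm_triple[of x] x xx by auto
    have "\<bar>V n (T, s, q) - V n (T + e + xt, s + xs, q + xq)\<bar>
      \<le> G * (\<bar>T - (T + e + xt)\<bar> + 1 / real n) * wt s + G * norm (s - (s + xs)) + G * wt s * norm (q - (q + xq))"
      by (rule V_lip[OF n])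
    also have "\<dots> \<le> G * (2 * e + 1 / real n) * wt s + G * (e * wt s) + G * wt s * e"
    proof -
      have "norm xs * 1 \<le> e * wt s" using b e by (intro mult_mono) auto
      then show ?thesis using b G_ge by (intro add_mono mult_right_mono mult_left_mono) auto
    qed
    also have "\<dots> = G * (4 * e + 1 / real n) * wt s" by (simp add: algebra_simps)
    finally show ?thesis by (simp add: xx abs_minus_commute add.assoc)
  qed
  have m: "(\<lambda>x. ?f x - V n ?z) \<in> borel_measurable borel"
    by (intro borel_measurable_diff moll_V_measurable[OF n]) simp
  have i: "integrable (moll e) ?f"
  proof (rule moll_bounded(1)[OF e1 moll_V_measurable[OF n]])
    fix x :: "'k hjb_point" assume "norm x < e"
    then show "\<bar>?f x\<bar> \<le> \<bar>V n ?z\<bar> + G * (4 * e + 1 / real n) * wt s" using d[of x] by linarith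
  qed
  have "\<bar>\<integral>x. ?f x - V n ?z \<partial>moll e\<bar> \<le> G * (4 * e + 1 / real n) * wt s"
    by (rule moll_bounded(2)[OF e1 m d])
  then show ?thesis using i by (simp add: W_def prob_space)
qed

text \<open>On the support of the kernel at most \<open>2 * e * n\<close> rounds are left, and
  \<open>u n 0\<close> vanishes. The factor 8 is 2 from the time and 4 from
  \<open>wt_add_le\<close>.\<close>

lemma W_initial:
  assumes n: "n0 \<le> n" shows "\<bar>W e n (0, s, q)\<bar> \<le> 8 * G * e * wt s"
  unfolding W_def
proof (rule moll_bounded(2)[OF e1])
  fix x :: "'k hjb_point" assume x: "norm x < e"
  note N = n_pos[OF n]
  obtain xt xs xq where xx: "x = (xt, xs, xq)" by (metis surj_pair)
  have b: "\<bar>xt\<bar> \<le> e" "norm xs \<le> e" "norm xq \<le> e" using norm_triple[of x] x xx by auto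
  let ?j = "min (nat \<lfloor>real n * (e + xt)\<rfloor>) (2 * n)"
  have "real ?j \<le> real (nat \<lfloor>real n * (e + xt)\<rfloor>)" by simp
  also have "\<dots> \<le> real n * (e + xt)" using b(1) by (simp add: of_nat_nat)
  also have "\<dots> \<le> real n * (2 * e)" using b by (intro mult_left_mono) auto
  finally have j: "real ?j / real n \<le> 2 * e" using N by (simp add: field_simps)
  have "\<bar>u n ?j (s + xs) (q + xq) - u n 0 (s + xs) (q + xq)\<bar> \<le> G * (\<bar>real ?j - real 0\<bar> / real n) * wt (s + xs)"
    by (rule u_time[OF n]) auto
  also have "\<dots> = G * (real ?j / real n) * wt (s + xs)" by simp
  also have "\<dots> \<le> G * (2 * e) * (4 * wt s)"
    using j b e G_ge by (intro mult_mono wt_add_le) auto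
  finally show "\<bar>V n ((0, s, q) + (e, 0, 0) + x)\<bar> \<le> 8 * G * e * wt s" by (simp add: V_def xx)
qed (rule moll_V_measurable[OF n])

text \<open>The cost, per \<open>e * wt s / n\<close>, of taking the coefficients at
  \<open>(s, q)\<close> instead of a nearby point: \<open>3 * C\<close> for the reward, the rest for
  the moved state. It must not depend on \<open>e\<close>, which is later chosen small relative to
  it.\<close>

definition cS :: real where "cS = 3 * C + G * (3 * C + C * normal_weight 1)"

text \<open>The Bellman inequality for arm \<open>k\<close> at the point displaced by
  \<open>x\<close>, rewritten with the coefficients of \<open>(s, q)\<close>. Reward and mean
  increment change by at most order \<open>e / n\<close>, and by \<open>tau_lip\<close> so does the
  noise. With coefficients free of \<open>x\<close> the inequality can be averaged over the
  kernel.\<close>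

lemma V_super:
  assumes n: "n0 \<le> n" "2 \<le> n" and T: "0 \<le> T" "T \<le> 1" and x: "norm x < e"
  shows "\<mu> n k s q / real n + (\<integral>\<zeta>. V n ((T, s, q) + shift n k s q \<zeta> + (e, 0, 0) + x) \<partial>std_normal_distribution) - cS * e * wt s / real n
    \<le> V n ((T + 1 / real n, s, q) + (e, 0, 0) + x)"
proof -
  interpret prob_space std_normal_distribution by (rule prob_space_std_normal)
  note N = n_pos[OF n(1)]
  obtain xt xs xq where xx: "x = (xt, xs, xq)" by (metis surj_pair)
  have b: "\<bar>xt\<bar> \<le> e" "norm xs \<le> e" "norm xq \<le> e" using norm_triple[of x] x xx by auto
  let ?t = "T + e + xt" and ?s = "s + xs" and ?q = "q + xq"
  define j where "j = nat \<lfloor>real n * ?t\<rfloor>"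
  have t0: "0 \<le> real n * ?t" using b T by simp
  \<comment> \<open>A time step of exactly \<open>1 / n\<close> raises the rounded time by exactly
    one round, so rounding causes no error.\<close>
  have fl: "\<lfloor>real n * (?t + 1 / real n)\<rfloor> = \<lfloor>real n * ?t\<rfloor> + 1"
  proof -
    have "real n * (?t + 1 / real n) = real n * ?t + 1" using N by (simp add: algebra_simps)
    then show ?thesis by simp
  qed
  \<comment> \<open>The shifted time is at most 1 + 1/4 + 1/4, so
    \<open>Suc j \<le> 3 * n / 2 + 1 \<le> 2 * n\<close> for \<open>n \<ge> 2\<close>, and the
    cut-off in \<open>V\<close> is inactive.\<close>
  have "real j \<le> real n * ?t" unfolding j_def using t0 by (simp add: of_nat_nat)
  also have "\<dots> \<le> real n * (3 / 2)" using b T e by (intro mult_left_mono) auto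
  finally have j2: "Suc j \<le> 2 * n" using n(2) by linarith
  have nat: "nat \<lfloor>real n * (?t + 1 / real n)\<rfloor> = Suc j"
    unfolding fl j_def using t0 by (simp add: nat_add_distrib)
  have "V n ((T + 1 / real n, s, q) + (e, 0, 0) + x) = u n (Suc j) ?s ?q"
    using nat j2 by (simp add: V_def xx add_ac del: u.simps)
  moreover have "\<mu> n k ?s ?q / real n + step n k (u n j) ?s ?q \<le> u n (Suc j) ?s ?q"
    by (simp add: Max_ge)
  moreover have mu: "\<bar>\<mu> n k ?s ?q - \<mu> n k s q\<bar> \<le> 3 * C * e * wt s"
  proof -
    have "\<bar>\<mu> n k ?s ?q - \<mu> n k s ?q\<bar> \<le> C * norm (?s - s)" by (rule mu_lip_s[OF n(1)])
    also have "\<dots> \<le> C * (e * wt s)" 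
    proof -
      have "norm xs * 1 \<le> e * wt s" using b e by (intro mult_mono) auto
      then show ?thesis using C by simp
    qed
    finally have 1: "\<bar>\<mu> n k ?s ?q - \<mu> n k s ?q\<bar> \<le> C * (e * wt s)" .
    have "\<bar>\<mu> n k s ?q - \<mu> n k s q\<bar> \<le> C * (1 + norm s) * norm (?q - q)" by (rule mu_lip_q[OF n(1)])
    also have "\<dots> \<le> C * (2 * wt s) * e" using b C norm_le_wt(1)[of s] by (intro mult_mono) auto
    finally show ?thesis using 1 by (simp add: algebra_simps)
  qed
  moreover have "\<bar>\<mu> n k ?s ?q / real n - \<mu> n k s q / real n\<bar> \<le> 3 * C * e * wt s / real n"
    using mu N by (simp add: divide_right_mono flip: diff_divide_distrib)
  moreover have "(\<integral>\<zeta>. V n ((T, s, q) + shift n k s q \<zeta> + (e, 0, 0) + x) \<partial>std_normal_distribution)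
     - step n k (u n j) ?s ?q \<le> G * (3 * C + C * normal_weight 1) * e * wt s / real n"
  proof -
    let ?q' = "?q + (1 / real n) *\<^sub>R axis k 1"
    have Ve: "V n ((T, s, q) + shift n k s q \<zeta> + (e, 0, 0) + x) = u n j (move n k s q \<zeta> + xs) ?q'" for \<zeta>
      using j2 by (simp add: V_def xx shift_eq move_def j_def add_ac min_absorb1)
    have i1: "integrable std_normal_distribution (\<lambda>\<zeta>. u n j (move n k s q \<zeta> + xs) ?q')"
    proof (rule integrable_move1[OF n(1), of "\<lambda>s. u n j (s + xs) ?q'" "G * 4"])
      show "(\<lambda>s. u n j (s + xs) ?q') \<in> borel_measurable borel"
        by (rule measurable_compose[OF _ u_measurable[OF n(1)]]) measurable
      fix s
      have "\<bar>u n j (s + xs) ?q'\<bar> \<le> G * wt (s + xs)" using j2 by (intro u_growth[OF n(1)]) auto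
      also have "\<dots> \<le> G * (4 * wt s)" using G_ge b e by (intro mult_left_mono wt_add_le) auto
      finally show "\<bar>u n j (s + xs) ?q'\<bar> \<le> G * 4 * wt s" by simp
    qed
    have d: "u n j (move n k s q \<zeta> + xs) ?q' - u n j (move n k ?s ?q \<zeta>) ?q' \<le> G * (e * wt s / real n) * (3 * C + C * (1 + \<bar>\<zeta>\<bar>) ^ 1)" for \<zeta>
    proof -
      have "move n k s q \<zeta> + xs - move n k ?s ?q \<zeta> = ((\<mu> n k s q / real n - \<mu> n k ?s ?q / real n) + (\<tau> n k q - \<tau> n k ?q) / sqrt (real n) * \<zeta>) *\<^sub>R axis k 1"
        by (simp add: move_def incr_def algebra_simps diff_divide_distrib)
      then have "norm (move n k s q \<zeta> + xs - move n k ?s ?q \<zeta>) = \<bar>(\<mu> n k s q / real n - \<mu> n k ?s ?q / real n) + (\<tau> n k q - \<tau> n k ?q) / sqrt (real n) * \<zeta>\<bar>"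
        by simp
      also have "\<dots> \<le> 3 * C * e * wt s / real n + (C * e * wt s / real n) * (1 + \<bar>\<zeta>\<bar>)"
      proof (rule order_trans[OF abs_triangle_ineq add_mono])
        show "\<bar>\<mu> n k s q / real n - \<mu> n k ?s ?q / real n\<bar> \<le> 3 * C * e * wt s / real n"
          using mu N by (simp add: divide_right_mono abs_minus_commute flip: diff_divide_distrib)
        have "\<bar>(\<tau> n k q - \<tau> n k ?q) / sqrt (real n) * \<zeta>\<bar> \<le> \<bar>\<tau> n k q - \<tau> n k ?q\<bar> / 1 * (1 + \<bar>\<zeta>\<bar>)"
          unfolding abs_mult abs_divide using N by (intro mult_mono divide_left_mono) auto
        also have "\<dots> \<le> (C * norm (q - ?q) / real n) / 1 * (1 + \<bar>\<zeta>\<bar>)"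
          using tau_lip[OF n(1), of k q ?q] by (intro mult_right_mono divide_right_mono) auto
        also have "\<dots> \<le> (C * e * wt s / real n) * (1 + \<bar>\<zeta>\<bar>)"
        proof -
          have "norm xq * 1 \<le> e * wt s" using b e by (intro mult_mono) auto
          then have "C * (norm xq * 1) \<le> C * (e * wt s)" using C by (intro mult_left_mono) auto
          then have "(C * norm xq) / real n \<le> (C * e * wt s) / real n" using N by (intro divide_right_mono) auto
          then show ?thesis by (intro mult_right_mono) auto
        qed
        finally show "\<bar>(\<tau> n k q - \<tau> n k ?q) / sqrt (real n) * \<zeta>\<bar> \<le> (C * e * wt s / real n) * (1 + \<bar>\<zeta>\<bar>)" .
      qed
      also have "\<dots> = (e * wt s / real n) * (3 * C + C * (1 + \<bar>\<zeta>\<bar>))"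
        by (simp add: algebra_simps add_divide_distrib)
      finally have m: "norm (move n k s q \<zeta> + xs - move n k ?s ?q \<zeta>) \<le> (e * wt s / real n) * (3 * C + C * (1 + \<bar>\<zeta>\<bar>))" .
      have "\<bar>u n j (move n k s q \<zeta> + xs) ?q' - u n j (move n k ?s ?q \<zeta>) ?q'\<bar> \<le> G * norm (move n k s q \<zeta> + xs - move n k ?s ?q \<zeta>)"
        using u_lip[OF n(1), of j j "move n k s q \<zeta> + xs" ?q' "move n k ?s ?q \<zeta>" ?q'] j2 by simp
      also have "\<dots> \<le> G * ((e * wt s / real n) * (3 * C + C * (1 + \<bar>\<zeta>\<bar>)))" using m G_ge by (intro mult_left_mono) auto
      finally show ?thesis by (simp add: mult.assoc)
    qed
    have "(\<integral>\<zeta>. V n ((T, s, q) + shift n k s q \<zeta> + (e, 0, 0) + x) \<partial>std_normal_distribution) - step n k (u n j) ?s ?q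
      = (\<integral>\<zeta>. u n j (move n k s q \<zeta> + xs) ?q' - u n j (move n k ?s ?q \<zeta>) ?q' \<partial>std_normal_distribution)"
      unfolding Ve step_def using i1 u_integrable[OF n(1), of j k ?s ?q ?q'] by simp
    also have "\<dots> \<le> (\<integral>\<zeta>. G * (e * wt s / real n) * (3 * C + C * (1 + \<bar>\<zeta>\<bar>) ^ 1) \<partial>std_normal_distribution)"
      using i1 u_integrable[OF n(1), of j k ?s ?q ?q'] integrable_std_normal_weight[of 1]
      by (intro integral_mono d) (auto simp del: power_one_right)
    also have "\<dots> = G * (e * wt s / real n) * (3 * C + C * normal_weight 1)"
      unfolding normal_weight_def using integrable_std_normal_weight[of 1] by (simp del: power_one_right)
    finally show ?thesis by (simp add: mult_ac)
  qed
  moreover have "cS * e * wt s / real n = 3 * C * e * wt s / real n + G * (3 * C + C * normal_weight 1) * e * wt s / real n"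
    by (simp add: cS_def algebra_simps add_divide_distrib)
  ultimately show ?thesis by linarith
qed

text \<open>\<open>V_super\<close> is linear in \<open>V\<close> with coefficients independent of
  the kernel variable, so it survives averaging; Fubini exchanges the average over the kernel with
  the one over the noise.\<close>

lemma W_super:
  assumes n: "n0 \<le> n" "2 \<le> n" and T: "0 \<le> T" "T \<le> 1"
  shows "\<mu> n k s q / real n + (\<integral>\<zeta>. W e n ((T, s, q) + shift n k s q \<zeta>) \<partial>std_normal_distribution) - cS * e * wt s / real n
    \<le> W e n (T + 1 / real n, s, q)"
proof -
  interpret M: prob_space "moll e :: 'k hjb_point measure" by (rule moll_prob[OF e1])
  interpret S: prob_space std_normal_distribution by (rule prob_space_std_normal)
  interpret P: pair_prob_space "moll e :: 'k hjb_point measure" std_normal_distribution ..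
  note [measurable] = V_measurable[OF n(1)] and [measurable_cong] = moll_measurable_cong[OF e1]
  let ?f = "\<lambda>x \<zeta>. V n ((T, s, q) + shift n k s q \<zeta> + (e, 0, 0) + x)"
  have b: "\<bar>?f x \<zeta>\<bar> \<le> 4 * G * wt (move n k s q \<zeta>)" if "norm x < e" for x \<zeta>
  proof -
    obtain xt xs xq where xx: "x = (xt, xs, xq)" by (metis surj_pair)
    have "norm xs \<le> 1" using norm_triple[of x] that xx e by auto
    have "\<bar>V n (T + e + xt, move n k s q \<zeta> + xs, q + (1 / real n) *\<^sub>R axis k 1 + xq)\<bar> \<le> G * wt (move n k s q \<zeta> + xs)"
      by (rule V_growth[OF n(1)])
    also have "\<dots> \<le> G * (4 * wt (move n k s q \<zeta>))" using G_ge wt_add_le[OF \<open>norm xs \<le> 1\<close>] by (intro mult_left_mono) auto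
    finally show ?thesis by (simp add: xx shift_eq move_def add_ac)
  qed
  have i2: "integrable std_normal_distribution (?f x)" if "norm x < e" for x
    by (rule Bochner_Integration.integrable_bound[OF integrable_mult_right[OF wt_integrable(1)[OF n(1), of k s q], of "4 * G"]])
      (use b[OF that] G_ge in auto)
  \<comment> \<open>The identity serves the iterated integral, \<open>abs\<close> the absolute
    integrability behind Fubini.\<close>
  have i3: "\<bar>\<integral>\<zeta>. g (?f x \<zeta>) \<partial>std_normal_distribution\<bar> \<le> 4 * G * (\<integral>\<zeta>. wt (move n k s q \<zeta>) \<partial>std_normal_distribution)"
    if "norm x < e" and g: "g = (\<lambda>x. x) \<or> g = abs" for x and g :: "real \<Rightarrow> real"
  proof -
    have ig: "integrable std_normal_distribution (\<lambda>\<zeta>. g (?f x \<zeta>))" using g i2[OF that(1)] by auto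
    have "\<bar>\<integral>\<zeta>. g (?f x \<zeta>) \<partial>std_normal_distribution\<bar> \<le> (\<integral>\<zeta>. \<bar>g (?f x \<zeta>)\<bar> \<partial>std_normal_distribution)"
      by (rule integral_abs_bound)
    also have "\<dots> \<le> (\<integral>\<zeta>. 4 * G * wt (move n k s q \<zeta>) \<partial>std_normal_distribution)"
      using ig g b[OF that(1)] wt_integrable(1)[OF n(1), of k s q] by (intro integral_mono integrable_abs) auto
    finally show ?thesis using wt_integrable(1)[OF n(1), of k s q] by simp
  qed
  have m1: "(\<lambda>x. \<integral>\<zeta>. ?f x \<zeta> \<partial>std_normal_distribution) \<in> borel_measurable borel"
    "(\<lambda>x. \<integral>\<zeta>. \<bar>?f x \<zeta>\<bar> \<partial>std_normal_distribution) \<in> borel_measurable borel"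
    by measurable
  have i1: "integrable (moll e) (\<lambda>x. \<integral>\<zeta>. ?f x \<zeta> \<partial>std_normal_distribution)"
    by (rule moll_bounded(1)[OF e1 m1(1)]) (use i3[of _ "\<lambda>x. x"] in auto)
  have i: "integrable (moll e \<Otimes>\<^sub>M std_normal_distribution) (case_prod ?f)"
  proof (rule P.Fubini_integrable)
    show "case_prod ?f \<in> borel_measurable (moll e \<Otimes>\<^sub>M std_normal_distribution)" by measurable
    have "integrable (moll e) (\<lambda>x. \<integral>\<zeta>. \<bar>?f x \<zeta>\<bar> \<partial>std_normal_distribution)"
      by (rule moll_bounded(1)[OF e1 m1(2)]) (use i3[of _ abs] in auto)
    then show "integrable (moll e) (\<lambda>x. \<integral>y. norm (case (x, y) of (x, y) \<Rightarrow> ?f x y) \<partial>std_normal_distribution)" by simp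
    show "AE x in moll e. integrable std_normal_distribution (\<lambda>y. case (x, y) of (x, y) \<Rightarrow> ?f x y)"
      using moll_AE[OF e1] by (auto elim!: eventually_mono simp: i2)
  qed
  have swap: "(\<integral>\<zeta>. W e n ((T, s, q) + shift n k s q \<zeta>) \<partial>std_normal_distribution) = (\<integral>x. (\<integral>\<zeta>. ?f x \<zeta> \<partial>std_normal_distribution) \<partial>moll e)"
    unfolding W_def by (rule P.Fubini_integral[OF i])
  let ?g = "\<lambda>x. V n ((T + 1 / real n, s, q) + (e, 0, 0) + x)"
  have ig: "integrable (moll e) ?g"
  proof (rule moll_bounded(1)[OF e1 moll_V_measurable[OF n(1)]])
    fix x :: "'k hjb_point" assume "norm x < e"
    obtain xt xs xq where xx: "x = (xt, xs, xq)" by (metis surj_pair)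
    have "norm xs \<le> 1" using norm_triple[of x] \<open>norm x < e\<close> xx e by auto
    have "\<bar>?g x\<bar> \<le> G * wt (s + xs)" unfolding xx by (simp add: V_growth[OF n(1)])
    also have "\<dots> \<le> G * (4 * wt s)" using G_ge wt_add_le[OF \<open>norm xs \<le> 1\<close>] by (intro mult_left_mono) auto
    finally show "\<bar>?g x\<bar> \<le> G * (4 * wt s)" .
  qed
  have AE: "AE x in moll e. \<mu> n k s q / real n + (\<integral>\<zeta>. ?f x \<zeta> \<partial>std_normal_distribution) - cS * e * wt s / real n \<le> ?g x"
    using moll_AE[OF e1] by (rule eventually_mono) (rule V_super[OF n T])
  have "\<mu> n k s q / real n + (\<integral>x. (\<integral>\<zeta>. ?f x \<zeta> \<partial>std_normal_distribution) \<partial>moll e) - cS * e * wt s / real n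
    = (\<integral>x. \<mu> n k s q / real n + (\<integral>\<zeta>. ?f x \<zeta> \<partial>std_normal_distribution) - cS * e * wt s / real n \<partial>moll e)"
    using i1 by (simp add: M.prob_space)
  also have "\<dots> \<le> (\<integral>x. ?g x \<partial>moll e)"
    using i1 ig AE by (intro integral_mono_AE) auto
  finally show ?thesis unfolding swap by (simp add: W_def)
qed

text \<open>\<open>moll_jet\<close> applies with \<open>R = 2 * G * wt s\<close>, since
  \<open>wt (s + xs) \<le> 2 * wt s * (1 + norm x ^ 2)\<close>. The constant depends on
  \<open>e\<close>, not on the horizon.\<close>

lemma W_jet:
  "\<exists>c\<ge>0. \<forall>n T s q. n0 \<le> n \<longrightarrow>
    (\<exists>p B. bilinear B \<and> norm p \<le> c * wt s \<and> (\<forall>a b. \<bar>B a b\<bar> \<le> c * wt s * norm a * norm b) \<and>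
      (\<forall>d. \<bar>W e n ((T, s, q) + d) - W e n (T, s, q) - p \<bullet> d - B d d / 2\<bar> \<le> c * wt s * norm d ^ 3))"
proof -
  obtain c where c: "0 \<le> c" and jet: "\<And>(V :: 'k hjb_point \<Rightarrow> real) z R. V \<in> borel_measurable borel \<Longrightarrow> (\<forall>x. \<bar>V (z + x)\<bar> \<le> R * (1 + (norm x)\<^sup>2)) \<Longrightarrow>
    (\<exists>p B. bilinear B \<and> norm p \<le> c * R \<and> (\<forall>a b. \<bar>B a b\<bar> \<le> c * R * norm a * norm b) \<and>
      (\<forall>d. \<bar>(\<integral>x. V (z + d + x) \<partial>moll e) - (\<integral>x. V (z + x) \<partial>moll e) - p \<bullet> d - B d d / 2\<bar> \<le> c * R * norm d ^ 3))"
    using moll_jet[OF e1, where 'a = "'k hjb_point"] by metis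
  show ?thesis
  proof (intro exI[of _ "c * (2 * G)"] conjI allI impI)
    show "0 \<le> c * (2 * G)" using c G_ge by simp
    fix n :: nat and T :: real and s q :: "real^'k" assume n: "n0 \<le> n"
    have eq: "(T, s, q) + d + (e, 0, 0) + x = (T, s, q) + (e, 0, 0) + d + x" for d x :: "'k hjb_point"
      by (simp only: add_ac)
    have "\<forall>x. \<bar>V n ((T, s, q) + (e, 0, 0) + x)\<bar> \<le> (2 * G * wt s) * (1 + (norm x)\<^sup>2)"
    proof
      fix x :: "'k hjb_point"
      obtain xt xs xq where xx: "x = (xt, xs, xq)" by (metis surj_pair)
      have "\<bar>V n ((T, s, q) + (e, 0, 0) + x)\<bar> \<le> G * wt (s + xs)" unfolding xx by (simp add: V_growth[OF n])
      also have "\<dots> \<le> G * (2 * wt s * (1 + (norm x)\<^sup>2))"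
      proof (intro mult_left_mono)
        have "(norm xs)\<^sup>2 \<le> (norm x)\<^sup>2" using norm_triple[of x] xx by (intro power_mono) auto
        then have "2 * wt s * (1 + (norm xs)\<^sup>2) \<le> 2 * wt s * (1 + (norm x)\<^sup>2)" by (intro mult_left_mono) auto
        then show "wt (s + xs) \<le> 2 * wt s * (1 + (norm x)\<^sup>2)" using wt_add[of s xs] by linarith
      qed (use G_ge in auto)
      finally show "\<bar>V n ((T, s, q) + (e, 0, 0) + x)\<bar> \<le> (2 * G * wt s) * (1 + (norm x)\<^sup>2)" by (simp add: mult_ac)
    qed
    from jet[OF V_measurable[OF n] this] show "\<exists>p B. bilinear B \<and> norm p \<le> c * (2 * G) * wt s \<and> (\<forall>a b. \<bar>B a b\<bar> \<le> c * (2 * G) * wt s * norm a * norm b) \<and>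
      (\<forall>d. \<bar>W e n ((T, s, q) + d) - W e n (T, s, q) - p \<bullet> d - B d d / 2\<bar> \<le> c * (2 * G) * wt s * norm d ^ 3)"
      unfolding W_def eq by (simp only: mult.assoc)
  qed
qed

end

end

section \<open>Convergent coefficients and comparison of horizons\<close>

text \<open>The limit diffusion coefficient is one constant for all arms and pull counts.
  \<open>tau_lim\<close> compares squares because only the variance enters the limit
  equation.\<close>

locale bandit_limit = bandit_scheme \<mu> \<tau> C n0
  for \<mu> :: "nat \<Rightarrow> 'k::finite \<Rightarrow> real^'k \<Rightarrow> real^'k \<Rightarrow> real" and \<tau> C n0 +
  fixes \<mu>l :: "'k \<Rightarrow> real^'k \<Rightarrow> real^'k \<Rightarrow> real" and \<sigma>l :: real and \<gamma> :: "nat \<Rightarrow> real"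
  assumes mu_lim: "\<And>n k s q. n0 \<le> n \<Longrightarrow> \<bar>\<mu> n k s q - \<mu>l k s q\<bar> \<le> \<gamma> n * (1 + norm s)"
    and tau_lim: "\<And>n k q. n0 \<le> n \<Longrightarrow> \<bar>(\<tau> n k q)\<^sup>2 - \<sigma>l\<^sup>2\<bar> \<le> \<gamma> n"
    and gamma_lim: "\<gamma> \<longlonglongrightarrow> 0"
begin

lemma gamma_nonneg: "n0 \<le> n \<Longrightarrow> 0 \<le> \<gamma> n"
  using tau_lim[of n] abs_ge_zero order_trans by blast

definition rate :: "nat \<Rightarrow> real" where "rate n = 1 / sqrt (real n) + \<gamma> n"

text \<open>The mollified value function of horizon \<open>N\<close> is a smooth approximate supersolution of the
  limit equation, hence of the recursion of every other large horizon \<open>n\<close>.\<close>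

lemma W_super_other:
  assumes e: "0 < e" "e \<le> 1 / 4"
  shows "\<exists>c\<ge>0. \<forall>n N T k s q. n0 \<le> n \<longrightarrow> n0 \<le> N \<longrightarrow> 2 \<le> N \<longrightarrow> 0 \<le> T \<longrightarrow> T \<le> 1 \<longrightarrow>
    \<mu> n k s q / real n + (\<integral>\<zeta>. W e N ((T, s, q) + shift n k s q \<zeta>) \<partial>std_normal_distribution)
      - (cS * e + c * (rate n + rate N)) * wt s ^ 3 / real n \<le> W e N (T + 1 / real n, s, q) \<and>
    integrable std_normal_distribution (\<lambda>\<zeta>. W e N ((T, s, q) + shift n k s q \<zeta>))"
proof -
  obtain c where c: "0 \<le> c" and jet: "\<And>n T s q. n0 \<le> n \<Longrightarrow>
    (\<exists>p B. bilinear B \<and> norm p \<le> c * wt s \<and> (\<forall>a b. \<bar>B a b\<bar> \<le> c * wt s * norm a * norm b) \<and>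
      (\<forall>d. \<bar>W e n ((T, s, q) + d) - W e n (T, s, q) - p \<bullet> d - B d d / 2\<bar> \<le> c * wt s * norm d ^ 3))"
    using W_jet[OF e] by metis
  \<comment> \<open>\<open>2 + cc\<close> collects the errors of the time step and of
    \<open>consistency\<close>, \<open>2 + 3 * c\<close> the change of coefficients from
    \<open>N\<close> to \<open>n\<close>.\<close>
  define c' where "c' = (2 + cc) * c + 2 + 3 * c"
  have c': "0 \<le> c'" using c cc_nonneg by (simp add: c'_def)
  have cS0: "0 \<le> cS" using C G_ge normal_weight_ge_1[of 1]
    by (auto simp: cS_def[OF e] intro!: add_nonneg_nonneg mult_nonneg_nonneg)
  show ?thesis
  proof (intro exI[of _ c'] conjI allI impI c')
    fix n N :: nat and T :: real and k :: 'k and s q :: "real^'k"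
    assume n: "n0 \<le> n" and N: "n0 \<le> N" "2 \<le> N" and T: "0 \<le> T" "T \<le> 1"
    obtain p B where B: "bilinear B" and p: "norm p \<le> c * wt s" and Bb: "\<And>a b. \<bar>B a b\<bar> \<le> c * wt s * norm a * norm b"
      and j: "\<And>d. \<bar>W e N ((T, s, q) + d) - W e N (T, s, q) - p \<bullet> d - B d d / 2\<bar> \<le> c * wt s * norm d ^ 3"
      using jet[OF N(1), of s T q] by blast
    define b where "b = c * wt s"
    have b: "0 \<le> b" using c by (simp add: b_def)
    define x :: "'k hjb_point" where "x = (0, axis k 1, 0)"
    define y :: "'k hjb_point" where "y = (0, 0, axis k 1)"
    define tt :: "'k hjb_point" where "tt = (1, 0, 0)"
    have nx: "norm x = 1" "norm y = 1" "norm tt = 1" by (simp_all add: x_def y_def tt_def norm_Pair)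
    define w where "w = W e N (T, s, q)"
    \<comment> \<open>\<open>D m\<close> is the residual of the equation with the coefficients of
      horizon \<open>m\<close>; by \<open>near\<close> it is close to \<open>m\<close> times the
      one-step defect of \<open>W e N\<close>. It is almost nonnegative for \<open>m = N\<close>
      (\<open>DN\<close>) and changes little from \<open>N\<close> to \<open>n\<close>
      (\<open>Dn\<close>), and \<open>near\<close> leads back to the recursion of horizon
      \<open>n\<close>.\<close>
    define D where "D m = p \<bullet> tt - (\<mu> m k s q * (p \<bullet> x) + p \<bullet> y + (\<tau> m k q)\<^sup>2 / 2 * B x x) - \<mu> m k s q" for m
    have cons: "integrable std_normal_distribution (\<lambda>\<zeta>. W e N ((T, s, q) + shift m k s q \<zeta>))"
      "\<bar>(\<integral>\<zeta>. W e N ((T, s, q) + shift m k s q \<zeta>) \<partial>std_normal_distribution) - w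
        - (\<mu> m k s q * (p \<bullet> x) + p \<bullet> y + (\<tau> m k q)\<^sup>2 / 2 * B x x) / real m\<bar>
      \<le> cc * b * (wt s)\<^sup>2 / (real m * sqrt (real m))" if m: "n0 \<le> m" for m
    proof -
      have j': "\<bar>W e N ((T, s, q) + d) - W e N (T, s, q) - p \<bullet> d - B d d / 2\<bar> \<le> b * (norm d ^ 3 + norm d ^ 4)" for d
      proof -
        have "b * norm d ^ 3 \<le> b * (norm d ^ 3 + norm d ^ 4)" using b by (intro mult_left_mono) auto
        then show ?thesis using j[of d] unfolding b_def by linarith
      qed
      note c = consistency[OF m W_measurable[OF e N(1)] B p[folded b_def] Bb[folded b_def] j', of x y k s q]
      show "integrable std_normal_distribution (\<lambda>\<zeta>. W e N ((T, s, q) + shift m k s q \<zeta>))"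
        using c(1) nx by (simp add: shift_def x_def y_def)
      show "\<bar>(\<integral>\<zeta>. W e N ((T, s, q) + shift m k s q \<zeta>) \<partial>std_normal_distribution) - w
        - (\<mu> m k s q * (p \<bullet> x) + p \<bullet> y + (\<tau> m k q)\<^sup>2 / 2 * B x x) / real m\<bar>
      \<le> cc * b * (wt s)\<^sup>2 / (real m * sqrt (real m))"
        using c(2) nx unfolding shift_def x_def[symmetric] y_def[symmetric] w_def by simp
    qed
    have time: "\<bar>W e N (T + 1 / real m, s, q) - w - (p \<bullet> tt) / real m\<bar> \<le> 2 * b * (wt s)\<^sup>2 / (real m * sqrt (real m))"
      if m: "n0 \<le> m" for m
    proof -
      note M = n_pos[OF m]
      let ?d = "(1 / real m) *\<^sub>R tt"
      have nd: "norm ?d = 1 / real m" using nx M by simp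
      have eq: "(T, s, q) + ?d = (T + 1 / real m, s, q)" by (simp add: tt_def)
      let ?h = "1 / real m"
      have 1: "\<bar>B ?d ?d\<bar> \<le> b * ?h\<^sup>2" using Bb[of ?d ?d] unfolding nd b_def by (simp add: power2_eq_square)
      have 2: "b * ?h ^ 3 \<le> b * ?h\<^sup>2"
        using M b by (intro mult_left_mono power_decreasing) auto
      have 3: "\<bar>W e N (T + 1 / real m, s, q) - w - p \<bullet> ?d - B ?d ?d / 2\<bar> \<le> b * ?h ^ 3"
        using j[of ?d] unfolding nd eq w_def b_def .
      have 4: "\<bar>X - Y\<bar> \<le> 2 * Q" if "\<bar>X - Y - Z / 2\<bar> \<le> R" "\<bar>Z\<bar> \<le> Q" "R \<le> Q" for X Y Z R Q :: real
        using that by linarith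
      have "\<bar>W e N (T + 1 / real m, s, q) - w - p \<bullet> ?d\<bar> \<le> 2 * (b * ?h\<^sup>2)"
        by (rule 4[OF 3 1 2])
      also have "\<dots> = 2 * b * 1 / (real m * real m)" by (simp add: power2_eq_square)
      also have "\<dots> \<le> 2 * b * (wt s)\<^sup>2 / (real m * sqrt (real m))"
        using M b one_le_power[OF wt_ge_1[of s], of 2] by (intro frac_le mult_left_mono) auto
      finally show ?thesis by simp
    qed
    let ?E = "\<lambda>m. \<integral>\<zeta>. W e N ((T, s, q) + shift m k s q \<zeta>) \<partial>std_normal_distribution"
    have near: "\<bar>real m * (W e N (T + 1 / real m, s, q) - \<mu> m k s q / real m - ?E m) - D m\<bar> \<le> (2 + cc) * b * (wt s)\<^sup>2 / sqrt (real m)"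
      if m: "n0 \<le> m" for m
    proof -
      note M = n_pos[OF m]
      have eq: "real m * (W e N (T + 1 / real m, s, q) - \<mu> m k s q / real m - ?E m) - D m
        = real m * ((W e N (T + 1 / real m, s, q) - w - (p \<bullet> tt) / real m)
          - (?E m - w - (\<mu> m k s q * (p \<bullet> x) + p \<bullet> y + (\<tau> m k q)\<^sup>2 / 2 * B x x) / real m))"
        unfolding D_def using M by (simp add: field_simps)
      have "\<bar>(W e N (T + 1 / real m, s, q) - w - (p \<bullet> tt) / real m)
          - (?E m - w - (\<mu> m k s q * (p \<bullet> x) + p \<bullet> y + (\<tau> m k q)\<^sup>2 / 2 * B x x) / real m)\<bar>
          \<le> 2 * b * (wt s)\<^sup>2 / (real m * sqrt (real m)) + cc * b * (wt s)\<^sup>2 / (real m * sqrt (real m))"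
        using time[OF m] cons(2)[OF m] by linarith
      also have "\<dots> = ((2 + cc) * b * (wt s)\<^sup>2 / sqrt (real m)) / real m"
        by (simp add: algebra_simps add_divide_distrib)
      finally have "real m * \<bar>(W e N (T + 1 / real m, s, q) - w - (p \<bullet> tt) / real m)
          - (?E m - w - (\<mu> m k s q * (p \<bullet> x) + p \<bullet> y + (\<tau> m k q)\<^sup>2 / 2 * B x x) / real m)\<bar> \<le> real m * (((2 + cc) * b * (wt s)\<^sup>2 / sqrt (real m)) / real m)"
        by (intro mult_left_mono) auto
      then show ?thesis unfolding eq abs_mult using M by simp
    qed
    have DN: "- cS * e * wt s - (2 + cc) * b * (wt s)\<^sup>2 / sqrt (real N) \<le> D N"
    proof -
      note M = n_pos[OF N(1)]
      have "- (cS * e * wt s / real N) \<le> W e N (T + 1 / real N, s, q) - \<mu> N k s q / real N - ?E N"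
        using W_super[OF e N T, of k s q] by linarith
      then have "real N * - (cS * e * wt s / real N) \<le> real N * (W e N (T + 1 / real N, s, q) - \<mu> N k s q / real N - ?E N)"
        by (intro mult_left_mono) auto
      moreover have "real N * - (cS * e * wt s / real N) = - cS * e * wt s" using M by simp
      ultimately show ?thesis using near[OF N(1)] by linarith
    qed
    let ?g = "\<gamma> n + \<gamma> N"
    have g: "0 \<le> ?g" using gamma_nonneg n N by simp
    have Dn: "D N - ?g * (2 + 3 * c) * (wt s)\<^sup>2 \<le> D n"
    proof -
      have mu: "\<bar>\<mu> n k s q - \<mu> N k s q\<bar> \<le> ?g * (2 * wt s)"
      proof -
        have "\<bar>\<mu> n k s q - \<mu> N k s q\<bar> \<le> ?g * (1 + norm s)"
          using mu_lim[OF n, of k s q] mu_lim[OF N(1), of k s q] by (simp add: distrib_right)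
        also have "\<dots> \<le> ?g * (2 * wt s)" using g norm_le_wt(1)[of s] by (intro mult_left_mono)
        finally show ?thesis .
      qed
      have ta: "\<bar>(\<tau> n k q)\<^sup>2 - (\<tau> N k q)\<^sup>2\<bar> \<le> ?g"
        using tau_lim[OF n, of k q] tau_lim[OF N(1), of k q] by linarith
      have px: "\<bar>p \<bullet> x\<bar> \<le> c * wt s" using Cauchy_Schwarz_ineq2[of p x] p nx by simp
      have Bx: "\<bar>B x x\<bar> \<le> c * wt s" using Bb[of x x] nx by simp
      have "D N - D n = (\<mu> n k s q - \<mu> N k s q) * (p \<bullet> x + 1) + ((\<tau> n k q)\<^sup>2 - (\<tau> N k q)\<^sup>2) * (B x x / 2)"
        by (simp add: D_def algebra_simps)
      also have "\<dots> \<le> \<bar>\<mu> n k s q - \<mu> N k s q\<bar> * \<bar>p \<bullet> x + 1\<bar> + \<bar>(\<tau> n k q)\<^sup>2 - (\<tau> N k q)\<^sup>2\<bar> * \<bar>B x x / 2\<bar>"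
        unfolding abs_mult[symmetric] by (intro add_mono abs_ge_self)
      also have "\<dots> \<le> (?g * (2 * wt s)) * (c * wt s + 1) + ?g * (c * wt s / 2)"
        using mu ta px Bx g by (intro add_mono mult_mono) auto
      also have "\<dots> \<le> (?g * (2 * wt s)) * (c * wt s + wt s) + ?g * (c * (wt s * wt s))"
      proof (intro add_mono mult_left_mono)
        have "wt s * 1 \<le> wt s * wt s" by (intro mult_left_mono) auto
        then have "c * wt s \<le> c * (wt s * wt s)" using c by (intro mult_left_mono) auto
        moreover have "c * wt s / 2 \<le> c * wt s" using c by simp
        ultimately show "c * wt s / 2 \<le> c * (wt s * wt s)" by linarith
      qed (use g c in \<open>simp_all add: mult_nonneg_nonneg\<close>)
      also have "\<dots> = ?g * (2 + 3 * c) * (wt s)\<^sup>2" by (simp add: algebra_simps power2_eq_square)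
      finally show ?thesis by linarith
    qed
    note M = n_pos[OF n]
    have w23: "wt s \<le> wt s ^ 3" "(wt s)\<^sup>2 \<le> wt s ^ 3" "wt s * (wt s)\<^sup>2 = wt s ^ 3"
    proof -
      show "wt s \<le> wt s ^ 3" by (rule self_le_power) auto
      show "(wt s)\<^sup>2 \<le> wt s ^ 3" by (rule power_increasing) auto
      show "wt s * (wt s)\<^sup>2 = wt s ^ 3" by (simp add: power2_eq_square power3_eq_cube)
    qed
    have "- ((cS * e + c' * (rate n + rate N)) * wt s ^ 3) \<le> real n * (W e N (T + 1 / real n, s, q) - \<mu> n k s q / real n - ?E n)"
    proof -
      have 1: "cS * e * wt s \<le> cS * e * wt s ^ 3" using cS0 e w23 by (intro mult_left_mono) auto
      have 2: "?g * (2 + 3 * c) * (wt s)\<^sup>2 \<le> ?g * (2 + 3 * c) * wt s ^ 3" using g c w23 by (intro mult_left_mono) auto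
      have 3: "(2 + cc) * b * (wt s)\<^sup>2 / sqrt (real m) = (2 + cc) * c * wt s ^ 3 * (1 / sqrt (real m))" for m
        unfolding b_def w23(3)[symmetric] by simp
      have "cS * e * wt s ^ 3 + (2 + cc) * c * wt s ^ 3 * (1 / sqrt (real N)) + ?g * (2 + 3 * c) * wt s ^ 3 + (2 + cc) * c * wt s ^ 3 * (1 / sqrt (real n))
        = (cS * e + (2 + cc) * c * (1 / sqrt (real n) + 1 / sqrt (real N)) + (2 + 3 * c) * ?g) * wt s ^ 3"
        by (simp add: algebra_simps)
      also have "\<dots> \<le> (cS * e + c' * (rate n + rate N)) * wt s ^ 3"
      proof (intro mult_right_mono)
        have "c' * (rate n + rate N) = (2 + cc) * c * (1 / sqrt (real n) + 1 / sqrt (real N)) + (2 + 3 * c) * ?g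
          + (2 + cc) * c * ?g + (2 + 3 * c) * (1 / sqrt (real n) + 1 / sqrt (real N))"
          by (simp add: c'_def rate_def algebra_simps add_divide_distrib)
        moreover have "0 \<le> (2 + cc) * c * ?g" "0 \<le> (2 + 3 * c) * (1 / sqrt (real n) + 1 / sqrt (real N))"
          using g c cc_nonneg by auto
        ultimately show "cS * e + (2 + cc) * c * (1 / sqrt (real n) + 1 / sqrt (real N)) + (2 + 3 * c) * ?g \<le> cS * e + c' * (rate n + rate N)"
          by linarith
      qed auto
      finally have 4: "cS * e * wt s ^ 3 + (2 + cc) * c * wt s ^ 3 * (1 / sqrt (real N)) + ?g * (2 + 3 * c) * wt s ^ 3 + (2 + cc) * c * wt s ^ 3 * (1 / sqrt (real n))
        \<le> (cS * e + c' * (rate n + rate N)) * wt s ^ 3" .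
      have fin: "- P \<le> X" if "\<bar>X - D n\<bar> \<le> a" "- cS * e * wt s - b' \<le> D N" "D N - g \<le> D n" "cS * e * wt s \<le> s3" "g \<le> g3" "s3 + b' + g3 + a \<le> P"
        for P X a b' g s3 g3 :: real using that by linarith
      show ?thesis by (rule fin[OF near[OF n, unfolded 3] DN[unfolded 3] Dn 1 2 4])
    qed
    then have "- ((cS * e + c' * (rate n + rate N)) * wt s ^ 3) / real n \<le> W e N (T + 1 / real n, s, q) - \<mu> n k s q / real n - ?E n"
      using M by (simp add: field_simps)
    then show "\<mu> n k s q / real n + ?E n - (cS * e + c' * (rate n + rate N)) * wt s ^ 3 / real n \<le> W e N (T + 1 / real n, s, q)"
      by simp
    show "integrable std_normal_distribution (\<lambda>\<zeta>. W e N ((T, s, q) + shift n k s q \<zeta>))" by (rule cons(1)[OF n])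
  qed
qed

text \<open>Discrete comparison with the barrier \<open>K * a ^ j * wt s ^ 3\<close>. One step
  multiplies \<open>wt s ^ 3\<close> by at most \<open>1 + cw / n\<close> in the mean, and the
  surplus \<open>1 / n\<close> in \<open>a\<close> pays for the one-step error of
  \<open>W_super_other\<close>. At \<open>j = 0\<close> the barrier absorbs
  \<open>W_initial\<close>; \<open>W_near\<close> finally replaces \<open>W\<close> by
  \<open>V\<close>.\<close>

lemma u_le_V:
  assumes e: "0 < e" "e \<le> 1 / 4"
  shows "\<exists>c\<ge>0. \<forall>n N j s q. n0 \<le> n \<longrightarrow> n0 \<le> N \<longrightarrow> 2 \<le> N \<longrightarrow> j \<le> n \<longrightarrow>
    u n j s q \<le> V N (real j / real n, s, q)
      + ((8 * G * e + (cS * e + c * (rate n + rate N))) * exp (2 * (cw + 1)) + G * (4 * e + 1 / real N)) * wt s ^ 3"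
proof -
  obtain c where c: "0 \<le> c" and sup: "\<And>n N T k s q. n0 \<le> n \<Longrightarrow> n0 \<le> N \<Longrightarrow> 2 \<le> N \<Longrightarrow> 0 \<le> T \<Longrightarrow> T \<le> 1 \<Longrightarrow>
    \<mu> n k s q / real n + (\<integral>\<zeta>. W e N ((T, s, q) + shift n k s q \<zeta>) \<partial>std_normal_distribution)
      - (cS * e + c * (rate n + rate N)) * wt s ^ 3 / real n \<le> W e N (T + 1 / real n, s, q) \<and>
    integrable std_normal_distribution (\<lambda>\<zeta>. W e N ((T, s, q) + shift n k s q \<zeta>))"
    using W_super_other[OF e] by metis
  have cS0: "0 \<le> cS" using C G_ge normal_weight_ge_1[of 1]
    by (auto simp: cS_def[OF e] intro!: add_nonneg_nonneg mult_nonneg_nonneg)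
  show ?thesis
  proof (intro exI[of _ c] conjI allI impI c)
    fix n N j :: nat and s q :: "real^'k"
    assume n: "n0 \<le> n" and N: "n0 \<le> N" "2 \<le> N" and "j \<le> n"
    note M = n_pos[OF n]
    have rate0: "0 \<le> rate m" if "n0 \<le> m" for m using gamma_nonneg[OF that] by (simp add: rate_def)
    define err where "err = cS * e + c * (rate n + rate N)"
    have err: "0 \<le> err" using cS0 e c rate0[OF n] rate0[OF N(1)] by (simp add: err_def)
    define K where "K = 8 * G * e + err"
    have K: "err \<le> K" "0 \<le> K" "8 * G * e \<le> K" using G_ge e err by (simp_all add: K_def)
    define a where "a = 1 + (cw + 1) / real n"
    have a: "1 \<le> a" using cw_ge by (simp add: a_def)
    have main: "u n j s q \<le> W e N (real j / real n, s, q) + K * a ^ j * wt s ^ 3" using \<open>j \<le> n\<close>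
    proof (induction j arbitrary: s q)
      case 0
      have "wt s \<le> wt s ^ 3" by (rule self_le_power) auto
      then have "8 * G * e * wt s \<le> K * wt s ^ 3" using K by (intro mult_mono) auto
      then show ?case using W_initial[OF e N(1), of s q] by simp
    next
      case (Suc j)
      let ?T = "real j / real n"
      have T: "0 \<le> ?T" "?T \<le> 1" using Suc.prems M by (auto simp: field_simps)
      have T': "real (Suc j) / real n = ?T + 1 / real n" by (simp add: add_divide_distrib)
      have aj: "1 \<le> a ^ j" using a by (rule one_le_power)
      have "\<mu> n k s q / real n + step n k (u n j) s q \<le> W e N (real (Suc j) / real n, s, q) + K * a ^ Suc j * wt s ^ 3" for k
      proof -
        have i: "integrable std_normal_distribution (\<lambda>\<zeta>. W e N ((?T, s, q) + shift n k s q \<zeta>))"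
          and l: "\<mu> n k s q / real n + (\<integral>\<zeta>. W e N ((?T, s, q) + shift n k s q \<zeta>) \<partial>std_normal_distribution)
            - err * wt s ^ 3 / real n \<le> W e N (?T + 1 / real n, s, q)"
          using sup[OF n N T, of k s q] unfolding err_def by auto
        have "step n k (u n j) s q \<le> (\<integral>\<zeta>. W e N ((?T, s, q) + shift n k s q \<zeta>) + K * a ^ j * wt (move n k s q \<zeta>) ^ 3 \<partial>std_normal_distribution)"
          unfolding step_def
        proof (rule integral_mono[OF u_integrable[OF n]])
          show "integrable std_normal_distribution (\<lambda>\<zeta>. W e N ((?T, s, q) + shift n k s q \<zeta>) + K * a ^ j * wt (move n k s q \<zeta>) ^ 3)"
            using i wt_integrable(2)[OF n, of k s q] by simp
          fix \<zeta>
          show "u n j (move n k s q \<zeta>) (q + (1 / real n) *\<^sub>R axis k 1) \<le> W e N ((?T, s, q) + shift n k s q \<zeta>) + K * a ^ j * wt (move n k s q \<zeta>) ^ 3"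
            using Suc.IH[of "move n k s q \<zeta>" "q + (1 / real n) *\<^sub>R axis k 1"] Suc.prems by (simp add: shift_eq move_def)
        qed
        also have "\<dots> = (\<integral>\<zeta>. W e N ((?T, s, q) + shift n k s q \<zeta>) \<partial>std_normal_distribution) + K * a ^ j * (\<integral>\<zeta>. wt (move n k s q \<zeta>) ^ 3 \<partial>std_normal_distribution)"
          using i wt_integrable(2)[OF n, of k s q] by simp
        also have "\<dots> \<le> (\<integral>\<zeta>. W e N ((?T, s, q) + shift n k s q \<zeta>) \<partial>std_normal_distribution) + K * a ^ j * ((1 + cw / real n) * wt s ^ 3)"
          using integral_wt3_move[OF n, of k s q] K aj by (intro add_left_mono mult_left_mono) auto
        finally have 1: "step n k (u n j) s q \<le> \<dots>" .
        have "err \<le> K * a ^ j" using mult_mono[OF K(1) aj] K(2) by simp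
        then have "err / real n * wt s ^ 3 \<le> K * a ^ j / real n * wt s ^ 3"
          using M by (intro mult_right_mono divide_right_mono) auto
        moreover have "K * a ^ Suc j * wt s ^ 3 = K * a ^ j * ((1 + cw / real n) * wt s ^ 3) + K * a ^ j / real n * wt s ^ 3"
          by (simp add: a_def algebra_simps add_divide_distrib)
        ultimately show ?thesis using 1 l unfolding T' by (simp del: power_Suc)
      qed
      then show ?case by (simp add: Max_le_iff del: power_Suc)
    qed
    have "a ^ j \<le> exp (2 * (cw + 1))" unfolding a_def using \<open>j \<le> n\<close> cw_ge M by (intro power_le_exp2) auto
    then have 2: "K * a ^ j * wt s ^ 3 \<le> K * exp (2 * (cw + 1)) * wt s ^ 3"
      using K by (intro mult_right_mono mult_left_mono) auto
    have "wt s \<le> wt s ^ 3" by (rule self_le_power) auto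
    then have 3: "G * (4 * e + 1 / real N) * wt s \<le> G * (4 * e + 1 / real N) * wt s ^ 3"
      using G_ge e by (intro mult_left_mono) auto
    have "u n j s q \<le> V N (real j / real n, s, q) + (K * exp (2 * (cw + 1)) + G * (4 * e + 1 / real N)) * wt s ^ 3"
      using main 2 3 W_near[OF e N(1), of "real j / real n" s q] unfolding distrib_right by linarith
    then show "u n j s q \<le> V N (real j / real n, s, q)
      + ((8 * G * e + (cS * e + c * (rate n + rate N))) * exp (2 * (cw + 1)) + G * (4 * e + 1 / real N)) * wt s ^ 3"
      by (simp add: K_def err_def)
  qed
qed

lemma rate_lim: "rate \<longlonglongrightarrow> 0"
proof -
  have "(\<lambda>n. 1 / sqrt (real n)) \<longlonglongrightarrow> 0"
    by (intro tendsto_divide_0[OF tendsto_const] filterlim_compose[OF sqrt_at_top filterlim_real_sequentially, THEN filterlim_at_top_imp_at_infinity])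
  then show ?thesis unfolding rate_def[abs_def] using tendsto_add[OF _ gamma_lim] by force
qed

text \<open>The order of choices matters. The coefficient \<open>Kc\<close> of the terms
  proportional to \<open>e\<close> is built from constants that do not depend on \<open>e\<close>,
  so \<open>e\<close> can be fixed before the constant \<open>c\<close> of \<open>u_le_V\<close>,
  which does depend on it; large horizons control what remains.\<close>

lemma u_le_V_eventually:
  assumes "0 < \<eta>"
  shows "\<exists>n1\<ge>n0. \<forall>n\<ge>n1. \<forall>N\<ge>n1. \<forall>j\<le>n. \<forall>s q. u n j s q \<le> V N (real j / real n, s, q) + \<eta> * wt s ^ 3"
proof -
  let ?X = "exp (2 * (cw + 1))"
  define Kc where "Kc = (8 * G + cS) * ?X + 4 * G"
  have cS0: "0 \<le> cS" using C G_ge normal_weight_ge_1[of 1]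
    by (auto simp: cS_def[of "1/4"] intro!: add_nonneg_nonneg mult_nonneg_nonneg)
  have Kc: "0 \<le> Kc" using cS0 G_ge by (simp add: Kc_def)
  define e where "e = min (1 / 4) (\<eta> / (2 * (Kc + 1)))"
  have e: "0 < e" "e \<le> 1 / 4"
  proof -
    show "0 < e" using assms Kc by (simp add: e_def)
    show "e \<le> 1 / 4" unfolding e_def by (rule min.cobounded1)
  qed
  have "e \<le> \<eta> / (2 * (Kc + 1))" by (simp add: e_def)
  then have "e * (2 * (Kc + 1)) \<le> \<eta>" using Kc by (simp add: field_simps)
  moreover have "Kc * e \<le> (Kc + 1) * e" using e by (intro mult_right_mono) auto
  ultimately have Ke: "Kc * e \<le> \<eta> / 2" by (simp add: algebra_simps)
  obtain c where c: "0 \<le> c" and main: "\<And>n N j s q. n0 \<le> n \<Longrightarrow> n0 \<le> N \<Longrightarrow> 2 \<le> N \<Longrightarrow> j \<le> n \<Longrightarrow>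
    u n j s q \<le> V N (real j / real n, s, q)
      + ((8 * G * e + (cS * e + c * (rate n + rate N))) * ?X + G * (4 * e + 1 / real N)) * wt s ^ 3"
    using u_le_V[OF e] by metis
  have "(\<lambda>n. c * rate n * ?X + G * (1 / real n)) \<longlonglongrightarrow> c * 0 * ?X + G * 0"
    by (intro tendsto_intros rate_lim lim_1_over_n)
  then have "\<forall>\<^sub>F n in sequentially. c * rate n * ?X + G * (1 / real n) < \<eta> / 4"
    using assms by (intro order_tendstoD(2)) auto
  then obtain n2 where n2: "\<And>n. n2 \<le> n \<Longrightarrow> c * rate n * ?X + G * (1 / real n) < \<eta> / 4"
    unfolding eventually_sequentially by blast
  show ?thesis
  proof (intro exI[of _ "max n2 (max n0 2)"] conjI allI impI)
    fix n N j :: nat and s q :: "real^'k"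
    assume n: "max n2 (max n0 2) \<le> n" and N: "max n2 (max n0 2) \<le> N" and j: "j \<le> n"
    have "(8 * G * e + (cS * e + c * (rate n + rate N))) * ?X + G * (4 * e + 1 / real N)
      = Kc * e + c * rate n * ?X + (c * rate N * ?X + G * (1 / real N))"
      by (simp add: Kc_def algebra_simps)
    also have "\<dots> \<le> \<eta> / 2 + \<eta> / 4 + \<eta> / 4"
    proof (intro add_mono Ke)
      have "0 \<le> G * (1 / real n)" using G_ge by simp
      moreover have "c * rate n * ?X + G * (1 / real n) < \<eta> / 4" using n by (intro n2) simp
      ultimately show "c * rate n * ?X \<le> \<eta> / 4" by linarith
      show "c * rate N * ?X + G * (1 / real N) \<le> \<eta> / 4" using n2[of N] N by simp
    qed
    also have "\<eta> / 2 + \<eta> / 4 + \<eta> / 4 = \<eta>" by simp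
    finally have "((8 * G * e + (cS * e + c * (rate n + rate N))) * ?X + G * (4 * e + 1 / real N)) * wt s ^ 3 \<le> \<eta> * wt s ^ 3"
      by (rule mult_right_mono) simp
    with main[of n N j s q] n N j show "u n j s q \<le> V N (real j / real n, s, q) + \<eta> * wt s ^ 3" by linarith
  qed simp
qed

lemma V_eq_u:
  assumes T: "0 \<le> T" "T \<le> 1" shows "V n (T, s, q) = u n (nat \<lfloor>real n * T\<rfloor>) s q" "nat \<lfloor>real n * T\<rfloor> \<le> n"
proof -
  have "real n * T \<le> real n" using T by (simp add: mult_left_le)
  then show 1: "nat \<lfloor>real n * T\<rfloor> \<le> n" by linarith
  then show "V n (T, s, q) = u n (nat \<lfloor>real n * T\<rfloor>) s q" by (simp add: V_def min_absorb1)
qed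

text \<open>The one-sided bound holds with \<open>n\<close> and \<open>N\<close> exchanged, so it is
  two-sided. \<open>u_le_V_eventually\<close> speaks of the grid times of horizon \<open>n\<close>;
  a general \<open>T\<close> is within \<open>1 / n\<close> of one of them, and \<open>V_lip\<close>
  bridges the gap.\<close>

lemma V_cauchy:
  assumes "0 < \<eta>"
  shows "\<exists>n1\<ge>n0. \<forall>n\<ge>n1. \<forall>N\<ge>n1. \<forall>T s q. 0 \<le> T \<longrightarrow> T \<le> 1 \<longrightarrow> \<bar>V n (T, s, q) - V N (T, s, q)\<bar> \<le> \<eta> * wt s ^ 3"
proof -
  obtain n1 where n1: "n0 \<le> n1" and le: "\<And>n N j s q. n1 \<le> n \<Longrightarrow> n1 \<le> N \<Longrightarrow> j \<le> n \<Longrightarrow> u n j s q \<le> V N (real j / real n, s, q) + \<eta> / 2 * wt s ^ 3"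
    using u_le_V_eventually[of "\<eta> / 2"] assms by auto
  have "(\<lambda>n. G * (1 / real n)) \<longlonglongrightarrow> G * 0" by (intro tendsto_intros lim_1_over_n)
  then have "\<forall>\<^sub>F n in sequentially. G * (1 / real n) < \<eta> / 4"
    using assms by (intro order_tendstoD(2)) auto
  then obtain n2 where n2: "\<And>n. n2 \<le> n \<Longrightarrow> G * (1 / real n) < \<eta> / 4"
    unfolding eventually_sequentially by blast
  have half: "V n (T, s, q) \<le> V N (T, s, q) + \<eta> * wt s ^ 3"
    if n: "max n1 n2 \<le> n" and N: "max n1 n2 \<le> N" and T: "0 \<le> T" "T \<le> 1" for n N T s q
  proof -
    let ?j = "nat \<lfloor>real n * T\<rfloor>"
    note M = n_pos[of n] n_pos[of N]
    have nn: "n0 \<le> n" "n0 \<le> N" using n N n1 by auto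
    have "\<bar>real ?j - real n * T\<bar> \<le> 1" using T by (simp add: of_nat_nat) linarith
    then have "\<bar>real ?j - real n * T\<bar> / real n \<le> 1 / real n" by (simp add: divide_right_mono)
    moreover have "\<bar>real ?j / real n - T\<bar> = \<bar>real ?j - real n * T\<bar> / real n"
    proof -
      have "\<bar>real ?j - real n * T\<bar> / real n = \<bar>(real ?j - real n * T) / real n\<bar>" by (simp add: abs_divide)
      also have "(real ?j - real n * T) / real n = real ?j / real n - T"
        using M(1)[OF nn(1)] by (simp add: diff_divide_distrib)
      finally show ?thesis ..
    qed
    ultimately have jT: "\<bar>real ?j / real n - T\<bar> \<le> 1 / real n" by simp
    have "V n (T, s, q) \<le> V N (real ?j / real n, s, q) + \<eta> / 2 * wt s ^ 3"
      unfolding V_eq_u(1)[OF T] using n N V_eq_u(2)[OF T] by (intro le) auto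
    moreover have "\<bar>V N (real ?j / real n, s, q) - V N (T, s, q)\<bar> \<le> \<eta> / 2 * wt s ^ 3"
    proof -
      have "\<bar>V N (real ?j / real n, s, q) - V N (T, s, q)\<bar> \<le> G * (\<bar>real ?j / real n - T\<bar> + 1 / real N) * wt s"
        using V_lip[OF nn(2), of "real ?j / real n" s q T s q] by simp
      also have "\<dots> \<le> G * (1 / real n + 1 / real N) * wt s ^ 3"
        using jT G_ge by (intro mult_mono add_mono self_le_power) auto
      also have "\<dots> \<le> (\<eta> / 2) * wt s ^ 3"
      proof (intro mult_right_mono)
        have "G * (1 / real n) < \<eta> / 4" "G * (1 / real N) < \<eta> / 4" using n2[of n] n2[of N] n N by auto
        then show "G * (1 / real n + 1 / real N) \<le> \<eta> / 2" unfolding distrib_left by linarith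
      qed auto
      finally show ?thesis .
    qed
    moreover have "\<eta> * wt s ^ 3 = \<eta> / 2 * wt s ^ 3 + \<eta> / 2 * wt s ^ 3" by simp
    ultimately show ?thesis by linarith
  qed
  show ?thesis
  proof (intro exI[of _ "max n1 n2"] conjI allI impI)
    fix n N :: nat and T :: real and s q :: "real^'k"
    assume "max n1 n2 \<le> n" "max n1 n2 \<le> N" "0 \<le> T" "T \<le> 1"
    then show "\<bar>V n (T, s, q) - V N (T, s, q)\<bar> \<le> \<eta> * wt s ^ 3"
      using half[of n N T s q] half[of N n T s q] by linarith
  qed (use n1 in simp)
qed

section \<open>The limit function\<close>

text \<open>The first argument is the time to go: the solution of the equation at time
  \<open>t\<close> is \<open>vl (1 - t)\<close>.\<close>

definition vl :: "real \<Rightarrow> real^'k \<Rightarrow> real^'k \<Rightarrow> real" where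
  "vl T s q = lim (\<lambda>n. V n (T, s, q))"

lemma V_tendsto:
  assumes T: "0 \<le> T" "T \<le> 1" shows "(\<lambda>n. V n (T, s, q)) \<longlonglongrightarrow> vl T s q"
proof -
  have "Cauchy (\<lambda>n. V n (T, s, q))"
  proof (rule metric_CauchyI)
    fix r :: real assume r: "0 < r"
    have w: "0 < wt s ^ 3" by simp
    with r have "0 < r / 2 / wt s ^ 3" by simp
    from V_cauchy[OF this] obtain n1 where
      "\<And>n N. n1 \<le> n \<Longrightarrow> n1 \<le> N \<Longrightarrow> \<bar>V n (T, s, q) - V N (T, s, q)\<bar> \<le> r / 2 / wt s ^ 3 * wt s ^ 3"
      using T by blast
    moreover have "r / 2 / wt s ^ 3 * wt s ^ 3 < r" using w r by simp
    ultimately show "\<exists>M. \<forall>m\<ge>M. \<forall>n\<ge>M. dist (V m (T, s, q)) (V n (T, s, q)) < r"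
      unfolding dist_real_def by (meson le_less_trans)
  qed
  then show ?thesis unfolding vl_def by (simp add: Cauchy_convergent_iff convergent_LIMSEQ_iff)
qed

lemma vl_lip:
  assumes T: "0 \<le> T" "T \<le> 1" "0 \<le> T'" "T' \<le> 1"
  shows "\<bar>vl T s q - vl T' s' q'\<bar> \<le> G * \<bar>T - T'\<bar> * wt s + G * norm (s - s') + G * wt s * norm (q - q')"
proof (rule tendsto_le[OF sequentially_bot])
  show "(\<lambda>n. \<bar>V n (T, s, q) - V n (T', s', q')\<bar>) \<longlonglongrightarrow> \<bar>vl T s q - vl T' s' q'\<bar>"
    using T by (intro tendsto_intros V_tendsto)
  have "(\<lambda>n. G * (\<bar>T - T'\<bar> + 1 / real n) * wt s + G * norm (s - s') + G * wt s * norm (q - q'))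
    \<longlonglongrightarrow> G * (\<bar>T - T'\<bar> + 0) * wt s + G * norm (s - s') + G * wt s * norm (q - q')"
    by (intro tendsto_intros lim_1_over_n)
  then show "(\<lambda>n. G * (\<bar>T - T'\<bar> + 1 / real n) * wt s + G * norm (s - s') + G * wt s * norm (q - q'))
    \<longlonglongrightarrow> G * \<bar>T - T'\<bar> * wt s + G * norm (s - s') + G * wt s * norm (q - q')" by simp
  show "\<forall>\<^sub>F n in sequentially. \<bar>V n (T, s, q) - V n (T', s', q')\<bar> \<le> G * (\<bar>T - T'\<bar> + 1 / real n) * wt s + G * norm (s - s') + G * wt s * norm (q - q')"
    using V_lip by (auto simp: eventually_sequentially intro!: exI[of _ n0])
qed

text \<open>Passage to the limit in \<open>N\<close> in \<open>V_cauchy\<close>. Uniformity in the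
  state, up to the weight, allows evaluation at states that move with \<open>n\<close>.\<close>

lemma u_near_vl:
  assumes "0 < \<eta>"
  shows "\<exists>n1\<ge>n0. \<forall>n\<ge>n1. \<forall>j\<le>n. \<forall>s q. \<bar>u n j s q - vl (real j / real n) s q\<bar> \<le> \<eta> * wt s ^ 3"
proof -
  obtain n1 where n1: "n0 \<le> n1" and c: "\<And>n N T s q. n1 \<le> n \<Longrightarrow> n1 \<le> N \<Longrightarrow> 0 \<le> T \<Longrightarrow> T \<le> 1 \<Longrightarrow> \<bar>V n (T, s, q) - V N (T, s, q)\<bar> \<le> \<eta> * wt s ^ 3"
    using V_cauchy[OF assms] by blast
  show ?thesis
  proof (intro exI[of _ n1] conjI allI impI n1)
    fix n j :: nat and s q :: "real^'k" assume n: "n1 \<le> n" and j: "j \<le> n"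
    note M = n_pos[OF order_trans[OF n1 n]]
    let ?T = "real j / real n"
    have T: "0 \<le> ?T" "?T \<le> 1" using j M by (auto simp: field_simps)
    have "real n * ?T = real j" using M by simp
    then have V: "V n (?T, s, q) = u n j s q" using V_eq_u(1)[OF T, of n s q] by simp
    show "\<bar>u n j s q - vl ?T s q\<bar> \<le> \<eta> * wt s ^ 3"
    proof (rule tendsto_upperbound[OF _ _ sequentially_bot])
      show "(\<lambda>N. \<bar>V n (?T, s, q) - V N (?T, s, q)\<bar>) \<longlonglongrightarrow> \<bar>u n j s q - vl ?T s q\<bar>"
        unfolding V using T by (intro tendsto_intros V_tendsto)
      show "\<forall>\<^sub>F N in sequentially. \<bar>V n (?T, s, q) - V N (?T, s, q)\<bar> \<le> \<eta> * wt s ^ 3"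
        using c[OF n _ T] by (auto simp: eventually_sequentially)
    qed
  qed
qed

end

subsection \<open>The limit is a viscosity solution\<close>

text \<open>Mean value theorem on the segment from \<open>z\<close> to \<open>y\<close> for
  \<open>\<phi>\<close> minus its quadratic model; the derivative of the difference is small by
  differentiability of \<open>g\<close> at \<open>z\<close>.\<close>

lemma C2_on_taylor:
  assumes C2: "C2_on \<Omega> \<phi> g H" and "open \<Omega>" "z \<in> \<Omega>" "0 < \<kappa>"
  shows "\<forall>\<^sub>F y in nhds z. \<bar>\<phi> y - \<phi> z - g z \<bullet> (y - z) - (y - z) \<bullet> blinfun_apply (H z) (y - z) / 2\<bar> \<le> \<kappa> * (norm (y - z))\<^sup>2"
proof -
  have d\<phi>: "(\<phi> has_derivative (\<lambda>h. g y \<bullet> h)) (at y)" if "y \<in> \<Omega>" for y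
    using C2 that by (simp add: C2_on_def)
  have dg: "(g has_derivative blinfun_apply (H z)) (at z)"
    using C2 \<open>z \<in> \<Omega>\<close> by (simp add: C2_on_def)
  obtain d where d: "0 < d" "\<And>y. norm (y - z) < d \<Longrightarrow> norm (g y - g z - blinfun_apply (H z) (y - z)) \<le> \<kappa> * norm (y - z)"
    using dg \<open>0 < \<kappa>\<close> unfolding has_derivative_at_alt by blast
  obtain d' where d': "0 < d'" "ball z d' \<subseteq> \<Omega>" using \<open>open \<Omega>\<close> \<open>z \<in> \<Omega>\<close> by (meson openE)
  have "\<forall>\<^sub>F y in nhds z. y \<in> ball z (min d d')"
    using d(1) d'(1) by (intro eventually_nhds_in_open) auto
  then show ?thesis
  proof eventually_elim
    case (elim y)
    define h where "h = y - z"
    have h: "norm h < d" "norm h < d'" using elim by (auto simp: h_def dist_norm norm_minus_commute)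
    let ?\<psi> = "\<lambda>r. \<phi> (z + r *\<^sub>R h) - r * (g z \<bullet> h) - r\<^sup>2 / 2 * (h \<bullet> blinfun_apply (H z) h)"
    let ?\<psi>' = "\<lambda>r. g (z + r *\<^sub>R h) \<bullet> h - g z \<bullet> h - r * (h \<bullet> blinfun_apply (H z) h)"
    have nr: "norm (r *\<^sub>R h) \<le> norm h" if "0 \<le> r" "r \<le> 1" for r using that by (simp add: mult_left_le_one_le)
    have D: "(?\<psi> has_real_derivative ?\<psi>' r) (at r)" if r: "0 \<le> r" "r \<le> 1" for r
    proof -
      have "z + r *\<^sub>R h \<in> ball z d'" using nr[OF r] h by (simp add: dist_norm)
      then have "z + r *\<^sub>R h \<in> \<Omega>" using d'(2) by blast
      moreover have "((\<lambda>r. z + r *\<^sub>R h) has_derivative (\<lambda>r. r *\<^sub>R h)) (at r)"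
        by (auto intro!: derivative_eq_intros)
      ultimately have "((\<lambda>r. \<phi> (z + r *\<^sub>R h)) has_derivative (\<lambda>x. g (z + r *\<^sub>R h) \<bullet> (x *\<^sub>R h))) (at r)"
        by (intro has_derivative_compose[where f = "\<lambda>r. z + r *\<^sub>R h" and g = \<phi>] d\<phi>)
      then have "((\<lambda>r. \<phi> (z + r *\<^sub>R h)) has_real_derivative (g (z + r *\<^sub>R h) \<bullet> h)) (at r)"
        by (simp add: has_field_derivative_def mult_commute_abs)
      then show ?thesis by (auto intro!: derivative_eq_intros)
    qed
    obtain r where r: "0 < r" "r < 1" "?\<psi> 1 - ?\<psi> 0 = (1 - 0) * ?\<psi>' r"
      using MVT2[of 0 1 ?\<psi> ?\<psi>'] D by auto
    have "?\<psi>' r = (g (z + r *\<^sub>R h) - g z - blinfun_apply (H z) (r *\<^sub>R h)) \<bullet> h"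
      by (simp add: inner_diff_left inner_diff_right blinfun.scaleR_right inner_commute)
    then have "\<bar>?\<psi>' r\<bar> \<le> norm (g (z + r *\<^sub>R h) - g z - blinfun_apply (H z) (r *\<^sub>R h)) * norm h"
      by (simp add: Cauchy_Schwarz_ineq2)
    also have "\<dots> \<le> (\<kappa> * norm (r *\<^sub>R h)) * norm h"
      using d(2)[of "z + r *\<^sub>R h"] nr[of r] r h by (intro mult_right_mono) auto
    also have "\<dots> \<le> (\<kappa> * norm h) * norm h" using nr[of r] r \<open>0 < \<kappa>\<close> by (intro mult_right_mono mult_left_mono) auto
    finally have "\<bar>?\<psi> 1 - ?\<psi> 0\<bar> \<le> \<kappa> * (norm h)\<^sup>2" using r(3) by (simp add: power2_eq_square)
    moreover have "?\<psi> 1 - ?\<psi> 0 = \<phi> y - \<phi> z - g z \<bullet> h - h \<bullet> blinfun_apply (H z) h / 2"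
      by (simp add: h_def)
    ultimately show ?case by (simp only: h_def)
  qed
qed

lemma norm_adjoint_le:
  fixes H :: "'a::euclidean_space \<Rightarrow>\<^sub>L 'a"
  shows "norm (adjoint (blinfun_apply H) a) \<le> norm H * norm a"
proof -
  let ?b = "adjoint (blinfun_apply H) a"
  have "norm ?b * norm ?b = blinfun_apply H ?b \<bullet> a"
    using adjoint_works[OF bounded_linear.linear[OF blinfun.bounded_linear_right], of ?b H a]
    by (simp add: power2_norm_eq_inner flip: power2_eq_square)
  also have "\<dots> \<le> norm (blinfun_apply H ?b) * norm a" by (rule norm_cauchy_schwarz)
  also have "\<dots> \<le> (norm H * norm ?b) * norm a" by (intro mult_right_mono norm_blinfun) simp
  finally have "norm ?b * norm ?b \<le> (norm H * norm a) * norm ?b" by (simp add: mult_ac)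
  then show ?thesis by (cases "norm ?b = 0") (auto simp: mult_le_cancel_right)
qed

text \<open>Beyond second order the expansion of \<open>Q\<close> is exactly
  \<open>\<Lambda> * (4 * (a \<bullet> d) * norm d ^ 2 + norm d ^ 4)\<close>, and \<open>b\<close>
  bounds all coefficients uniformly for \<open>norm a \<le> 1\<close>. \<open>H\<close> may be
  nonsymmetric, hence the adjoint in the gradient \<open>p\<close>; the expansion sees only the
  diagonal \<open>B d d\<close>, where symmetrising \<open>H\<close> would change nothing.\<close>

lemma quartic_jet:
  fixes g a d :: "'a::euclidean_space" and H :: "'a \<Rightarrow>\<^sub>L 'a" and \<kappa> \<Lambda> :: real
  defines "Q \<equiv> \<lambda>a. g \<bullet> a + a \<bullet> blinfun_apply H a / 2 + 2 * \<kappa> * (norm a)\<^sup>2 + \<Lambda> * norm a ^ 4"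
    and "p \<equiv> \<lambda>a. g + (1 / 2) *\<^sub>R (blinfun_apply H a + adjoint (blinfun_apply H) a) + (4 * \<kappa> + 4 * \<Lambda> * (norm a)\<^sup>2) *\<^sub>R a"
    and "B \<equiv> \<lambda>a x y. x \<bullet> blinfun_apply H y + (4 * \<kappa> + 4 * \<Lambda> * (norm a)\<^sup>2) * (x \<bullet> y) + 8 * \<Lambda> * (a \<bullet> x) * (a \<bullet> y)"
    and "b \<equiv> norm g + norm H + 4 * \<kappa> + 12 * \<Lambda>"
  assumes pos: "0 \<le> \<kappa>" "0 \<le> \<Lambda>" and a: "norm a \<le> 1"
  shows "bilinear (B a)" "norm (p a) \<le> b" "\<bar>B a x y\<bar> \<le> b * norm x * norm y"
    "\<bar>Q (a + d) - Q a - p a \<bullet> d - B a d d / 2\<bar> \<le> b * (norm d ^ 3 + norm d ^ 4)"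
proof -
  have a2: "(norm a)\<^sup>2 \<le> 1" using a by (simp add: power_le_one)
  have La: "\<Lambda> * (norm a)\<^sup>2 \<le> \<Lambda>" using pos a2 by (simp add: mult_left_le)
  show "bilinear (B a)"
    unfolding bilinear_def B_def
    by (auto intro!: linearI simp: inner_add_left inner_add_right blinfun.add_right blinfun.scaleR_right algebra_simps)
  have "norm (p a) \<le> norm g + norm ((1 / 2) *\<^sub>R (blinfun_apply H a + adjoint (blinfun_apply H) a)) + norm ((4 * \<kappa> + 4 * \<Lambda> * (norm a)\<^sup>2) *\<^sub>R a)"
    unfolding p_def by (intro norm_triangle_mono order_refl)
  moreover have "norm ((1 / 2) *\<^sub>R (blinfun_apply H a + adjoint (blinfun_apply H) a)) \<le> norm H"
  proof -
    have "norm H * norm a \<le> norm H" using a by (simp add: mult_left_le)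
    then have "norm (blinfun_apply H a + adjoint (blinfun_apply H) a) \<le> norm H + norm H"
      using norm_blinfun[of H a] norm_adjoint_le[of H a] by (intro norm_triangle_mono) auto
    then show ?thesis by simp
  qed
  moreover have "norm ((4 * \<kappa> + 4 * \<Lambda> * (norm a)\<^sup>2) *\<^sub>R a) \<le> (4 * \<kappa> + 4 * \<Lambda>) * 1"
    unfolding norm_scaleR using pos a La by (intro mult_mono) auto
  ultimately show "norm (p a) \<le> b" using pos by (simp add: b_def)
  have Bb: "\<bar>B a x y\<bar> \<le> b * (norm x * norm y)" for x y
  proof -
    have xy: "\<bar>x \<bullet> y\<bar> \<le> norm x * norm y" by (rule Cauchy_Schwarz_ineq2)
    have "\<bar>x \<bullet> blinfun_apply H y\<bar> \<le> norm x * (norm H * norm y)"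
      by (rule order_trans[OF Cauchy_Schwarz_ineq2]) (intro mult_left_mono norm_blinfun, simp)
    then have 1: "\<bar>x \<bullet> blinfun_apply H y\<bar> \<le> norm H * (norm x * norm y)" by (simp add: mult_ac)
    have 2: "\<bar>(4 * \<kappa> + 4 * \<Lambda> * (norm a)\<^sup>2) * (x \<bullet> y)\<bar> \<le> (4 * \<kappa> + 4 * \<Lambda>) * (norm x * norm y)"
      unfolding abs_mult using pos La xy by (intro mult_mono) auto
    have ax: "\<bar>a \<bullet> x\<bar> \<le> norm x" for x
      using Cauchy_Schwarz_ineq2[of a x] mult_right_mono[OF a, of "norm x"] by simp
    have "\<bar>(a \<bullet> x) * (a \<bullet> y)\<bar> \<le> norm x * norm y"
      unfolding abs_mult using ax by (intro mult_mono) auto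
    then have 3: "\<bar>8 * \<Lambda> * (a \<bullet> x) * (a \<bullet> y)\<bar> \<le> 8 * \<Lambda> * (norm x * norm y)"
      using pos by (simp add: abs_mult mult_left_mono mult.assoc)
    have "\<bar>B a x y\<bar> \<le> norm H * (norm x * norm y) + (4 * \<kappa> + 4 * \<Lambda>) * (norm x * norm y) + 8 * \<Lambda> * (norm x * norm y)"
      unfolding B_def using 1 2 3 by linarith
    also have "\<dots> = (b - norm g) * (norm x * norm y)" by (simp add: b_def algebra_simps)
    also have "\<dots> \<le> b * (norm x * norm y)" by (intro mult_right_mono) auto
    finally show ?thesis .
  qed
  then show "\<bar>B a x y\<bar> \<le> b * norm x * norm y" by (simp add: mult.assoc)
  have n2: "(norm (a + d))\<^sup>2 = (norm a)\<^sup>2 + 2 * (a \<bullet> d) + (norm d)\<^sup>2"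
    by (simp add: power2_norm_eq_inner inner_add_left inner_add_right inner_commute)
  have n4: "norm (a + d) ^ 4 = ((norm a)\<^sup>2 + 2 * (a \<bullet> d) + (norm d)\<^sup>2)\<^sup>2"
    by (metis n2 power2_eq_square power4_eq_xxxx mult.assoc)
  have ad: "adjoint (blinfun_apply H) a \<bullet> d = a \<bullet> blinfun_apply H d"
    using adjoint_works[OF bounded_linear.linear[OF blinfun.bounded_linear_right], of d H a] by (simp add: inner_commute)
  have eq: "Q (a + d) - Q a - p a \<bullet> d - B a d d / 2 = \<Lambda> * (4 * (a \<bullet> d) * (norm d)\<^sup>2 + norm d ^ 4)"
    unfolding Q_def p_def B_def n2 n4
    by (simp add: inner_add_left inner_add_right blinfun.add_right ad inner_commute[of d "blinfun_apply H a"] power2_norm_eq_inner[symmetric])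
      (simp add: power2_eq_square power4_eq_xxxx algebra_simps add_divide_distrib)
  have "\<bar>(a \<bullet> d) * (norm d)\<^sup>2\<bar> \<le> norm d * (norm d)\<^sup>2"
    unfolding abs_mult using Cauchy_Schwarz_ineq2[of a d] mult_right_mono[OF a, of "norm d"] by (intro mult_mono) auto
  then have "\<bar>(a \<bullet> d) * (norm d)\<^sup>2\<bar> \<le> norm d ^ 3" by (simp add: power2_eq_square power3_eq_cube)
  moreover have "\<bar>4 * X + Y\<bar> \<le> 4 * (Z + Y)" if "\<bar>X\<bar> \<le> Z" "0 \<le> Y" for X Y Z :: real
    using that unfolding distrib_left by linarith
  ultimately have "\<bar>4 * (a \<bullet> d) * (norm d)\<^sup>2 + norm d ^ 4\<bar> \<le> 4 * (norm d ^ 3 + norm d ^ 4)"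
    unfolding mult.assoc[of 4 "a \<bullet> d"] by simp
  then have "\<Lambda> * \<bar>4 * (a \<bullet> d) * (norm d)\<^sup>2 + norm d ^ 4\<bar> \<le> \<Lambda> * (4 * (norm d ^ 3 + norm d ^ 4))"
    using pos by (intro mult_left_mono) auto
  also have "\<dots> = (4 * \<Lambda>) * (norm d ^ 3 + norm d ^ 4)" by simp
  also have "\<dots> \<le> b * (norm d ^ 3 + norm d ^ 4)"
    using pos by (intro mult_right_mono) (auto simp: b_def add_increasing)
  finally show "\<bar>Q (a + d) - Q a - p a \<bullet> d - B a d d / 2\<bar> \<le> b * (norm d ^ 3 + norm d ^ 4)"
    unfolding eq abs_mult[of \<Lambda>] using pos by simp
qed

context bandit_limit
begin

lemma mu_tendsto:
  assumes "s \<longlonglongrightarrow> s0" "q \<longlonglongrightarrow> q0"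
  shows "(\<lambda>n. \<mu> n k (s n) (q n)) \<longlonglongrightarrow> \<mu>l k s0 q0"
proof -
  let ?h = "\<lambda>n. C * norm (s n - s0) + C * (1 + norm s0) * norm (q n - q0) + \<gamma> n * (1 + norm s0)"
  have "?h \<longlonglongrightarrow> C * norm (s0 - s0) + C * (1 + norm s0) * norm (q0 - q0) + 0 * (1 + norm s0)"
    by (intro tendsto_intros assms gamma_lim)
  then have h: "?h \<longlonglongrightarrow> 0" by simp
  have "(\<lambda>n. \<mu> n k (s n) (q n) - \<mu>l k s0 q0) \<longlonglongrightarrow> 0"
  proof (rule Lim_null_comparison[OF _ h])
    show "\<forall>\<^sub>F n in sequentially. norm (\<mu> n k (s n) (q n) - \<mu>l k s0 q0) \<le> ?h n"
      unfolding eventually_sequentially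
    proof (intro exI allI impI)
      fix n assume n: "n0 \<le> n"
      show "norm (\<mu> n k (s n) (q n) - \<mu>l k s0 q0) \<le> ?h n"
        using mu_lip_s[OF n, of k "s n" "q n" s0] mu_lip_q[OF n, of k s0 "q n" q0] mu_lim[OF n, of k s0 q0] by simp
    qed
  qed
  then show ?thesis by (simp add: LIM_zero_iff)
qed

lemma tau_tendsto: "(\<lambda>n. (\<tau> n k (q n))\<^sup>2) \<longlonglongrightarrow> \<sigma>l\<^sup>2"
proof -
  have "(\<lambda>n. (\<tau> n k (q n))\<^sup>2 - \<sigma>l\<^sup>2) \<longlonglongrightarrow> 0"
    by (rule Lim_null_comparison[OF _ gamma_lim]) (auto simp: eventually_sequentially intro!: exI[of _ n0] tau_lim)
  then show ?thesis by (simp add: LIM_zero_iff)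
qed

text \<open>With \<open>c = 1\<close> and all arms this gives the subsolution property, with \<open>c = - 1\<close> and a single arm
  the supersolution property. The test function is replaced by a quartic polynomial \<open>Q\<close> that touches
  \<open>c * vl\<close> strictly at the point and dominates \<open>c * u n\<close> far away.\<close>

lemma touching_inequality:
  fixes S :: "'k set" and g :: "'k hjb_point" and H :: "'k hjb_point \<Rightarrow>\<^sub>L 'k hjb_point"
  assumes c: "\<bar>c\<bar> = 1" and t0: "0 < t0" "t0 < 1"
    and rec: "\<And>n j s q. n0 \<le> n \<Longrightarrow> \<exists>k\<in>S. c * u n (Suc j) s q \<le> c * \<mu> n k s q / real n + c * step n k (u n j) s q"
    and touch: "\<And>\<kappa>. 0 < \<kappa> \<Longrightarrow> \<forall>\<^sub>F z in nhds (t0, s0, q0).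
      c * vl (1 - fst z) (fst (snd z)) (snd (snd z)) \<le> c * vl (1 - t0) s0 q0 + g \<bullet> (z - (t0, s0, q0))
        + (z - (t0, s0, q0)) \<bullet> blinfun_apply H (z - (t0, s0, q0)) / 2 + \<kappa> * (norm (z - (t0, s0, q0)))\<^sup>2"
  shows "\<exists>k\<in>S. 0 \<le> fst g + snd (snd g) $ k + \<mu>l k s0 q0 * fst (snd g) $ k
    + 1 / 2 * \<sigma>l\<^sup>2 * ((0, axis k 1, 0) \<bullet> blinfun_apply H (0, axis k 1, 0)) + c * \<mu>l k s0 q0"
proof (rule ccontr)
  let ?L = "\<lambda>k. fst g + snd (snd g) $ k + \<mu>l k s0 q0 * fst (snd g) $ k
    + 1 / 2 * \<sigma>l\<^sup>2 * ((0, axis k 1, 0) \<bullet> blinfun_apply H (0, axis k 1, 0)) + c * \<mu>l k s0 q0"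
  assume "\<not> (\<exists>k\<in>S. 0 \<le> ?L k)"
  then have neg: "\<And>k. k \<in> S \<Longrightarrow> ?L k < 0" by force
  let ?pt = "(t0, s0, q0)"
  have "S \<noteq> {}" using rec[of n0] by auto
  define m where "m = Max (?L ` S)"
  have m: "m < 0" "\<And>k. k \<in> S \<Longrightarrow> ?L k \<le> m"
    using neg \<open>S \<noteq> {}\<close> by (auto simp: m_def)
  \<comment> \<open>The quadratic term of \<open>Q\<close> adds \<open>4 * \<kappa>\<close> to the
    second derivative, hence \<open>2 * \<kappa> * \<sigma>l^2\<close> to the expression
    \<open>?L k\<close>; this \<open>\<kappa>\<close> is small enough to keep the sum
    negative.\<close>
  define \<kappa> where "\<kappa> = - m / (4 * (\<sigma>l\<^sup>2 + 1))"
  have s1: "0 < \<sigma>l\<^sup>2 + 1" by (simp add: add_nonneg_pos)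
  have \<kappa>: "0 < \<kappa>" using m s1 unfolding \<kappa>_def by (intro divide_pos_pos) auto
  have "2 * \<kappa> * (\<sigma>l\<^sup>2 + 1) = - m / 2" using s1 by (simp add: \<kappa>_def field_simps)
  then have \<kappa>m: "2 * \<kappa> * \<sigma>l\<^sup>2 < - m" using \<kappa> m by (simp add: algebra_simps)
  define v0 where "v0 = c * vl (1 - t0) s0 q0"
  obtain r0 where r0: "0 < r0" and loc0: "\<And>z. norm (z - ?pt) < r0 \<Longrightarrow>
      c * vl (1 - fst z) (fst (snd z)) (snd (snd z)) \<le> v0 + g \<bullet> (z - ?pt)
        + (z - ?pt) \<bullet> blinfun_apply H (z - ?pt) / 2 + \<kappa> * (norm (z - ?pt))\<^sup>2"
    using touch[OF \<kappa>] unfolding eventually_nhds_metric v0_def dist_norm by blast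
  define r where "r = min r0 1"
  have r: "0 < r" "r \<le> 1" "r \<le> r0" using r0 by (auto simp: r_def)
  \<comment> \<open>At distance at least \<open>r\<close> the quartic term has to beat
    \<open>v0\<close>, the lower terms of \<open>Q\<close> and the quadratic growth of
    \<open>u n\<close>, with 1 to spare; see \<open>far\<close>. The growth bound
    \<open>2 * G * wt s0 * (1 + norm a ^ 2)\<close> is covered by two copies of
    \<open>(norm a / r) ^ 4\<close>, which gives the 4.\<close>
  define \<Lambda> where "\<Lambda> = (1 + \<bar>v0\<bar> + norm g + norm H + 4 * G * wt s0) / r ^ 4"
  have \<Lambda>: "0 \<le> \<Lambda>" using G_ge r by (auto simp: \<Lambda>_def intro!: divide_nonneg_pos add_nonneg_nonneg)
  define Q where "Q a = g \<bullet> a + a \<bullet> blinfun_apply H a / 2 + 2 * \<kappa> * (norm a)\<^sup>2 + \<Lambda> * norm a ^ 4" for a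
  define p where "p a = g + (1 / 2) *\<^sub>R (blinfun_apply H a + adjoint (blinfun_apply H) a) + (4 * \<kappa> + 4 * \<Lambda> * (norm a)\<^sup>2) *\<^sub>R a" for a
  define B where "B a x y = x \<bullet> blinfun_apply H y + (4 * \<kappa> + 4 * \<Lambda> * (norm a)\<^sup>2) * (x \<bullet> y) + 8 * \<Lambda> * (a \<bullet> x) * (a \<bullet> y)" for a x y
  define b where "b = norm g + norm H + 4 * \<kappa> + 12 * \<Lambda>"
  have jet1: "bilinear (B a)" if "norm a \<le> 1" for a
    unfolding B_def[abs_def] by (rule quartic_jet(1)[OF less_imp_le[OF \<kappa>] \<Lambda> that])
  have jet2: "norm (p a) \<le> b" if "norm a \<le> 1" for a
    unfolding p_def b_def by (rule quartic_jet(2)[OF less_imp_le[OF \<kappa>] \<Lambda> that])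
  have jet3: "\<bar>B a x y\<bar> \<le> b * norm x * norm y" if "norm a \<le> 1" for a x y
    unfolding B_def b_def by (rule quartic_jet(3)[OF less_imp_le[OF \<kappa>] \<Lambda> that])
  have jet4: "\<bar>Q (a + d) - Q a - p a \<bullet> d - B a d d / 2\<bar> \<le> b * (norm d ^ 3 + norm d ^ 4)" if "norm a \<le> 1" for a d
    unfolding Q_def p_def B_def b_def by (rule quartic_jet(4)[OF less_imp_le[OF \<kappa>] \<Lambda> that])
  have Qcont: "continuous_on UNIV Q" unfolding Q_def[abs_def] by (intro continuous_intros) auto
  have Qlow: "- (norm g * norm a) - norm H * (norm a)\<^sup>2 + \<Lambda> * norm a ^ 4 \<le> Q a" for a
  proof -
    have "\<bar>g \<bullet> a\<bar> \<le> norm g * norm a" by (rule Cauchy_Schwarz_ineq2)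
    moreover have "\<bar>a \<bullet> blinfun_apply H a\<bar> \<le> norm a * (norm H * norm a)"
      by (rule order_trans[OF Cauchy_Schwarz_ineq2]) (intro mult_left_mono norm_blinfun, simp)
    then have "\<bar>a \<bullet> blinfun_apply H a\<bar> \<le> norm H * (norm a)\<^sup>2" by (simp add: power2_eq_square mult_ac)
    moreover have "0 \<le> 2 * \<kappa> * (norm a)\<^sup>2" "0 \<le> norm H * (norm a)\<^sup>2" using \<kappa> by auto
    ultimately show ?thesis unfolding Q_def by linarith
  qed
  \<comment> \<open>\<open>j\<close> counts rounds to go, so the time coordinate is
    \<open>1 - j / n\<close>.\<close>
  define zz where "zz n j s q = (1 - real j / real n, s, q) - ?pt" for n j :: nat and s q :: "real^'k"
  define val where "val n j s q = c * u n j s q - (v0 + Q (zz n j s q))" for n j s q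
  have zs: "norm (s - s0) \<le> norm (zz n j s q)" for n j s q
    using norm_triple(2)[of "zz n j s q"] by (simp add: zz_def)
  have cu_le: "c * u n j s q \<le> 2 * G * wt s0 * (1 + (norm (zz n j s q))\<^sup>2)" if n: "n0 \<le> n" and j: "j \<le> n" for n j s q
  proof -
    have "c * u n j s q \<le> \<bar>c * u n j s q\<bar>" by simp
    also have "\<dots> = \<bar>u n j s q\<bar>" using c by (simp add: abs_mult)
    also have "\<dots> \<le> G * wt (s0 + (s - s0))" using u_growth[OF n, of j s q] j by simp
    also have "\<dots> \<le> G * (2 * wt s0 * (1 + (norm (zz n j s q))\<^sup>2))"
    proof (intro mult_left_mono order_trans[OF wt_add])
      show "1 + (norm (s - s0))\<^sup>2 \<le> 1 + (norm (zz n j s q))\<^sup>2" using zs by (intro add_left_mono power_mono) auto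
    qed (use G_ge in auto)
    finally show ?thesis by (simp add: mult_ac)
  qed
  have far: "val n j s q \<le> - 1" if n: "n0 \<le> n" and j: "j \<le> n" and a: "r \<le> norm (zz n j s q)" for n j s q
  proof -
    let ?a = "norm (zz n j s q)" and ?y = "norm (zz n j s q) / r"
    have y: "1 \<le> ?y" "?a \<le> ?y" using a r mult_right_mono[OF r(2), of ?a] by (auto simp: field_simps)
    have y4: "1 \<le> ?y ^ 4" "?a \<le> ?y ^ 4" "?a\<^sup>2 \<le> ?y ^ 4"
    proof -
      show 1: "1 \<le> ?y ^ 4" using y(1) by (rule one_le_power)
      show "?a \<le> ?y ^ 4" by (rule order_trans[OF y(2) self_le_power[OF y(1)]]) simp
      have "?a\<^sup>2 \<le> ?y\<^sup>2" using y by (intro power_mono) auto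
      also have "?y\<^sup>2 \<le> ?y ^ 4" using y(1) by (intro power_increasing) auto
      finally show "?a\<^sup>2 \<le> ?y ^ 4" .
    qed
    have "\<Lambda> * ?a ^ 4 = (1 + \<bar>v0\<bar> + norm g + norm H + 4 * G * wt s0) * ?y ^ 4"
      by (simp add: \<Lambda>_def power_divide)
    also have "\<dots> = (1 + \<bar>v0\<bar>) * ?y ^ 4 + norm g * ?y ^ 4 + norm H * ?y ^ 4 + 2 * G * wt s0 * (?y ^ 4 + ?y ^ 4)"
      by (simp add: algebra_simps)
    also have "\<dots> \<ge> (1 + \<bar>v0\<bar>) * 1 + norm g * ?a + norm H * ?a\<^sup>2 + 2 * G * wt s0 * (1 + ?a\<^sup>2)"
      using y4 G_ge by (intro add_mono mult_left_mono) auto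
    finally have 1: "(1 + \<bar>v0\<bar>) * 1 + norm g * ?a + norm H * ?a\<^sup>2 + 2 * G * wt s0 * (1 + ?a\<^sup>2) \<le> \<Lambda> * ?a ^ 4" .
    have "X - (v0 + Y) \<le> - 1" if "(1 + \<bar>v0\<bar>) * 1 + c1 + c2 + D \<le> L" "- c1 - c2 + L \<le> Y" "X \<le> D" for X Y c1 c2 D L
      using that unfolding mult_1_right by linarith
    from this[OF 1 Qlow cu_le[OF n j]] show ?thesis unfolding val_def .
  qed
  have bdd: "val n j s q \<le> 4 * G * wt s0 + \<bar>v0\<bar> + norm g + norm H" if n: "n0 \<le> n" and j: "j \<le> n" for n j s q
  proof (cases "r \<le> norm (zz n j s q)")
    case True
    have "0 \<le> 4 * G * wt s0 + \<bar>v0\<bar> + norm g + norm H" using G_ge by (intro add_nonneg_nonneg) auto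
    then show ?thesis using far[OF n j True] by linarith
  next
    case False
    then have a: "norm (zz n j s q) \<le> 1" "(norm (zz n j s q))\<^sup>2 \<le> 1" using r by (auto simp: power_le_one)
    have "2 * G * wt s0 * (1 + (norm (zz n j s q))\<^sup>2) \<le> 2 * G * wt s0 * 2" using a G_ge by (intro mult_left_mono) auto
    then have 1: "2 * G * wt s0 * (1 + (norm (zz n j s q))\<^sup>2) \<le> 4 * G * wt s0" by simp
    have 2: "norm g * norm (zz n j s q) \<le> norm g" "norm H * (norm (zz n j s q))\<^sup>2 \<le> norm H"
      using a by (simp_all add: mult_left_le)
    have 3: "0 \<le> \<Lambda> * norm (zz n j s q) ^ 4" using \<Lambda> by simp
    have "X - (v0 + Y) \<le> D' + \<bar>v0\<bar> + norm g + norm H"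
      if "D \<le> D'" "c1 \<le> norm g" "c2 \<le> norm H" "0 \<le> L" "- c1 - c2 + L \<le> Y" "X \<le> D" for X Y c1 c2 D D' L
      using that by linarith
    from this[OF 1 2 3 Qlow cu_le[OF n j]] show ?thesis unfolding val_def .
  qed
  \<comment> \<open>Near-maximisers up to \<open>1 / n^2\<close> are good enough, this error being
    negligible against the step size \<open>1 / n\<close>; attainment of the supremum over the
    unbounded state space is not at issue.\<close>
  have "\<exists>x. n0 \<le> n \<longrightarrow> fst x \<le> n \<and> (\<forall>j s q. j \<le> n \<longrightarrow> val n j s q \<le> val n (fst x) (fst (snd x)) (snd (snd x)) + 1 / (real n)\<^sup>2)" for n
  proof (cases "n0 \<le> n")
    case n: True
    let ?X = "{val n j s q | j s q. j \<le> n}"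
    have ba: "bdd_above ?X"
      by (rule bdd_aboveI[of _ "4 * G * wt s0 + \<bar>v0\<bar> + norm g + norm H"]) (use bdd[OF n] in blast)
    have ne: "?X \<noteq> {}" by blast
    have "Sup ?X - 1 / (real n)\<^sup>2 < Sup ?X" using n_pos[OF n] by simp
    from less_cSupE[OF this ne] obtain y where y: "y \<in> ?X" "Sup ?X - 1 / (real n)\<^sup>2 < y" by blast
    from y(1) obtain j s q where yj: "j \<le> n" "y = val n j s q" by blast
    then have j: "j \<le> n" "Sup ?X - 1 / (real n)\<^sup>2 < val n j s q" using y(2) by simp_all
    have "val n j' s' q' \<le> val n j s q + 1 / (real n)\<^sup>2" if "j' \<le> n" for j' s' q'
    proof -
      have "val n j' s' q' \<le> Sup ?X" by (rule cSup_upper[OF _ ba]) (use that in blast)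
      then show ?thesis using j(2) by linarith
    qed
    then show ?thesis using j(1) by (intro exI[of _ "(j, s, q)"]) auto
  qed auto
  then have "\<forall>n. \<exists>x. n0 \<le> n \<longrightarrow> fst x \<le> n \<and> (\<forall>j s q. j \<le> n \<longrightarrow> val n j s q \<le> val n (fst x) (fst (snd x)) (snd (snd x)) + 1 / (real n)\<^sup>2)"
    by (rule allI)
  from choice[OF this] obtain xx where xx0: "\<forall>n. n0 \<le> n \<longrightarrow> fst (xx n) \<le> n \<and> (\<forall>j s q. j \<le> n \<longrightarrow>
    val n j s q \<le> val n (fst (xx n)) (fst (snd (xx n))) (snd (snd (xx n))) + 1 / (real n)\<^sup>2)" ..
  have xx: "\<And>n. n0 \<le> n \<Longrightarrow> fst (xx n) \<le> n"
    "\<And>n j s q. n0 \<le> n \<Longrightarrow> j \<le> n \<Longrightarrow> val n j s q \<le> val n (fst (xx n)) (fst (snd (xx n))) (snd (snd (xx n))) + 1 / (real n)\<^sup>2"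
    using xx0 by simp_all
  define J where "J n = fst (xx n)" for n
  define s where "s n = fst (snd (xx n))" for n
  define q where "q n = snd (snd (xx n))" for n
  define a where "a n = zz n (J n) (s n) (q n)" for n
  have J: "J n \<le> n" and best: "j \<le> n \<Longrightarrow> val n j s' q' \<le> val n (J n) (s n) (q n) + 1 / (real n)\<^sup>2" if "n0 \<le> n" for n j s' q'
    using xx that by (auto simp: J_def s_def q_def)
  have inv2: "(\<lambda>n. 1 / (real n)\<^sup>2) \<longlonglongrightarrow> 0"
    using tendsto_mult[OF lim_1_over_n lim_1_over_n] by (simp add: power2_eq_square)
  \<comment> \<open>The grid time that approximates the touching point. There \<open>val\<close>
    tends to 0, so \<open>\<beta> n\<close>, a lower bound for the near-maximal values, tends to 0
    as well.\<close>
  define j0 where "j0 n = nat \<lfloor>real n * (1 - t0)\<rfloor>" for n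
  have j0: "j0 n \<le> n" "V n (1 - t0, s0, q0) = u n (j0 n) s0 q0" for n
    using V_eq_u(1)[of "1 - t0" n s0 q0] V_eq_u(2)[of "1 - t0" n] t0 by (auto simp: j0_def)
  have j0lim: "(\<lambda>n. real (j0 n) / real n) \<longlonglongrightarrow> 1 - t0"
  proof -
    have "(\<lambda>n. real (j0 n) / real n - (1 - t0)) \<longlonglongrightarrow> 0"
    proof (rule Lim_null_comparison[OF _ lim_1_over_n])
      show "\<forall>\<^sub>F n in sequentially. norm (real (j0 n) / real n - (1 - t0)) \<le> 1 / real n"
        unfolding eventually_sequentially
      proof (intro exI[of _ 1] allI impI)
        fix n :: nat assume n: "1 \<le> n"
        have "\<bar>real (j0 n) - real n * (1 - t0)\<bar> \<le> 1" using t0 by (simp add: j0_def of_nat_nat) linarith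
        then have "\<bar>real (j0 n) - real n * (1 - t0)\<bar> / real n \<le> 1 / real n" by (simp add: divide_right_mono)
        moreover have "\<bar>real (j0 n) - real n * (1 - t0)\<bar> / real n = \<bar>(real (j0 n) - real n * (1 - t0)) / real n\<bar>"
          by (simp add: abs_divide)
        moreover have "(real (j0 n) - real n * (1 - t0)) / real n = real (j0 n) / real n - (1 - t0)"
          using n by (simp add: diff_divide_distrib)
        ultimately show "norm (real (j0 n) / real n - (1 - t0)) \<le> 1 / real n" by simp
      qed
    qed
    then show ?thesis by (simp add: LIM_zero_iff)
  qed
  define \<beta> where "\<beta> n = val n (j0 n) s0 q0 - 1 / (real n)\<^sup>2" for n
  have \<beta>: "\<beta> \<longlonglongrightarrow> 0"
  proof -
    have "(\<lambda>n. zz n (j0 n) s0 q0) \<longlonglongrightarrow> (1 - (1 - t0), s0, q0) - ?pt"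
      unfolding zz_def by (intro tendsto_intros j0lim)
    then have "(\<lambda>n. zz n (j0 n) s0 q0) \<longlonglongrightarrow> 0" by (simp add: zero_prod_def)
    then have "(\<lambda>n. Q (zz n (j0 n) s0 q0)) \<longlonglongrightarrow> Q 0"
      by (rule continuous_on_tendsto_compose[OF Qcont]) auto
    then have 1: "(\<lambda>n. Q (zz n (j0 n) s0 q0)) \<longlonglongrightarrow> 0" by (simp add: Q_def)
    have 2: "(\<lambda>n. u n (j0 n) s0 q0) \<longlonglongrightarrow> vl (1 - t0) s0 q0"
      using V_tendsto[of "1 - t0" s0 q0] t0 j0(2) by simp
    have "\<beta> \<longlonglongrightarrow> c * vl (1 - t0) s0 q0 - (v0 + 0) - 0"
      unfolding \<beta>_def val_def by (intro tendsto_intros 1 2 inv2)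
    then show ?thesis by (simp add: v0_def)
  qed
  have val\<beta>: "\<beta> n \<le> val n (J n) (s n) (q n)" if "n0 \<le> n" for n
    using best[OF that j0(1)[of n], of s0 q0] by (simp add: \<beta>_def)
  have near: "\<forall>\<^sub>F n in sequentially. n0 \<le> n \<and> norm (a n) < r"
  proof -
    have "\<forall>\<^sub>F n in sequentially. - 1 < \<beta> n" using order_tendstoD(1)[OF \<beta>, of "- 1"] by simp
    then show ?thesis using eventually_ge_at_top[of n0]
    proof eventually_elim
      case (elim n)
      have "norm (a n) < r"
      proof (rule ccontr)
        assume "\<not> norm (a n) < r"
        then have "val n (J n) (s n) (q n) \<le> - 1" unfolding a_def using elim J by (intro far) auto
        then show False using val\<beta>[of n] elim by linarith
      qed
      then show ?case using elim by simp
    qed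
  qed
  have a0: "a \<longlonglongrightarrow> 0"
  proof (rule tendstoI)
    fix \<epsilon> :: real assume \<epsilon>: "0 < \<epsilon>"
    \<comment> \<open>Touching consumes one \<open>\<kappa> * norm a ^ 2\<close> of the two
      contained in \<open>Q\<close>; the other forces the near-maximisers to the point. Half of
      \<open>\<kappa> * \<epsilon>^2\<close> is allotted to the distance of \<open>u n\<close> from
      \<open>vl\<close>, half to \<open>\<beta>\<close>. Within distance 1 of \<open>s0\<close> the
      weight is at most \<open>4 * wt s0\<close>.\<close>
    define \<eta> where "\<eta> = \<kappa> * \<epsilon>\<^sup>2 / 2 / (4 * wt s0) ^ 3"
    have w: "0 < (4 * wt s0) ^ 3" by simp
    have \<eta>: "0 < \<eta>" using \<kappa> \<epsilon> w unfolding \<eta>_def by (intro divide_pos_pos mult_pos_pos) auto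
    have \<eta>w: "\<eta> * (4 * wt s0) ^ 3 = \<kappa> * \<epsilon>\<^sup>2 / 2" 
    proof -
      have "wt s0 \<noteq> 0" using wt_pos[of s0] by linarith
      then show ?thesis by (simp add: \<eta>_def)
    qed
    obtain n1 where n1: "n0 \<le> n1" "\<And>n j s q. n1 \<le> n \<Longrightarrow> j \<le> n \<Longrightarrow> \<bar>u n j s q - vl (real j / real n) s q\<bar> \<le> \<eta> * wt s ^ 3"
      using u_near_vl[OF \<eta>] by blast
    have "\<forall>\<^sub>F n in sequentially. - (\<kappa> * \<epsilon>\<^sup>2 / 2) < \<beta> n"
      using order_tendstoD(1)[OF \<beta>, of "- (\<kappa> * \<epsilon>\<^sup>2 / 2)"] \<kappa> \<epsilon> by simp
    then show "\<forall>\<^sub>F n in sequentially. dist (a n) 0 < \<epsilon>" using near eventually_ge_at_top[of n1]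
    proof eventually_elim
      case (elim n)
      have n: "n0 \<le> n" and ar: "norm (a n) < r" using elim by auto
      let ?z = "(1 - real (J n) / real n, s n, q n)"
      have az: "a n = ?z - ?pt" by (simp only: a_def zz_def)
      have 1: "c * u n (J n) (s n) (q n) \<le> c * vl (real (J n) / real n) (s n) (q n) + \<eta> * wt (s n) ^ 3"
      proof -
        have "c * (u n (J n) (s n) (q n) - vl (real (J n) / real n) (s n) (q n)) \<le> \<bar>c * (u n (J n) (s n) (q n) - vl (real (J n) / real n) (s n) (q n))\<bar>" by simp
        also have "\<dots> \<le> \<eta> * wt (s n) ^ 3" unfolding abs_mult c using n1(2)[of n "J n" "s n" "q n"] elim J[OF n] by simp
        finally show ?thesis by (simp add: algebra_simps)
      qed
      have 2: "\<eta> * wt (s n) ^ 3 \<le> \<eta> * (4 * wt s0) ^ 3"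
      proof (intro mult_left_mono power_mono)
        have "norm (s n - s0) \<le> 1" using zs[where n=n and j="J n" and s="s n" and q="q n"] ar r by (simp add: a_def)
        then show "wt (s n) \<le> 4 * wt s0" using wt_add_le[of "s n - s0" s0] by simp
      qed (use \<eta> in auto)
      have 3: "c * vl (real (J n) / real n) (s n) (q n) \<le> v0 + g \<bullet> a n + a n \<bullet> blinfun_apply H (a n) / 2 + \<kappa> * (norm (a n))\<^sup>2"
      proof -
        have "norm (?z - ?pt) < r0" using ar r unfolding az[symmetric] by simp
        from loc0[OF this, folded az] show ?thesis by simp
      qed
      have 4: "0 \<le> \<Lambda> * norm (a n) ^ 4" using \<Lambda> by simp
      have 5: "val n (J n) (s n) (q n) = c * u n (J n) (s n) (q n) - (v0 + (g \<bullet> a n + a n \<bullet> blinfun_apply H (a n) / 2 + 2 * \<kappa> * (norm (a n))\<^sup>2 + \<Lambda> * norm (a n) ^ 4))"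
        by (simp add: val_def a_def[symmetric] Q_def)
      have "K \<le> E - V" if "X \<le> Y + Z" "Z \<le> E" "Y \<le> v0 + g' + h' / 2 + K" "0 \<le> L" "V = X - (v0 + (g' + h' / 2 + 2 * K + L))"
        for X Y Z E g' h' K L V :: real using that by linarith
      from this[OF 1 2[unfolded \<eta>w] 3 4 5[unfolded mult.assoc[of 2 \<kappa>]]]
      have "\<kappa> * (norm (a n))\<^sup>2 \<le> \<kappa> * \<epsilon>\<^sup>2 / 2 - val n (J n) (s n) (q n)" .
      then have "\<kappa> * (norm (a n))\<^sup>2 < \<kappa> * \<epsilon>\<^sup>2" using val\<beta>[OF n] elim by linarith
      then have "(norm (a n))\<^sup>2 < \<epsilon>\<^sup>2" using \<kappa> by simp
      then show ?case using \<epsilon> by (simp add: power2_less_imp_less)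
    qed
  qed
  have slim: "s \<longlonglongrightarrow> s0" "q \<longlonglongrightarrow> q0" and tlim: "(\<lambda>n. 1 - real (J n) / real n) \<longlonglongrightarrow> t0"
  proof -
    have z: "(\<lambda>n. a n + ?pt) \<longlonglongrightarrow> 0 + ?pt" by (intro tendsto_intros a0)
    have e: "a n + ?pt = (1 - real (J n) / real n, s n, q n)" for n unfolding a_def zz_def by (rule diff_add_cancel)
    show "s \<longlonglongrightarrow> s0" using tendsto_fst[OF tendsto_snd[OF z]] unfolding e by simp
    show "q \<longlonglongrightarrow> q0" using tendsto_snd[OF tendsto_snd[OF z]] unfolding e by simp
    show "(\<lambda>n. 1 - real (J n) / real n) \<longlonglongrightarrow> t0" using tendsto_fst[OF z] unfolding e by simp
  qed
  define x :: "'k \<Rightarrow> 'k hjb_point" where "x k = (0, axis k 1, 0)" for k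
  \<comment> \<open>One round shortens the time to go by \<open>1 / n\<close>, so \<open>t\<close>
    and the pull count of the arm increase together.\<close>
  define y :: "'k \<Rightarrow> 'k hjb_point" where "y k = (1, 0, axis k 1)" for k
  have nx: "norm (x k) \<le> 1" "norm (y k) \<le> 2" for k
  proof -
    show "norm (x k) \<le> 1" by (simp add: x_def norm_Pair)
    have "sqrt 2 \<le> sqrt 4" by (simp only: real_sqrt_le_iff)
    then show "norm (y k) \<le> 2" by (simp add: y_def norm_Pair)
  qed
  \<comment> \<open>\<open>n\<close> times the one-step inequality at the near-maximiser, with the
    errors of \<open>consistency\<close> and of near-maximality. Its limit is
    \<open>?L k + 2 * \<kappa> * \<sigma>l^2\<close>, which is negative.\<close>
  define \<Phi> where "\<Phi> n k = c * \<mu> n k (s n) (q n) + (\<mu> n k (s n) (q n) * (p (a n) \<bullet> x k) + p (a n) \<bullet> y k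
     + (\<tau> n k (q n))\<^sup>2 / 2 * B (a n) (x k) (x k)) + cc * b * (wt (s n))\<^sup>2 * (1 / sqrt (real n)) + 1 / real n" for n k
  have "\<forall>\<^sub>F n in sequentially. \<Phi> n k < 0" if k: "k \<in> S" for k
  proof -
    have Hc: "(\<lambda>n. blinfun_apply H (a n)) \<longlonglongrightarrow> blinfun_apply H 0" by (intro tendsto_intros a0)
    have Hc': "(\<lambda>n. adjoint (blinfun_apply H) (a n)) \<longlonglongrightarrow> 0"
    proof (rule Lim_null_comparison[OF always_eventually])
      show "\<forall>n. norm (adjoint (blinfun_apply H) (a n)) \<le> norm H * norm (a n)" by (simp add: norm_adjoint_le)
      have "(\<lambda>n. norm H * norm (a n)) \<longlonglongrightarrow> norm H * norm (0 :: 'k hjb_point)" by (intro tendsto_intros a0)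
      then show "(\<lambda>n. norm H * norm (a n)) \<longlonglongrightarrow> 0" by simp
    qed
    have p0: "(\<lambda>n. p (a n)) \<longlonglongrightarrow> g + (1 / 2) *\<^sub>R (blinfun_apply H 0 + 0) + (4 * \<kappa> + 4 * \<Lambda> * (norm (0 :: 'k hjb_point))\<^sup>2) *\<^sub>R 0"
      unfolding p_def by (intro tendsto_intros a0 Hc Hc')
    then have p0: "(\<lambda>n. p (a n)) \<longlonglongrightarrow> g" by (simp add: blinfun.zero_right)
    have B0: "(\<lambda>n. B (a n) (x k) (x k)) \<longlonglongrightarrow> x k \<bullet> blinfun_apply H (x k) + (4 * \<kappa> + 4 * \<Lambda> * (norm (0 :: 'k hjb_point))\<^sup>2) * (x k \<bullet> x k) + 8 * \<Lambda> * (0 \<bullet> x k) * (0 \<bullet> x k)"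
      unfolding B_def by (intro tendsto_intros a0)
    have xx1: "x k \<bullet> x k = 1" by (simp add: x_def inner_axis_axis)
    have B0: "(\<lambda>n. B (a n) (x k) (x k)) \<longlonglongrightarrow> x k \<bullet> blinfun_apply H (x k) + 4 * \<kappa>"
      using B0 by (simp add: xx1)
    have sq: "(\<lambda>n. 1 / sqrt (real n)) \<longlonglongrightarrow> 0"
      by (intro tendsto_divide_0[OF tendsto_const] filterlim_compose[OF sqrt_at_top filterlim_real_sequentially, THEN filterlim_at_top_imp_at_infinity])
    have wl: "(\<lambda>n. wt (s n)) \<longlonglongrightarrow> wt s0" unfolding wt_def by (intro tendsto_intros slim)
    have "(\<lambda>n. \<Phi> n k) \<longlonglongrightarrow> c * \<mu>l k s0 q0 + (\<mu>l k s0 q0 * (g \<bullet> x k) + g \<bullet> y k + \<sigma>l\<^sup>2 / 2 * (x k \<bullet> blinfun_apply H (x k) + 4 * \<kappa>)) + cc * b * (wt s0)\<^sup>2 * 0 + 0"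
      unfolding \<Phi>_def by (intro tendsto_intros mu_tendsto slim tau_tendsto p0 B0 sq wl lim_1_over_n) auto
    moreover have [symmetric]: "c * \<mu>l k s0 q0 + (\<mu>l k s0 q0 * (g \<bullet> x k) + g \<bullet> y k + \<sigma>l\<^sup>2 / 2 * (x k \<bullet> blinfun_apply H (x k) + 4 * \<kappa>)) + cc * b * (wt s0)\<^sup>2 * 0 + 0 = ?L k + 2 * \<kappa> * \<sigma>l\<^sup>2"
    proof -
      have "g \<bullet> x k = fst (snd g) $ k" "g \<bullet> y k = fst g + snd (snd g) $ k"
        by (simp_all add: x_def y_def inner_prod_def inner_axis)
      then show ?thesis by (simp add: x_def algebra_simps)
    qed
    ultimately have "(\<lambda>n. \<Phi> n k) \<longlonglongrightarrow> ?L k + 2 * \<kappa> * \<sigma>l\<^sup>2" by (rule ssubst[rotated])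
    moreover have "?L k + 2 * \<kappa> * \<sigma>l\<^sup>2 < 0" using m(2)[OF k] \<kappa>m by linarith
    ultimately show ?thesis by (rule order_tendstoD(2))
  qed
  then have "\<forall>\<^sub>F n in sequentially. \<forall>k\<in>S. \<Phi> n k < 0" by (intro eventually_ball_finite) auto
  moreover have "\<forall>\<^sub>F n in sequentially. 1 - real (J n) / real n < 1" using order_tendstoD(2)[OF tlim t0(2)] .
  ultimately have "\<forall>\<^sub>F n in sequentially. False" using near
  proof eventually_elim
    case (elim n)
    then have n: "n0 \<le> n" and a1: "norm (a n) \<le> 1" using r by auto
    note N = n_pos[OF n]
    \<comment> \<open>The time coordinate is below 1 for large \<open>n\<close>, so at least one
      round is left and the recursion applies.\<close>
    have "J n \<noteq> 0"
    proof
      assume "J n = 0"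
      with elim(2) show False by simp
    qed
    then obtain j where j: "J n = Suc j" by (cases "J n") auto
    obtain k where k: "k \<in> S" "c * u n (Suc j) (s n) (q n) \<le> c * \<mu> n k (s n) (q n) / real n + c * step n k (u n j) (s n) (q n)"
      using rec[OF n] by blast
    let ?d = "\<lambda>\<zeta>. incr n k (s n) (q n) \<zeta> *\<^sub>R x k + (1 / real n) *\<^sub>R y k"
    let ?val = "val n (J n) (s n) (q n)"
    have Qm: "Q \<in> borel_measurable borel" using Qcont by (rule borel_measurable_continuous_onI)
    have j0: "\<bar>Q (a n + d) - Q (a n) - p (a n) \<bullet> d - B (a n) d d / 2\<bar> \<le> b * (norm d ^ 3 + norm d ^ 4)" for d
      by (rule jet4[OF a1])
    note cons = consistency[where k = k and s = "s n" and q = "q n",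
        OF n Qm jet1[OF a1] jet2[OF a1] jet3[OF a1] j0 nx(1)[of k] nx(2)[of k]]
    \<comment> \<open>Near-maximality bounds \<open>c * u\<close> at every successor state by
      \<open>v0 + Q\<close> plus a constant, so integrating over the noise transfers the step from
      \<open>u n\<close> to \<open>Q\<close>.\<close>
    have dom: "c * u n j (move n k (s n) (q n) \<zeta>) (q n + (1 / real n) *\<^sub>R axis k 1) \<le> v0 + Q (a n + ?d \<zeta>) + (?val + 1 / (real n)\<^sup>2)" for \<zeta>
    proof -
      have "zz n j (move n k (s n) (q n) \<zeta>) (q n + (1 / real n) *\<^sub>R axis k 1) = a n + ?d \<zeta>"
        using N by (simp add: zz_def a_def j x_def y_def move_def add_divide_distrib)
      then show ?thesis using best[OF n, of j "move n k (s n) (q n) \<zeta>" "q n + (1 / real n) *\<^sub>R axis k 1"] J[OF n] j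
        by (simp add: val_def)
    qed
    interpret prob_space std_normal_distribution by (rule prob_space_std_normal)
    have "c * step n k (u n j) (s n) (q n) = (\<integral>\<zeta>. c * u n j (move n k (s n) (q n) \<zeta>) (q n + (1 / real n) *\<^sub>R axis k 1) \<partial>std_normal_distribution)"
      by (simp add: step_def)
    also have "\<dots> \<le> (\<integral>\<zeta>. v0 + Q (a n + ?d \<zeta>) + (?val + 1 / (real n)\<^sup>2) \<partial>std_normal_distribution)"
      using cons(1) u_integrable[OF n] by (intro integral_mono dom) auto
    also have "\<dots> = v0 + (\<integral>\<zeta>. Q (a n + ?d \<zeta>) \<partial>std_normal_distribution) + (?val + 1 / (real n)\<^sup>2)"
      using cons(1) by simp
    finally have st: "c * step n k (u n j) (s n) (q n) \<le> \<dots>" .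
    have "c * u n (Suc j) (s n) (q n) = v0 + Q (a n) + ?val" using j by (simp add: val_def a_def del: u.simps)
    then have qa: "Q (a n) \<le> c * \<mu> n k (s n) (q n) / real n + (\<integral>\<zeta>. Q (a n + ?d \<zeta>) \<partial>std_normal_distribution) + 1 / (real n)\<^sup>2"
    proof -
      assume 1: "c * u n (Suc j) (s n) (q n) = v0 + Q (a n) + ?val"
      have "Y \<le> M + I + E" if "X = v0 + Y + V" "X \<le> M + Z" "Z \<le> v0 + I + (V + E)" for X Y V M Z I E :: real
        using that by linarith
      from this[OF 1 k(2) st] show ?thesis .
    qed
    have "0 \<le> M + P + E + D" if "Y \<le> M + I + D" "\<bar>I - Y - P\<bar> \<le> E" for Y M I D P E :: real
      using that by linarith
    from this[OF qa cons(2)] have "0 \<le> c * \<mu> n k (s n) (q n) / real n + (\<mu> n k (s n) (q n) * (p (a n) \<bullet> x k) + p (a n) \<bullet> y k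
        + (\<tau> n k (q n))\<^sup>2 / 2 * B (a n) (x k) (x k)) / real n + cc * b * (wt (s n))\<^sup>2 / (real n * sqrt (real n)) + 1 / (real n)\<^sup>2" .
    also have "\<dots> = \<Phi> n k / real n"
      unfolding \<Phi>_def by (simp add: add_divide_distrib power2_eq_square mult.commute)
    finally have "0 \<le> \<Phi> n k" using N by (simp add: zero_le_divide_iff)
    moreover have "\<Phi> n k < 0" using elim k(1) by auto
    ultimately show False by simp
  qed
  then show False by simp
qed

end

lemma open_hjb_domain: "open (hjb_domain :: ('k::finite) hjb_point set)"
proof -
  have "{q :: real^'k. \<forall>k. q $ k \<in> {0<..<1}} = box 0 (\<chi> i. 1)" by (auto simp: mem_box_cart)
  then show ?thesis unfolding hjb_domain_def
    by (simp only:) (intro open_Times open_box open_UNIV open_greaterThanLessThan)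
qed

section \<open>Maximisation over the simplex and the equation on its domain\<close>

lemma sum_axis: "(\<Sum>i\<in>UNIV. c i * (axis k 1 :: real^'k::finite) $ i) = (c k :: real)"
  by (simp add: axis_def if_distrib cong: if_cong)

lemma axis_in_simplex: "(axis k 1 :: real^'k::finite) \<in> prob_simplex"
  using sum_axis[of "\<lambda>_. 1" k] by (auto simp: prob_simplex_def axis_def)

text \<open>The vertex \<open>axis k 1\<close> of the simplex yields \<open>c k\<close>. Boundedness
  is part of the work because the supremum of an unbounded set of reals is unspecified.\<close>

lemma simplex_SUP_ge:
  fixes c :: "'k::finite \<Rightarrow> real"
  shows "c k \<le> (SUP \<pi>\<in>prob_simplex. \<Sum>i\<in>UNIV. c i * \<pi> $ i)"
proof -
  have "bdd_above ((\<lambda>\<pi> :: real^'k. \<Sum>i\<in>UNIV. c i * \<pi> $ i) ` prob_simplex)"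
  proof (intro bdd_aboveI[of _ "\<Sum>i\<in>UNIV. \<bar>c i\<bar>"])
    fix x assume "x \<in> (\<lambda>\<pi> :: real^'k. \<Sum>i\<in>UNIV. c i * \<pi> $ i) ` prob_simplex"
    then obtain \<pi> :: "real^'k" where \<pi>: "\<pi> \<in> prob_simplex" "x = (\<Sum>i\<in>UNIV. c i * \<pi> $ i)" by blast
    have "c i * \<pi> $ i \<le> \<bar>c i\<bar>" for i
    proof -
      have "c i * \<pi> $ i \<le> \<bar>c i\<bar> * \<pi> $ i" using \<pi>(1) by (intro mult_right_mono) (auto simp: prob_simplex_def)
      also have "\<dots> \<le> \<bar>c i\<bar> * 1" using \<pi>(1) by (intro mult_left_mono) (auto simp: prob_simplex_def)
      finally show ?thesis by simp
    qed
    then show "x \<le> (\<Sum>i\<in>UNIV. \<bar>c i\<bar>)" unfolding \<pi>(2) by (rule sum_mono)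
  qed
  from cSUP_upper[OF axis_in_simplex[of k] this] show ?thesis by (simp add: sum_axis)
qed

lemma simplex_SUP_le:
  fixes c :: "'k::finite \<Rightarrow> real"
  assumes "\<And>k. c k \<le> m"
  shows "(SUP \<pi>\<in>prob_simplex. \<Sum>i\<in>UNIV. c i * \<pi> $ i) \<le> m"
proof (rule cSUP_least)
  show "(prob_simplex :: (real^'k) set) \<noteq> {}" using axis_in_simplex by blast
  fix \<pi> :: "real^'k" assume \<pi>: "\<pi> \<in> prob_simplex"
  have "(\<Sum>i\<in>UNIV. c i * \<pi> $ i) \<le> (\<Sum>i\<in>UNIV. m * \<pi> $ i)"
    using \<pi> assms by (intro sum_mono mult_right_mono) (auto simp: prob_simplex_def)
  also have "\<dots> = m" using \<pi> by (simp add: prob_simplex_def flip: sum_distrib_left)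
  finally show "(\<Sum>i\<in>UNIV. c i * \<pi> $ i) \<le> m" .
qed

context bandit_limit
begin

text \<open>The weight stays bounded along a convergent sequence of states, so
  \<open>u_near_vl\<close> applies at moving states; \<open>vl_lip\<close> handles the passage to
  the limit point.\<close>

lemma u_tendsto:
  assumes j: "\<And>n. 1 \<le> n \<Longrightarrow> j n \<le> n" and T: "(\<lambda>n. real (j n) / real n) \<longlonglongrightarrow> T" "0 \<le> T" "T \<le> 1"
    and s: "s \<longlonglongrightarrow> s0" and q: "q \<longlonglongrightarrow> q0"
  shows "(\<lambda>n. u n (j n) (s n) (q n)) \<longlonglongrightarrow> vl T s0 q0"
proof -
  let ?t = "\<lambda>n. real (j n) / real n"
  have 1: "(\<lambda>n. vl (?t n) (s n) (q n) - vl T s0 q0) \<longlonglongrightarrow> 0"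
  proof (rule Lim_null_comparison)
    have "(\<lambda>n. G * \<bar>T - ?t n\<bar> * wt s0 + G * norm (s0 - s n) + G * wt s0 * norm (q0 - q n))
      \<longlonglongrightarrow> G * \<bar>T - T\<bar> * wt s0 + G * norm (s0 - s0) + G * wt s0 * norm (q0 - q0)"
      by (intro tendsto_intros T s q)
    then show "(\<lambda>n. G * \<bar>T - ?t n\<bar> * wt s0 + G * norm (s0 - s n) + G * wt s0 * norm (q0 - q n)) \<longlonglongrightarrow> 0" by simp
    show "\<forall>\<^sub>F n in sequentially. norm (vl (?t n) (s n) (q n) - vl T s0 q0) \<le> G * \<bar>T - ?t n\<bar> * wt s0 + G * norm (s0 - s n) + G * wt s0 * norm (q0 - q n)"
      unfolding eventually_sequentially
    proof (intro exI[of _ 1] allI impI)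
      fix n :: nat assume n: "1 \<le> n"
      have "0 \<le> ?t n" "?t n \<le> 1" using j[OF n] n by (auto simp: field_simps)
      then show "norm (vl (?t n) (s n) (q n) - vl T s0 q0) \<le> G * \<bar>T - ?t n\<bar> * wt s0 + G * norm (s0 - s n) + G * wt s0 * norm (q0 - q n)"
        using vl_lip[of T "?t n" s0 q0 "s n" "q n"] T by (simp add: abs_minus_commute)
    qed
  qed
  have 2: "(\<lambda>n. u n (j n) (s n) (q n) - vl (?t n) (s n) (q n)) \<longlonglongrightarrow> 0"
  proof (rule tendstoI)
    fix \<epsilon> :: real assume \<epsilon>: "0 < \<epsilon>"
    define \<eta> where "\<eta> = \<epsilon> / 2 / (wt s0 ^ 3 + 1)"
    have w1: "0 < wt s0 ^ 3 + 1" by (simp add: add_pos_pos)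
    have \<eta>: "0 < \<eta>" using \<epsilon> w1 unfolding \<eta>_def by (intro divide_pos_pos) auto
    obtain n1 where n1: "\<And>n j s q. n1 \<le> n \<Longrightarrow> j \<le> n \<Longrightarrow> \<bar>u n j s q - vl (real j / real n) s q\<bar> \<le> \<eta> * wt s ^ 3"
      using u_near_vl[OF \<eta>] by blast
    have "(\<lambda>n. wt (s n) ^ 3) \<longlonglongrightarrow> wt s0 ^ 3" unfolding wt_def by (intro tendsto_intros s)
    then have "\<forall>\<^sub>F n in sequentially. wt (s n) ^ 3 < wt s0 ^ 3 + 1" by (rule order_tendstoD(2)) simp
    then show "\<forall>\<^sub>F n in sequentially. dist (u n (j n) (s n) (q n) - vl (?t n) (s n) (q n)) 0 < \<epsilon>"
      using eventually_ge_at_top[of "max 1 n1"]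
    proof eventually_elim
      case (elim n)
      have "\<bar>u n (j n) (s n) (q n) - vl (?t n) (s n) (q n)\<bar> \<le> \<eta> * wt (s n) ^ 3" using elim j[of n] by (intro n1) auto
      also have "\<dots> \<le> \<eta> * (wt s0 ^ 3 + 1)" using elim \<eta> by (intro mult_left_mono) auto
      also have "\<dots> = \<epsilon> / 2"
      proof -
        have "x / w * w = x" if "0 < w" for x w :: real using that by simp
        from this[OF w1] show ?thesis unfolding \<eta>_def .
      qed
      finally show ?case using \<epsilon> by simp
    qed
  qed
  from tendsto_add[OF tendsto_add[OF 2 1] tendsto_const[of "vl T s0 q0"]] show ?thesis by simp
qed

lemma vl_0: "vl 0 s q = 0"
proof -
  have "(\<lambda>n. V n (0, s, q)) \<longlonglongrightarrow> vl 0 s q" by (rule V_tendsto) auto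
  then show ?thesis by (simp add: V_def LIMSEQ_const_iff)
qed

text \<open>A linear form on the simplex is maximal at a vertex, so one good arm bounds the supremum
  from below and all arms together bound it from above. The hypothesis asks for agreement at
  positive pull counts because the scheme works with the positive part of \<open>q\<close>, and
  \<open>q\<close> is positive on the domain.\<close>

lemma vl_viscosity:
  fixes a :: "'k \<Rightarrow> real^'d"
  assumes mu: "\<And>k s q. (\<And>i. 0 < q $ i) \<Longrightarrow> mu_hat a \<alpha>h \<Sigma>h s q (a k) = \<mu>l k s q"
  shows "viscosity_solution hjb_domain (hjb_operator a \<alpha>h \<Sigma>h \<sigma>l) (\<lambda>z. vl (1 - fst z) (fst (snd z)) (snd (snd z)))"
proof -
  let ?v = "\<lambda>z :: 'k hjb_point. vl (1 - fst z) (fst (snd z)) (snd (snd z))"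
  define c where "c s q g X k = snd (snd g) $ k + \<mu>l k s q * fst (snd g) $ k
             + 1 / 2 * \<sigma>l\<^sup>2 * ((0, axis k 1, 0) \<bullet> blinfun_apply X (0, axis k 1, 0)) + \<mu>l k s q"
    for s q :: "real^'k" and g :: "'k hjb_point" and X :: "'k hjb_point \<Rightarrow>\<^sub>L 'k hjb_point" and k
  have op: "hjb_operator a \<alpha>h \<Sigma>h \<sigma>l (t, s, q) g X = - (fst g + (SUP \<pi>\<in>prob_simplex. \<Sum>k\<in>UNIV. c s q g X k * \<pi> $ k))"
    if "(t, s, q) \<in> hjb_domain" for t s q g X
  proof -
    have "mu_hat a \<alpha>h \<Sigma>h s q (a k) = \<mu>l k s q" for k using that by (intro mu) (auto simp: hjb_domain_def)
    then show ?thesis by (simp add: hjb_operator_def c_def case_prod_unfold)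
  qed
  have cont: "continuous_on hjb_domain ?v"
    unfolding continuous_on_def
  proof
    fix z :: "'k hjb_point" assume z: "z \<in> hjb_domain"
    let ?h = "\<lambda>y. G * \<bar>(1 - fst z) - (1 - fst y)\<bar> * wt (fst (snd z)) + G * norm (fst (snd z) - fst (snd y)) + G * wt (fst (snd z)) * norm (snd (snd z) - snd (snd y))"
    have "(?h \<longlongrightarrow> ?h z) (at z within hjb_domain)" by (intro tendsto_intros)
    then have h: "(?h \<longlongrightarrow> 0) (at z within hjb_domain)" by simp
    have "((\<lambda>y. ?v y - ?v z) \<longlongrightarrow> 0) (at z within hjb_domain)"
    proof (rule Lim_null_comparison[OF _ h])
      have "norm (?v y - ?v z) \<le> ?h y" if "y \<in> hjb_domain" for y
        using vl_lip[of "1 - fst z" "1 - fst y" "fst (snd z)" "snd (snd z)" "fst (snd y)" "snd (snd y)"] z that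
        by (auto simp: hjb_domain_def abs_minus_commute)
      then show "\<forall>\<^sub>F y in at z within hjb_domain. norm (?v y - ?v z) \<le> ?h y"
        by (auto simp: eventually_at intro: exI[of _ 1])
    qed
    then show "(?v \<longlongrightarrow> ?v z) (at z within hjb_domain)" by (simp add: LIM_zero_iff)
  qed
  have sub: "viscosity_subsolution hjb_domain (hjb_operator a \<alpha>h \<Sigma>h \<sigma>l) ?v"
    unfolding viscosity_subsolution_def
  proof (intro allI impI)
    fix \<phi> g H and z :: "'k hjb_point"
    assume C2: "C2_on hjb_domain \<phi> g H" and z: "z \<in> hjb_domain" and lm: "local_max_at (\<lambda>y. ?v y - \<phi> y) z"
    obtain t0 s0 q0 where zz: "z = (t0, s0, q0)" by (metis surj_pair)
    have t0: "0 < t0" "t0 < 1" using z by (auto simp: zz hjb_domain_def)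
    have "\<exists>k\<in>UNIV. 0 \<le> fst (g z) + snd (snd (g z)) $ k + \<mu>l k s0 q0 * fst (snd (g z)) $ k
      + 1 / 2 * \<sigma>l\<^sup>2 * ((0, axis k 1, 0) \<bullet> blinfun_apply (H z) (0, axis k 1, 0)) + 1 * \<mu>l k s0 q0"
    proof (rule touching_inequality[OF _ t0])
      fix n j s q
      have "u n (Suc j) s q \<in> range (\<lambda>k. \<mu> n k s q / real n + step n k (u n j) s q)"
        unfolding u.simps by (rule Max_in) auto
      then obtain k where "u n (Suc j) s q = \<mu> n k s q / real n + step n k (u n j) s q" by blast
      then show "\<exists>k\<in>UNIV. 1 * u n (Suc j) s q \<le> 1 * \<mu> n k s q / real n + 1 * step n k (u n j) s q"
        by (intro bexI[of _ k]) (simp_all del: u.simps)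
    next
      fix \<kappa> :: real assume \<kappa>: "0 < \<kappa>"
      show "\<forall>\<^sub>F y in nhds (t0, s0, q0). 1 * ?v y \<le> 1 * vl (1 - t0) s0 q0 + g z \<bullet> (y - (t0, s0, q0))
        + (y - (t0, s0, q0)) \<bullet> blinfun_apply (H z) (y - (t0, s0, q0)) / 2 + \<kappa> * (norm (y - (t0, s0, q0)))\<^sup>2"
        using C2_on_taylor[OF C2 open_hjb_domain z \<kappa>] lm[unfolded local_max_at_def] unfolding zz[symmetric]
      proof eventually_elim
        case (elim y)
        have "?v z = vl (1 - t0) s0 q0" by (simp add: zz)
        then show ?case using elim by linarith
      qed
    qed simp
    then obtain k where "0 \<le> fst (g z) + c s0 q0 (g z) (H z) k" unfolding c_def by (auto simp: add.assoc)
    then show "hjb_operator a \<alpha>h \<Sigma>h \<sigma>l z (g z) (H z) \<le> 0"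
      using simplex_SUP_ge[of "c s0 q0 (g z) (H z)" k] op[of t0 s0 q0 "g z" "H z"] z unfolding zz by linarith
  qed
  have sup: "viscosity_supersolution hjb_domain (hjb_operator a \<alpha>h \<Sigma>h \<sigma>l) ?v"
    unfolding viscosity_supersolution_def
  proof (intro allI impI)
    fix \<phi> g H and z :: "'k hjb_point"
    assume C2: "C2_on hjb_domain \<phi> g H" and z: "z \<in> hjb_domain" and lm: "local_min_at (\<lambda>y. ?v y - \<phi> y) z"
    obtain t0 s0 q0 where zz: "z = (t0, s0, q0)" by (metis surj_pair)
    have t0: "0 < t0" "t0 < 1" using z by (auto simp: zz hjb_domain_def)
    have "c s0 q0 (g z) (H z) k \<le> - fst (g z)" for k
    proof -
      have "\<exists>i\<in>{k}. 0 \<le> fst (- g z) + snd (snd (- g z)) $ i + \<mu>l i s0 q0 * fst (snd (- g z)) $ i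
        + 1 / 2 * \<sigma>l\<^sup>2 * ((0, axis i 1, 0) \<bullet> blinfun_apply (- H z) (0, axis i 1, 0)) + (- 1) * \<mu>l i s0 q0"
      proof (rule touching_inequality[OF _ t0])
        fix n j s q
        have "\<mu> n k s q / real n + step n k (u n j) s q \<le> u n (Suc j) s q" by (simp add: Max_ge)
        then show "\<exists>i\<in>{k}. - 1 * u n (Suc j) s q \<le> - 1 * \<mu> n i s q / real n + - 1 * step n i (u n j) s q"
          by (simp del: u.simps)
      next
        fix \<kappa> :: real assume \<kappa>: "0 < \<kappa>"
        show "\<forall>\<^sub>F y in nhds (t0, s0, q0). - 1 * ?v y \<le> - 1 * vl (1 - t0) s0 q0 + (- g z) \<bullet> (y - (t0, s0, q0))
          + (y - (t0, s0, q0)) \<bullet> blinfun_apply (- H z) (y - (t0, s0, q0)) / 2 + \<kappa> * (norm (y - (t0, s0, q0)))\<^sup>2"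
          using C2_on_taylor[OF C2 open_hjb_domain z \<kappa>] lm[unfolded local_min_at_def] unfolding zz[symmetric]
        proof eventually_elim
          case (elim y)
          have "?v z = vl (1 - t0) s0 q0" by (simp add: zz)
          moreover have "(- g z) \<bullet> (y - z) = - (g z \<bullet> (y - z))"
            "(y - z) \<bullet> blinfun_apply (- H z) (y - z) = - ((y - z) \<bullet> blinfun_apply (H z) (y - z))"
            by (simp_all add: blinfun.minus_left)
          ultimately show ?case using elim by linarith
        qed
      qed simp
      then show ?thesis by (simp add: c_def blinfun.minus_left)
    qed
    from simplex_SUP_le[of "c s0 q0 (g z) (H z)", OF this]
    show "0 \<le> hjb_operator a \<alpha>h \<Sigma>h \<sigma>l z (g z) (H z)"
      using op[of t0 s0 q0 "g z" "H z"] z unfolding zz by linarith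
  qed
  show ?thesis unfolding viscosity_solution_def using cont sub sup by blast
qed

end

subsection \<open>The coefficients of the rescaled bandit\<close>

lemma norm_matrix_vector_le:
  fixes A :: "real^'n^'m" shows "norm (A *v x) \<le> norm A * norm x"
proof -
  have "norm (A *v x) = L2_set (\<lambda>i. \<bar>A $ i \<bullet> x\<bar>) UNIV"
    by (simp add: norm_vec_def matrix_vector_mult_def inner_vec_def)
  also have "\<dots> \<le> L2_set (\<lambda>i. norm (A $ i) * norm x) UNIV"
    by (intro L2_set_mono Cauchy_Schwarz_ineq2) auto
  also have "\<dots> = norm A * norm x" by (simp add: norm_vec_def[of A] L2_set_left_distrib)
  finally show ?thesis .
qed

lemma outer_mult_vector: "outer b *v x = (b \<bullet> x) *\<^sub>R b"
  by (simp add: outer_def matrix_vector_mult_def inner_vec_def vec_eq_iff sum_distrib_left sum_distrib_right mult_ac)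

lemma transpose_outer: "transpose (outer b) = outer b"
  by (simp add: outer_def transpose_def vec_eq_iff mult.commute)

lemma sum_matrix_vector_mult: "(\<Sum>i\<in>I. A i) *v x = (\<Sum>i\<in>I. A i *v (x :: real^'n))" for A :: "'i \<Rightarrow> real^'n^'m"
  by (induction I rule: infinite_finite_induct) (auto simp: matrix_vector_mult_add_rdistrib)

lemma scaleR_matrix_vector_mult: "(c *\<^sub>R A) *v x = c *\<^sub>R (A *v (x :: real^'n))" for A :: "real^'n^'m"
  by (simp add: scaleR_matrix_vector_assoc)

lemma matrix_inv_eqI:
  fixes A B :: "real^'n^'n" assumes "A ** B = mat 1" shows "matrix_inv A = B"
proof -
  have "invertible A" using assms invertible_right_inverse by blast
  then show ?thesis by (metis assms matrix_inv_left matrix_mul_assoc matrix_mul_lid matrix_mul_rid)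
qed

lemma matrix_inv_scaleR:
  fixes A :: "real^'n^'n" assumes "invertible A" "c \<noteq> 0"
  shows "matrix_inv (c *\<^sub>R A) = (1 / c) *\<^sub>R matrix_inv A"
  using assms matrix_inv_right[OF assms(1)]
  by (intro matrix_inv_eqI) (simp add: matrix_scalar_ac scalar_matrix_assoc[symmetric])

section \<open>Coercive matrices\<close>

text \<open>Positive definiteness with an explicit constant. Adding positive semidefinite terms
  preserves \<open>l\<close>, so that a single \<open>l\<close> serves all pull counts and all large
  horizons.\<close>

definition coercive :: "real \<Rightarrow> real^'n^'n \<Rightarrow> bool" where
  "coercive l A \<longleftrightarrow> (\<forall>x. l * (norm x)\<^sup>2 \<le> x \<bullet> (A *v x))"

lemma coercive_invertible:
  assumes "coercive l A" "0 < l" shows "invertible A"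
proof (rule pos_def_invertible)
  fix x :: "real^'a" assume "x \<noteq> 0"
  then have "0 < l * (norm x)\<^sup>2" using assms by simp
  also have "\<dots> \<le> x \<bullet> (A *v x)" using assms by (simp add: coercive_def)
  finally show "0 < x \<bullet> (A *v x)" .
qed

lemma coercive_inv_vec:
  assumes "coercive l A" "0 < l" shows "A *v (matrix_inv A *v y) = y" "matrix_inv A *v (A *v y) = y"
  by (simp_all add: matrix_vector_mul_assoc matrix_inv_right matrix_inv_left coercive_invertible[OF assms])

lemma coercive_norm_inv:
  assumes A: "coercive l A" "0 < l" shows "norm (matrix_inv A *v y) \<le> norm y / l"
proof -
  let ?x = "matrix_inv A *v y"
  have "l * (norm ?x)\<^sup>2 \<le> ?x \<bullet> (A *v ?x)" using A by (simp add: coercive_def)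
  also have "\<dots> \<le> norm ?x * norm y" unfolding coercive_inv_vec[OF A] by (rule norm_cauchy_schwarz)
  finally have "(l * norm ?x) * norm ?x \<le> norm y * norm ?x" by (simp add: power2_eq_square mult_ac)
  then have "l * norm ?x \<le> norm y" by (cases "norm ?x = 0") (auto simp: mult_le_cancel_right)
  then show ?thesis using A(2) by (simp add: field_simps)
qed

lemma coercive_inv_nonneg:
  assumes A: "coercive l A" "0 < l" shows "0 \<le> y \<bullet> (matrix_inv A *v y)"
proof -
  let ?x = "matrix_inv A *v y"
  have "0 \<le> l * (norm ?x)\<^sup>2" using A by simp
  also have "\<dots> \<le> ?x \<bullet> (A *v ?x)" using A by (simp add: coercive_def)
  finally show ?thesis unfolding coercive_inv_vec[OF A] by (simp add: inner_commute)
qed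

text \<open>Resolvent identity: the difference of the inverses is
  \<open>matrix_inv A ** (B - A) ** matrix_inv B\<close>.\<close>

lemma coercive_inv_diff:
  assumes A: "coercive l A" "0 < l" and B: "coercive l B"
    and d: "\<And>x. norm ((B - A) *v x) \<le> D * norm x" and D: "0 \<le> D"
  shows "norm (matrix_inv A *v y - matrix_inv B *v y) \<le> D * norm y / l\<^sup>2"
proof -
  let ?x = "matrix_inv B *v y"
  have "matrix_inv A *v ((B - A) *v ?x) = matrix_inv A *v y - ?x"
    by (simp add: matrix_vector_mult_diff_rdistrib matrix_vector_mult_diff_distrib coercive_inv_vec[OF A] coercive_inv_vec[OF B A(2)])
  then have "norm (matrix_inv A *v y - ?x) \<le> norm ((B - A) *v ?x) / l"
    by (metis coercive_norm_inv[OF A])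
  also have "\<dots> \<le> D * (norm y / l) / l"
    using order_trans[OF d[of ?x] mult_left_mono[OF coercive_norm_inv[OF B A(2), of y] D]] A(2)
    by (intro divide_right_mono) auto
  finally show ?thesis by (simp add: power2_eq_square)
qed

text \<open>A limit of positive definite matrices is symmetric and positive semidefinite.
  Invertibility makes it definite, and compactness of the sphere makes this quantitative. Half of
  the resulting constant is given up so that the bound extends to nearby matrices.\<close>

lemma coercive_limit:
  fixes M :: "nat \<Rightarrow> real^'d^'d"
  assumes lim: "M \<longlonglongrightarrow> M0" and inv: "invertible M0" and M: "\<And>n. 1 \<le> n \<Longrightarrow> sym_pos_def (M n)"
  shows "\<exists>l>0. coercive l M0 \<and> (\<forall>\<^sub>F n in sequentially. coercive l (M n))"
proof -
  have Mv: "(\<lambda>n. M n *v x) \<longlonglongrightarrow> M0 *v x" for x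
  proof (rule Lim_null_comparison[THEN LIM_zero_cancel])
    show "\<forall>\<^sub>F n in sequentially. norm (M n *v x - M0 *v x) \<le> norm (M n - M0) * norm x"
      by (simp add: norm_matrix_vector_le flip: matrix_vector_mult_diff_rdistrib)
    have "(\<lambda>n. norm (M n - M0) * norm x) \<longlonglongrightarrow> norm (M0 - M0) * norm x" by (intro tendsto_intros lim)
    then show "(\<lambda>n. norm (M n - M0) * norm x) \<longlonglongrightarrow> 0" by simp
  qed
  have nn: "0 \<le> x \<bullet> (M0 *v x)" for x
  proof (rule tendsto_lowerbound[OF tendsto_inner[OF tendsto_const Mv]])
    have "0 \<le> x \<bullet> (M n *v x)" if "1 \<le> n" for n using M[OF that] by (cases "x = 0") (auto simp: sym_pos_def_def less_imp_le)
    then show "\<forall>\<^sub>F n in sequentially. 0 \<le> x \<bullet> (M n *v x)" by (auto simp: eventually_sequentially intro: exI[of _ 1])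
  qed simp
  have sym: "x \<bullet> (M0 *v y) = y \<bullet> (M0 *v x)" for x y
  proof (rule LIMSEQ_unique[OF tendsto_inner[OF tendsto_const Mv]])
    have "\<forall>\<^sub>F n in sequentially. x \<bullet> (M n *v y) = y \<bullet> (M n *v x)"
      unfolding eventually_sequentially
      by (intro exI[of _ 1] allI impI) (metis M inner_commute sym_pos_def_def symmetric_inner_matrix)
    then show "(\<lambda>n. x \<bullet> (M n *v y)) \<longlonglongrightarrow> y \<bullet> (M0 *v x)"
      by (rule Lim_transform_eventually[rotated, OF eventually_mono]) (auto intro!: tendsto_inner Mv)
  qed
  have pos: "0 < x \<bullet> (M0 *v x)" if "x \<noteq> 0" for x
  proof (rule ccontr)
    assume "\<not> 0 < x \<bullet> (M0 *v x)"
    then have x0: "x \<bullet> (M0 *v x) = 0" using nn[of x] by linarith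
    let ?y = "M0 *v x"
    have "?y = 0"
    proof (rule ccontr)
      assume "?y \<noteq> 0"
      then have yy: "0 < ?y \<bullet> ?y" by simp
      define K where "K = ?y \<bullet> (M0 *v ?y)"
      have K: "0 \<le> K" unfolding K_def by (rule nn)
      \<comment> \<open>A small step from \<open>x\<close> against \<open>?y\<close> would make the
        form negative: the term \<open>2 * t * (?y \<bullet> ?y)\<close> dominates
        \<open>t^2 * K\<close> for this \<open>t\<close>.\<close>
      define t where "t = - (?y \<bullet> ?y) / (K + 1)"
      have tneg: "t < 0" using yy K unfolding t_def by (simp add: divide_neg_pos)
      have "(x + t *\<^sub>R ?y) \<bullet> (M0 *v (x + t *\<^sub>R ?y)) = 2 * t * (?y \<bullet> ?y) + t\<^sup>2 * K"
        using x0 sym[of x ?y] by (simp add: K_def matrix_vector_right_distrib matrix_vector_mult_scaleR inner_add_left inner_add_right power2_eq_square algebra_simps)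
      also have "\<dots> = t * (2 * (?y \<bullet> ?y) + t * K)" by (simp add: power2_eq_square algebra_simps)
      also have "\<dots> < 0"
      proof (rule mult_neg_pos[OF tneg])
        have "t * (K + 1) = - (?y \<bullet> ?y)" using K by (simp add: t_def)
        then have "t * K = - (?y \<bullet> ?y) - t" by (simp add: algebra_simps)
        then show "0 < 2 * (?y \<bullet> ?y) + t * K" using yy tneg by linarith
      qed
      finally show False using nn[of "x + t *\<^sub>R ?y"] by linarith
    qed
    then have "matrix_inv M0 *v (M0 *v x) = 0" by simp
    then show False using that by (simp add: matrix_vector_mul_assoc matrix_inv_left[OF inv])
  qed
  have cont: "continuous_on (sphere 0 1) (\<lambda>x. x \<bullet> (M0 *v x))"
    by (intro continuous_intros matrix_vector_mult_linear_continuous_on)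
  obtain e0 :: "real^'d" where "norm e0 = 1" using norm_axis_1 by blast
  then have "sphere (0::real^'d) 1 \<noteq> {}" by auto
  from continuous_attains_inf[OF compact_sphere this cont]
  obtain x1 where x1: "norm x1 = 1" "\<And>x. norm x = 1 \<Longrightarrow> x1 \<bullet> (M0 *v x1) \<le> x \<bullet> (M0 *v x)" by auto
  define l where "l = x1 \<bullet> (M0 *v x1) / 2"
  have "x1 \<noteq> 0" using x1(1) by auto
  then have l: "0 < l" using pos[of x1] by (simp add: l_def)
  have M02: "2 * l * (norm x)\<^sup>2 \<le> x \<bullet> (M0 *v x)" for x
  proof (cases "x = 0")
    case False
    let ?u = "(1 / norm x) *\<^sub>R x"
    have "2 * l \<le> ?u \<bullet> (M0 *v ?u)" using x1(2)[of ?u] False by (simp add: l_def)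
    also have "\<dots> = (x \<bullet> (M0 *v x)) / (norm x)\<^sup>2" by (simp add: matrix_vector_mult_scaleR power2_eq_square)
    finally show ?thesis using False by (simp add: field_simps)
  qed simp
  have "\<forall>\<^sub>F n in sequentially. dist (M n) M0 < l" using tendstoD[OF lim l] .
  then have "\<forall>\<^sub>F n in sequentially. coercive l (M n)"
  proof eventually_elim
    case (elim n)
    show ?case unfolding coercive_def
    proof
      fix x
      have "\<bar>x \<bullet> ((M n - M0) *v x)\<bar> \<le> norm x * (norm (M n - M0) * norm x)"
        by (rule order_trans[OF Cauchy_Schwarz_ineq2]) (intro mult_left_mono norm_matrix_vector_le, simp)
      also have "\<dots> \<le> norm x * (l * norm x)" using elim by (intro mult_left_mono mult_right_mono) (auto simp: dist_norm)
      finally have "\<bar>x \<bullet> (M n *v x) - x \<bullet> (M0 *v x)\<bar> \<le> l * (norm x)\<^sup>2"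
        by (simp add: matrix_vector_mult_diff_rdistrib inner_diff_right power2_eq_square mult_ac)
      moreover have "2 * l * (norm x)\<^sup>2 = l * (norm x)\<^sup>2 + l * (norm x)\<^sup>2" by simp
      ultimately show "l * (norm x)\<^sup>2 \<le> x \<bullet> (M n *v x)" using M02[of x] by linarith
    qed
  qed
  moreover have "coercive l M0" unfolding coercive_def
  proof
    fix x :: "real^'d"
    have "0 \<le> l * (norm x)\<^sup>2" using l by simp
    then show "l * (norm x)\<^sup>2 \<le> x \<bullet> (M0 *v x)" using M02[of x] by linarith
  qed
  ultimately show ?thesis using l by blast
qed

text \<open>The recursion is extended to all real pull counts by replacing \<open>q\<close> with its positive part,
  so that the coefficients are globally Lipschitz.\<close>

definition prec :: "('k::finite \<Rightarrow> real^'d) \<Rightarrow> real^'d^'d \<Rightarrow> real^'k \<Rightarrow> real^'d^'d" where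
  "prec a M q = M + (\<Sum>k\<in>UNIV. max 0 (q $ k) *\<^sub>R outer (a k))"

text \<open>\<open>n\<close> times the posterior mean of a reward, in units of the scaling factor;
  see \<open>posterior_rescaled\<close>.\<close>

definition drift :: "('k::finite \<Rightarrow> real^'d) \<Rightarrow> real^'d^'d \<Rightarrow> real^'d \<Rightarrow> 'k \<Rightarrow> real^'k \<Rightarrow> real^'k \<Rightarrow> real" where
  "drift a M \<alpha> k s q = a k \<bullet> (matrix_inv (prec a M q) *v (\<alpha> + (\<Sum>i\<in>UNIV. s $ i *\<^sub>R a i)))"

text \<open>\<open>sqrt n\<close> times the standard deviation of the predictive reward when
  \<open>\<sigma>\<close> is the rescaled noise level: the posterior variance adds a relative amount
  of order \<open>1 / n\<close> to the noise variance.\<close>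

definition spread :: "('k::finite \<Rightarrow> real^'d) \<Rightarrow> real^'d^'d \<Rightarrow> real \<Rightarrow> nat \<Rightarrow> 'k \<Rightarrow> real^'k \<Rightarrow> real" where
  "spread a M \<sigma> n k q = \<sigma> * sqrt (1 + a k \<bullet> (matrix_inv (prec a M q) *v a k) / real n)"

lemma prec_mult_vector: "prec a M q *v x = M *v x + (\<Sum>k\<in>UNIV. (max 0 (q $ k) * (a k \<bullet> x)) *\<^sub>R a k)"
  by (simp add: prec_def matrix_vector_mult_add_rdistrib sum_matrix_vector_mult scaleR_matrix_vector_mult outer_mult_vector)

lemma coercive_prec:
  assumes "coercive l M" shows "coercive l (prec a M q)"
  unfolding coercive_def
proof
  fix x
  have "x \<bullet> (\<Sum>k\<in>UNIV. (max 0 (q $ k) * (a k \<bullet> x)) *\<^sub>R a k) = (\<Sum>k\<in>UNIV. max 0 (q $ k) * (a k \<bullet> x)\<^sup>2)"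
    by (simp add: inner_sum_right inner_commute[of x] power2_eq_square mult.assoc)
  also have "\<dots> \<ge> 0" by (intro sum_nonneg) auto
  finally show "l * (norm x)\<^sup>2 \<le> x \<bullet> (prec a M q *v x)"
    using assms by (simp add: prec_mult_vector inner_add_right coercive_def add_increasing2)
qed

definition arm_bound :: "('k::finite \<Rightarrow> real^'d) \<Rightarrow> real" where
  "arm_bound a = 1 + (\<Sum>k\<in>UNIV. norm (a k)) + (\<Sum>k\<in>UNIV. (norm (a k))\<^sup>2)"

lemma arm_bound:
  shows "1 \<le> arm_bound a" "norm (a k) \<le> arm_bound a" "(\<Sum>k\<in>UNIV. norm (a k)) \<le> arm_bound a"
    "(\<Sum>k\<in>UNIV. (norm (a k))\<^sup>2) \<le> arm_bound a"
proof -
  have 0: "0 \<le> (\<Sum>k\<in>UNIV. norm (a k))" "0 \<le> (\<Sum>k\<in>UNIV. (norm (a k))\<^sup>2)" by (auto intro: sum_nonneg)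
  have "norm (a k) \<le> (\<Sum>k\<in>UNIV. norm (a k))" by (rule member_le_sum) auto
  then show "1 \<le> arm_bound a" "norm (a k) \<le> arm_bound a" "(\<Sum>k\<in>UNIV. norm (a k)) \<le> arm_bound a"
    "(\<Sum>k\<in>UNIV. (norm (a k))\<^sup>2) \<le> arm_bound a" using 0 by (simp_all add: arm_bound_def)
qed

lemma norm_sum_arms: "norm (\<Sum>i\<in>UNIV. s $ i *\<^sub>R a i) \<le> arm_bound a * norm s"
proof -
  have "norm (\<Sum>i\<in>UNIV. s $ i *\<^sub>R a i) \<le> (\<Sum>i\<in>UNIV. norm s * norm (a i))"
    by (intro sum_norm_le) (simp add: component_le_norm_cart mult_right_mono)
  also have "\<dots> \<le> arm_bound a * norm s"
    using mult_left_mono[OF arm_bound(3)[of a], of "norm s"] by (simp add: sum_distrib_left mult.commute)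
  finally show ?thesis .
qed

lemma prec_diff_q: "norm ((prec a M q' - prec a M q) *v x) \<le> arm_bound a * norm (q - q') * norm x"
proof -
  have "(prec a M q' - prec a M q) *v x = (\<Sum>k\<in>UNIV. ((max 0 (q' $ k) - max 0 (q $ k)) * (a k \<bullet> x)) *\<^sub>R a k)"
    by (simp add: matrix_vector_mult_diff_rdistrib prec_mult_vector sum_subtractf[symmetric] left_diff_distrib scaleR_left_diff_distrib)
  also have "norm \<dots> \<le> (\<Sum>k\<in>UNIV. norm (q - q') * norm x * (norm (a k))\<^sup>2)"
  proof (intro sum_norm_le)
    fix k
    have "\<bar>max 0 (q' $ k) - max 0 (q $ k)\<bar> \<le> \<bar>(q - q') $ k\<bar>" by (auto simp: max_def)
    then have 1: "\<bar>max 0 (q' $ k) - max 0 (q $ k)\<bar> \<le> norm (q - q')" using component_le_norm_cart order_trans by blast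
    have "\<bar>max 0 (q' $ k) - max 0 (q $ k)\<bar> * \<bar>a k \<bullet> x\<bar> * norm (a k) \<le> norm (q - q') * (norm (a k) * norm x) * norm (a k)"
      using 1 Cauchy_Schwarz_ineq2[of "a k" x] by (intro mult_mono) auto
    then show "norm (((max 0 (q' $ k) - max 0 (q $ k)) * (a k \<bullet> x)) *\<^sub>R a k) \<le> norm (q - q') * norm x * (norm (a k))\<^sup>2"
      by (simp add: abs_mult power2_eq_square mult_ac)
  qed
  also have "\<dots> \<le> norm (q - q') * norm x * arm_bound a"
    unfolding sum_distrib_left[symmetric] by (intro mult_left_mono arm_bound) auto
  finally show ?thesis by (simp add: mult_ac)
qed

lemma prec_diff_M: "norm ((prec a M' q - prec a M q) *v x) \<le> norm (M' - M) * norm x"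
proof -
  have "prec a M' q - prec a M q = M' - M" by (simp add: prec_def)
  then show ?thesis by (simp add: norm_matrix_vector_le)
qed

lemma inner_arm_le: "norm y \<le> D \<Longrightarrow> \<bar>a k \<bullet> y\<bar> \<le> arm_bound a * D"
  by (rule order_trans[OF Cauchy_Schwarz_ineq2]) (intro mult_mono arm_bound, auto simp: order_trans[OF _ arm_bound(1)])

lemma drift_growth:
  assumes M: "coercive l M" "0 < l" and \<alpha>: "norm \<alpha> \<le> Ab"
  shows "\<bar>drift a M \<alpha> k s q\<bar> \<le> arm_bound a * (Ab + arm_bound a) / l * (1 + norm s)"
proof -
  note P = coercive_prec[OF M(1), of a q]
  have Ab: "0 \<le> Ab" using \<alpha> norm_ge_zero[of \<alpha>] by linarith
  have "norm (\<alpha> + (\<Sum>i\<in>UNIV. s $ i *\<^sub>R a i)) \<le> Ab + arm_bound a * norm s"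
    using \<alpha> norm_sum_arms[of s a] by (intro norm_triangle_mono)
  also have "\<dots> \<le> (Ab + arm_bound a) * (1 + norm s)"
    using Ab arm_bound(1)[of a] by (simp add: algebra_simps add_increasing)
  finally have "norm (matrix_inv (prec a M q) *v (\<alpha> + (\<Sum>i\<in>UNIV. s $ i *\<^sub>R a i))) \<le> (Ab + arm_bound a) * (1 + norm s) / l"
    using M(2) by (intro order_trans[OF coercive_norm_inv[OF P M(2)]] divide_right_mono) auto
  from inner_arm_le[OF this, of a k] show ?thesis by (simp add: drift_def)
qed

lemma drift_lip_s:
  assumes M: "coercive l M" "0 < l"
  shows "\<bar>drift a M \<alpha> k s q - drift a M \<alpha> k s' q\<bar> \<le> arm_bound a * arm_bound a / l * norm (s - s')"
proof -
  note P = coercive_prec[OF M(1), of a q]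
  have "drift a M \<alpha> k s q - drift a M \<alpha> k s' q = a k \<bullet> (matrix_inv (prec a M q) *v (\<Sum>i\<in>UNIV. (s - s') $ i *\<^sub>R a i))"
    by (simp add: drift_def scaleR_left_diff_distrib sum_subtractf matrix_vector_right_distrib matrix_vector_mult_diff_distrib inner_diff_right inner_add_right)
  moreover have "norm (matrix_inv (prec a M q) *v (\<Sum>i\<in>UNIV. (s - s') $ i *\<^sub>R a i)) \<le> arm_bound a * norm (s - s') / l"
    using M(2) by (intro order_trans[OF coercive_norm_inv[OF P M(2)]] divide_right_mono norm_sum_arms) auto
  ultimately show ?thesis using inner_arm_le[of "matrix_inv (prec a M q) *v (\<Sum>i\<in>UNIV. (s - s') $ i *\<^sub>R a i)" _ a k] by fastforce
qed

lemma drift_lip_q: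
  assumes M: "coercive l M" "0 < l" and \<alpha>: "norm \<alpha> \<le> Ab"
  shows "\<bar>drift a M \<alpha> k s q - drift a M \<alpha> k s q'\<bar> \<le> arm_bound a * arm_bound a * (Ab + arm_bound a) / l\<^sup>2 * (1 + norm s) * norm (q - q')"
proof -
  have Ab: "0 \<le> Ab" using \<alpha> norm_ge_zero[of \<alpha>] by linarith
  let ?y = "\<alpha> + (\<Sum>i\<in>UNIV. s $ i *\<^sub>R a i)"
  have y: "norm ?y \<le> (Ab + arm_bound a) * (1 + norm s)"
  proof -
    have "norm ?y \<le> Ab + arm_bound a * norm s" using \<alpha> norm_sum_arms[of s a] by (intro norm_triangle_mono)
    also have "\<dots> \<le> (Ab + arm_bound a) * (1 + norm s)"
      using Ab arm_bound(1)[of a] by (simp add: algebra_simps add_increasing)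
    finally show ?thesis .
  qed
  have D: "0 \<le> arm_bound a * norm (q - q')" using arm_bound(1)[of a] by simp
  have "norm (matrix_inv (prec a M q) *v ?y - matrix_inv (prec a M q') *v ?y) \<le> arm_bound a * norm (q - q') * norm ?y / l\<^sup>2"
    by (rule coercive_inv_diff[OF coercive_prec[OF M(1)] M(2) coercive_prec[OF M(1)] prec_diff_q D])
  also have "\<dots> \<le> arm_bound a * norm (q - q') * ((Ab + arm_bound a) * (1 + norm s)) / l\<^sup>2"
    using y D by (intro divide_right_mono mult_left_mono) auto
  finally have "norm (matrix_inv (prec a M q) *v ?y - matrix_inv (prec a M q') *v ?y) \<le> arm_bound a * norm (q - q') * ((Ab + arm_bound a) * (1 + norm s)) / l\<^sup>2" .
  from inner_arm_le[OF this, of a k] show ?thesis by (simp add: drift_def inner_diff_right mult_ac)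
qed

lemma drift_lim:
  assumes M: "coercive l M" "0 < l" and M': "coercive l M'" and \<alpha>: "norm \<alpha>' \<le> Ab"
  shows "\<bar>drift a M \<alpha> k s q - drift a M' \<alpha>' k s q\<bar>
    \<le> (arm_bound a / l * norm (\<alpha> - \<alpha>') + arm_bound a * (Ab + arm_bound a) / l\<^sup>2 * norm (M - M')) * (1 + norm s)"
proof -
  have Ab: "0 \<le> Ab" using \<alpha> norm_ge_zero[of \<alpha>'] by linarith
  let ?y = "\<alpha> + (\<Sum>i\<in>UNIV. s $ i *\<^sub>R a i)" and ?y' = "\<alpha>' + (\<Sum>i\<in>UNIV. s $ i *\<^sub>R a i)"
  let ?A = "matrix_inv (prec a M q)" and ?B = "matrix_inv (prec a M' q)"
  have y: "norm ?y' \<le> (Ab + arm_bound a) * (1 + norm s)"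
  proof -
    have "norm ?y' \<le> Ab + arm_bound a * norm s" using \<alpha> norm_sum_arms[of s a] by (intro norm_triangle_mono)
    also have "\<dots> \<le> (Ab + arm_bound a) * (1 + norm s)"
      using Ab arm_bound(1)[of a] by (simp add: algebra_simps add_increasing)
    finally show ?thesis .
  qed
  have 1: "norm (?A *v (\<alpha> - \<alpha>')) \<le> norm (\<alpha> - \<alpha>') / l"
    by (rule coercive_norm_inv[OF coercive_prec[OF M(1)] M(2)])
  also have "\<dots> = norm (\<alpha> - \<alpha>') / l * 1" by simp
  also have "\<dots> \<le> norm (\<alpha> - \<alpha>') / l * (1 + norm s)" using M(2) by (intro mult_left_mono) auto
  finally have 1: "norm (?A *v (\<alpha> - \<alpha>')) \<le> norm (\<alpha> - \<alpha>') / l * (1 + norm s)" .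
  have "norm (?A *v ?y' - ?B *v ?y') \<le> norm (M - M') * norm ?y' / l\<^sup>2"
    using prec_diff_M[of a M' q M] by (intro coercive_inv_diff[OF coercive_prec[OF M(1)] M(2) coercive_prec[OF M']]) (auto simp: norm_minus_commute)
  also have "\<dots> \<le> norm (M - M') * ((Ab + arm_bound a) * (1 + norm s)) / l\<^sup>2"
    using y by (intro divide_right_mono mult_left_mono) auto
  finally have 2: "norm (?A *v ?y' - ?B *v ?y') \<le> norm (M - M') * ((Ab + arm_bound a) * (1 + norm s)) / l\<^sup>2" .
  have "?A *v ?y - ?B *v ?y' = ?A *v (\<alpha> - \<alpha>') + (?A *v ?y' - ?B *v ?y')"
    by (simp add: matrix_vector_right_distrib matrix_vector_mult_diff_distrib)
  then have "norm (?A *v ?y - ?B *v ?y') \<le> norm (\<alpha> - \<alpha>') / l * (1 + norm s) + norm (M - M') * ((Ab + arm_bound a) * (1 + norm s)) / l\<^sup>2"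
    using norm_triangle_mono[OF 1 2] by (simp only:)
  from inner_arm_le[OF this, of a k] show ?thesis by (simp add: drift_def inner_diff_right algebra_simps)
qed

lemma spread_arg:
  assumes M: "coercive l M" "0 < l"
  shows "0 \<le> a k \<bullet> (matrix_inv (prec a M q) *v a k)"
    "a k \<bullet> (matrix_inv (prec a M q) *v a k) \<le> arm_bound a * arm_bound a / l"
    "\<bar>a k \<bullet> (matrix_inv (prec a M q) *v a k) - a k \<bullet> (matrix_inv (prec a M q') *v a k)\<bar>
      \<le> arm_bound a * arm_bound a * arm_bound a / l\<^sup>2 * norm (q - q')"
proof -
  show "0 \<le> a k \<bullet> (matrix_inv (prec a M q) *v a k)" by (rule coercive_inv_nonneg[OF coercive_prec[OF M(1)] M(2)])
  have "norm (matrix_inv (prec a M q) *v a k) \<le> arm_bound a / l"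
    using M(2) by (intro order_trans[OF coercive_norm_inv[OF coercive_prec[OF M(1)] M(2)]] divide_right_mono arm_bound) auto
  from inner_arm_le[OF this, of a k]
  show "a k \<bullet> (matrix_inv (prec a M q) *v a k) \<le> arm_bound a * arm_bound a / l" by simp
  have D: "0 \<le> arm_bound a * norm (q - q')" using arm_bound(1)[of a] by simp
  have "norm (matrix_inv (prec a M q) *v a k - matrix_inv (prec a M q') *v a k) \<le> arm_bound a * norm (q - q') * norm (a k) / l\<^sup>2"
    by (rule coercive_inv_diff[OF coercive_prec[OF M(1)] M(2) coercive_prec[OF M(1)] prec_diff_q D])
  also have "\<dots> \<le> arm_bound a * norm (q - q') * arm_bound a / l\<^sup>2"
    using arm_bound(2)[of a k] D by (intro divide_right_mono mult_left_mono) auto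
  finally have "norm (matrix_inv (prec a M q) *v a k - matrix_inv (prec a M q') *v a k) \<le> arm_bound a * norm (q - q') * arm_bound a / l\<^sup>2" .
  from inner_arm_le[OF this, of a k]
  show "\<bar>a k \<bullet> (matrix_inv (prec a M q) *v a k) - a k \<bullet> (matrix_inv (prec a M q') *v a k)\<bar>
      \<le> arm_bound a * arm_bound a * arm_bound a / l\<^sup>2 * norm (q - q')"
    by (simp add: inner_diff_right mult_ac)
qed

lemma abs_sqrt_diff_le: "1 \<le> x \<Longrightarrow> 1 \<le> y \<Longrightarrow> \<bar>sqrt x - sqrt y\<bar> \<le> \<bar>x - y\<bar>"
proof -
  assume x: "1 \<le> x" and y: "1 \<le> y"
  have "x - y = (sqrt x - sqrt y) * (sqrt x + sqrt y)" using x y by (simp add: algebra_simps)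
  then have "\<bar>x - y\<bar> = \<bar>sqrt x - sqrt y\<bar> * (sqrt x + sqrt y)" using x y by (simp add: abs_mult)
  moreover have "1 \<le> sqrt x + sqrt y" using x y real_sqrt_ge_one[OF x] real_sqrt_ge_zero[of y] by linarith
  then have "\<bar>sqrt x - sqrt y\<bar> * 1 \<le> \<bar>sqrt x - sqrt y\<bar> * (sqrt x + sqrt y)" by (intro mult_left_mono) auto
  ultimately show ?thesis by simp
qed

text \<open>All bounds rest on one coercivity constant, valid from \<open>n1\<close> on and, by
  \<open>coercive_prec\<close>, for every \<open>q\<close>. The convergent sequences supply the
  bounds \<open>Ab\<close> and \<open>S\<close>, and \<open>C\<close> is the sum of the individual
  constants.\<close>

lemma bandit_limit_coefficients:
  fixes a :: "'k::finite \<Rightarrow> real^'d"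
  assumes M: "M \<longlonglongrightarrow> M0" "invertible M0" "\<And>n. 1 \<le> n \<Longrightarrow> sym_pos_def (M n)"
    and \<alpha>: "\<alpha> \<longlonglongrightarrow> \<alpha>0" and \<sigma>: "\<sigma> \<longlonglongrightarrow> \<sigma>0"
  shows "\<exists>C n0 \<gamma>. bandit_limit (\<lambda>n. drift a (M n) (\<alpha> n)) (\<lambda>n. spread a (M n) (\<sigma> n) n) C n0 (drift a M0 \<alpha>0) \<sigma>0 \<gamma>"
proof -
  obtain l where l: "0 < l" "coercive l M0" and ev: "\<forall>\<^sub>F n in sequentially. coercive l (M n)"
    using coercive_limit[OF M] by blast
  obtain n1 where n1: "\<And>n. n1 \<le> n \<Longrightarrow> coercive l (M n)" using ev unfolding eventually_sequentially by blast
  obtain Ab where Ab: "\<And>n. norm (\<alpha> n) \<le> Ab" using convergent_imp_Bseq[of \<alpha>] \<alpha> unfolding Bseq_def convergent_def by blast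
  have Ab0: "norm \<alpha>0 \<le> Ab" by (rule tendsto_upperbound[OF tendsto_norm[OF \<alpha>]]) (auto simp: Ab)
  obtain S where S: "\<And>n. \<bar>\<sigma> n\<bar> \<le> S" using convergent_imp_Bseq[of \<sigma>] \<sigma> unfolding Bseq_def convergent_def by auto
  have S0: "0 \<le> S" using S[of 0] by linarith
  have Abp: "0 \<le> Ab" using Ab[of 0] norm_ge_zero order_trans by blast
  let ?A = "arm_bound a"
  have A: "1 \<le> ?A" by (rule arm_bound)
  define c1 where "c1 = ?A * (Ab + ?A) / l"
  define c2 where "c2 = ?A * ?A / l"
  define c3 where "c3 = ?A * ?A * (Ab + ?A) / l\<^sup>2"
  define c4 where "c4 = S * (1 + c2)"
  define c5 where "c5 = S * (?A * ?A * ?A / l\<^sup>2)"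
  have c: "0 \<le> c1" "0 \<le> c2" "0 \<le> c3" "0 \<le> c4" "0 \<le> c5"
    using A Abp S0 l by (auto simp: c1_def c2_def c3_def c4_def c5_def)
  define C where "C = 1 + c1 + c2 + c3 + c4 + c5"
  \<comment> \<open>The last term bounds the posterior variance, a fraction of at most
    \<open>c2 / n\<close> of the noise variance. It vanishes in the limit, which is why the limit
    diffusion coefficient is constant.\<close>
  define \<gamma> where "\<gamma> n = (?A / l * norm (\<alpha> n - \<alpha>0) + ?A * (Ab + ?A) / l\<^sup>2 * norm (M n - M0)) + (\<bar>(\<sigma> n)\<^sup>2 - \<sigma>0\<^sup>2\<bar> + S\<^sup>2 * c2 * (1 / real n))" for n
  have g1: "0 \<le> ?A / l * norm (\<alpha> n - \<alpha>0) + ?A * (Ab + ?A) / l\<^sup>2 * norm (M n - M0)" for n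
    using A Abp l by (intro add_nonneg_nonneg mult_nonneg_nonneg divide_nonneg_pos) auto
  have g2: "0 \<le> \<bar>(\<sigma> n)\<^sup>2 - \<sigma>0\<^sup>2\<bar> + S\<^sup>2 * c2 * (1 / real n)" for n using c by simp
  have up: "c' * x \<le> C * x" if "c' \<in> {c1, c2, c3, c4, c5}" "0 \<le> x" for c' x
    using that c by (intro mult_right_mono) (auto simp: C_def)
  have bandit: "bandit_limit (\<lambda>n. drift a (M n) (\<alpha> n)) (\<lambda>n. spread a (M n) (\<sigma> n) n) C (max 1 n1) (drift a M0 \<alpha>0) \<sigma>0 \<gamma>"
  proof
    show "1 \<le> C" using c by (simp add: C_def)
    show "1 \<le> max 1 n1" by simp
    have "\<gamma> \<longlonglongrightarrow> (?A / l * norm (\<alpha>0 - \<alpha>0) + ?A * (Ab + ?A) / l\<^sup>2 * norm (M0 - M0)) + (\<bar>\<sigma>0\<^sup>2 - \<sigma>0\<^sup>2\<bar> + S\<^sup>2 * c2 * 0)"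
      unfolding \<gamma>_def by (intro tendsto_intros \<alpha> \<sigma> M(1) lim_1_over_n)
    then show "\<gamma> \<longlonglongrightarrow> 0" by simp
  next
    fix n k s s' q q' assume "max 1 n1 \<le> n"
    then have n: "1 \<le> real n" and co: "coercive l (M n)" using n1 by auto
    show "\<bar>drift a (M n) (\<alpha> n) k s q\<bar> \<le> C * (1 + norm s)"
      using drift_growth[OF co l(1) Ab[of n], of a k s q] up[of c1 "1 + norm s"] by (simp add: c1_def)
    show "\<bar>drift a (M n) (\<alpha> n) k s q - drift a (M n) (\<alpha> n) k s' q\<bar> \<le> C * norm (s - s')"
      using drift_lip_s[OF co l(1), of a "\<alpha> n" k s q s'] up[of c2 "norm (s - s')"] by (simp add: c2_def)
    show "\<bar>drift a (M n) (\<alpha> n) k s q - drift a (M n) (\<alpha> n) k s q'\<bar> \<le> C * (1 + norm s) * norm (q - q')"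
      using drift_lip_q[OF co l(1) Ab[of n], of a k s q q'] up[of c3 "(1 + norm s) * norm (q - q')"] by (simp add: c3_def mult.assoc)
    have "\<bar>drift a (M n) (\<alpha> n) k s q - drift a M0 \<alpha>0 k s q\<bar> \<le> (?A / l * norm (\<alpha> n - \<alpha>0) + ?A * (Ab + ?A) / l\<^sup>2 * norm (M n - M0)) * (1 + norm s)"
      by (rule drift_lim[OF co l(1) l(2) Ab0])
    also have "\<dots> \<le> \<gamma> n * (1 + norm s)" unfolding \<gamma>_def using g2[of n] by (intro mult_right_mono) auto
    finally show "\<bar>drift a (M n) (\<alpha> n) k s q - drift a M0 \<alpha>0 k s q\<bar> \<le> \<gamma> n * (1 + norm s)" .
    let ?w = "\<lambda>q. a k \<bullet> (matrix_inv (prec a (M n) q) *v a k)"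
    note w = spread_arg[OF co l(1), of a k, folded c2_def]
    have w1: "1 \<le> 1 + ?w q / real n" for q using w(1)[of q] n by simp
    have wn: "?w q / real n \<le> c2 / 1" using w(2)[of q] w(1)[of q] n c by (intro frac_le) auto
    have sw: "sqrt (1 + ?w q / real n) \<le> 1 + c2"
    proof -
      have "sqrt (1 + ?w q / real n) \<le> 1 + ?w q / real n"
        using w1[of q] self_le_power[OF w1[of q], of 2] by (intro real_le_lsqrt) auto
      then show ?thesis using wn by simp
    qed
    show "\<bar>spread a (M n) (\<sigma> n) n k q\<bar> \<le> C"
    proof -
      have "\<bar>spread a (M n) (\<sigma> n) n k q\<bar> \<le> S * (1 + c2)"
        unfolding spread_def abs_mult using S[of n] sw S0 w1[of q] by (intro mult_mono) auto
      then show ?thesis using up[of c4 1] by (simp add: c4_def)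
    qed
    show "\<bar>spread a (M n) (\<sigma> n) n k q - spread a (M n) (\<sigma> n) n k q'\<bar> \<le> C * norm (q - q') / real n"
    proof -
      have "\<bar>sqrt (1 + ?w q / real n) - sqrt (1 + ?w q' / real n)\<bar> \<le> \<bar>(1 + ?w q / real n) - (1 + ?w q' / real n)\<bar>"
        by (rule abs_sqrt_diff_le[OF w1 w1])
      also have "\<dots> = \<bar>?w q - ?w q'\<bar> / real n" by (simp add: abs_divide flip: diff_divide_distrib)
      also have "\<dots> \<le> (?A * ?A * ?A / l\<^sup>2 * norm (q - q')) / real n" by (intro divide_right_mono w(3)) simp
      finally have "\<bar>sqrt (1 + ?w q / real n) - sqrt (1 + ?w q' / real n)\<bar> \<le> (?A * ?A * ?A / l\<^sup>2 * norm (q - q')) / real n" .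
      then have "\<bar>\<sigma> n\<bar> * \<bar>sqrt (1 + ?w q / real n) - sqrt (1 + ?w q' / real n)\<bar> \<le> S * ((?A * ?A * ?A / l\<^sup>2 * norm (q - q')) / real n)"
        using S[of n] S0 by (intro mult_mono) auto
      also have "\<dots> = (c5 * norm (q - q')) / real n" by (simp add: c5_def)
      also have "\<dots> \<le> (C * norm (q - q')) / real n" using up[of c5 "norm (q - q')"] by (intro divide_right_mono) auto
      finally show ?thesis unfolding spread_def by (simp add: abs_mult flip: right_diff_distrib)
    qed
    show "\<bar>(spread a (M n) (\<sigma> n) n k q)\<^sup>2 - \<sigma>0\<^sup>2\<bar> \<le> \<gamma> n"
    proof -
      have "(spread a (M n) (\<sigma> n) n k q)\<^sup>2 = (\<sigma> n)\<^sup>2 + (\<sigma> n)\<^sup>2 * (?w q / real n)"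
        using w1[of q] by (simp add: spread_def power_mult_distrib distrib_left)
      moreover have "(\<sigma> n)\<^sup>2 * (?w q / real n) \<le> S\<^sup>2 * (c2 * (1 / real n))"
      proof (intro mult_mono)
        have "\<bar>\<sigma> n\<bar>\<^sup>2 \<le> S\<^sup>2" using S[of n] by (intro power_mono) auto
        then show "(\<sigma> n)\<^sup>2 \<le> S\<^sup>2" by simp
        show "?w q / real n \<le> c2 * (1 / real n)" using w(2)[of q] n by (simp add: divide_right_mono)
      qed (use w(1)[of q] in auto)
      moreover have "0 \<le> (\<sigma> n)\<^sup>2 * (?w q / real n)" using w(1)[of q] by simp
      ultimately show ?thesis using g1[of n] unfolding \<gamma>_def mult.assoc by linarith
    qed
  qed
  then show ?thesis by blast
qed

subsection \<open>The bandit recursion in rescaled variables\<close>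

lemma sym_pos_def_prec:
  assumes M: "sym_pos_def M" shows "sym_pos_def (prec a M q)"
proof -
  have "transpose (prec a M q) = prec a M q"
    using M transpose_outer
    by (simp add: sym_pos_def_def prec_def vec_eq_iff transpose_def outer_def mult.commute)
  moreover have "0 < x \<bullet> (prec a M q *v x)" if "x \<noteq> 0" for x
  proof -
    have "x \<bullet> (\<Sum>k\<in>UNIV. (max 0 (q $ k) * (a k \<bullet> x)) *\<^sub>R a k) = (\<Sum>k\<in>UNIV. max 0 (q $ k) * (a k \<bullet> x)\<^sup>2)"
      by (simp add: inner_sum_right inner_commute[of x] power2_eq_square mult.assoc)
    also have "\<dots> \<ge> 0" by (intro sum_nonneg) auto
    finally show ?thesis using M that by (simp add: prec_mult_vector inner_add_right sym_pos_def_def add_pos_nonneg)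
  qed
  ultimately show ?thesis by (simp add: sym_pos_def_def)
qed

lemma sym_pos_def_scaleR: "sym_pos_def M \<Longrightarrow> 0 < c \<Longrightarrow> sym_pos_def (c *\<^sub>R M)"
  by (auto simp: sym_pos_def_def transpose_scalar scaleR_matrix_vector_mult)

text \<open>The posterior precision is \<open>n / \<sigma>^2\<close> times
  \<open>prec a M qh\<close>; counts are nonnegative, so the positive part in \<open>prec\<close>
  has no effect. \<open>M\<close> and \<open>\<beta>\<close> are the rescaled prior precision and
  the rescaled product of precision and prior mean, exactly the quantities whose limits the theorem
  prescribes.\<close>

lemma posterior_rescaled:
  fixes a :: "'k::finite \<Rightarrow> real^'d" and \<alpha> :: "real^'d" and q :: "nat^'k"
  assumes \<sigma>: "0 < \<sigma>" and S: "sym_pos_def \<Sigma>" and f: "0 < f" and n: "1 \<le> n"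
  defines "M \<equiv> (\<sigma>\<^sup>2 / real n) *\<^sub>R matrix_inv \<Sigma>" and "\<beta> \<equiv> (\<sigma>\<^sup>2 / f) *\<^sub>R (matrix_inv \<Sigma> *v \<alpha>)"
    and "qh \<equiv> \<chi> k. real (q $ k) / real n"
  shows "sym_pos_def (posterior_cov a \<sigma> \<Sigma> q)"
    and "a k \<bullet> posterior_mean a \<sigma> \<alpha> \<Sigma> s q = f * (drift a M \<beta> k ((1 / f) *\<^sub>R s) qh / real n)"
    and "sqrt (a k \<bullet> (posterior_cov a \<sigma> \<Sigma> q *v a k) + \<sigma>\<^sup>2) = f * (spread a M (sqrt (real n) / f * \<sigma>) n k qh / sqrt (real n))"
proof -
  have SM: "sym_pos_def M" unfolding M_def using \<sigma> n by (intro sym_pos_def_scaleR sym_pos_def_matrix_inv S) auto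
  have SP: "sym_pos_def (prec a M qh)" by (rule sym_pos_def_prec[OF SM])
  have "matrix_inv \<Sigma> + (1 / \<sigma>\<^sup>2) *\<^sub>R (\<Sum>k\<in>UNIV. real (q $ k) *\<^sub>R outer (a k)) = (real n / \<sigma>\<^sup>2) *\<^sub>R prec a M qh"
    using \<sigma> n by (simp add: prec_def M_def qh_def scaleR_right_distrib scaleR_sum_right)
  then have cov: "posterior_cov a \<sigma> \<Sigma> q = (\<sigma>\<^sup>2 / real n) *\<^sub>R matrix_inv (prec a M qh)"
    unfolding posterior_cov_def using matrix_inv_scaleR[OF sym_pos_def_invertible[OF SP], of "real n / \<sigma>\<^sup>2"] \<sigma> n by simp
  show "sym_pos_def (posterior_cov a \<sigma> \<Sigma> q)"
    unfolding cov using \<sigma> n by (intro sym_pos_def_scaleR sym_pos_def_matrix_inv SP) auto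
  have "matrix_inv \<Sigma> *v \<alpha> + (1 / \<sigma>\<^sup>2) *\<^sub>R (\<Sum>k\<in>UNIV. s $ k *\<^sub>R a k) = (f / \<sigma>\<^sup>2) *\<^sub>R (\<beta> + (\<Sum>i\<in>UNIV. ((1 / f) *\<^sub>R s) $ i *\<^sub>R a i))"
    using \<sigma> f by (simp add: \<beta>_def scaleR_right_distrib scaleR_sum_right)
  then have "posterior_mean a \<sigma> \<alpha> \<Sigma> s q = (f / real n) *\<^sub>R (matrix_inv (prec a M qh) *v (\<beta> + (\<Sum>i\<in>UNIV. ((1 / f) *\<^sub>R s) $ i *\<^sub>R a i)))"
    unfolding posterior_mean_def cov using \<sigma> n by (simp add: scaleR_matrix_vector_mult matrix_vector_mult_scaleR)
  then show "a k \<bullet> posterior_mean a \<sigma> \<alpha> \<Sigma> s q = f * (drift a M \<beta> k ((1 / f) *\<^sub>R s) qh / real n)"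
    by (simp add: drift_def)
  let ?w = "a k \<bullet> (matrix_inv (prec a M qh) *v a k)"
  have "a k \<bullet> (posterior_cov a \<sigma> \<Sigma> q *v a k) + \<sigma>\<^sup>2 = \<sigma>\<^sup>2 * (1 + ?w / real n)"
    by (simp add: cov scaleR_matrix_vector_mult algebra_simps)
  then have "sqrt (a k \<bullet> (posterior_cov a \<sigma> \<Sigma> q *v a k) + \<sigma>\<^sup>2) = \<sigma> * sqrt (1 + ?w / real n)"
    using \<sigma> by (simp add: real_sqrt_mult)
  then show "sqrt (a k \<bullet> (posterior_cov a \<sigma> \<Sigma> q *v a k) + \<sigma>\<^sup>2) = f * (spread a M (sqrt (real n) / f * \<sigma>) n k qh / sqrt (real n))"
    using f n by (simp add: spread_def)
qed

text \<open>Induction on the rounds to go, \<open>Suc n - i\<close> in number because round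
  \<open>i\<close> is still to be played. \<open>integral_mvn_normal_law\<close> turns the double
  integral into one step of the scheme, with integrability from the growth bounds of
  \<open>u\<close>, and multiplication by \<open>f > 0\<close> commutes with the maximum.\<close>

lemma opt_reward_rescaled:
  fixes a :: "'k::finite \<Rightarrow> real^'d"
  assumes \<sigma>: "0 < \<sigma>" and S: "sym_pos_def \<Sigma>" and f: "0 < f" and n: "n0 \<le> n"
    and sch: "bandit_scheme \<mu> \<tau> C n0"
    and \<mu>: "\<mu> n = drift a ((\<sigma>\<^sup>2 / real n) *\<^sub>R matrix_inv \<Sigma>) ((\<sigma>\<^sup>2 / f) *\<^sub>R (matrix_inv \<Sigma> *v \<alpha>))"
    and \<tau>: "\<tau> n = spread a ((\<sigma>\<^sup>2 / real n) *\<^sub>R matrix_inv \<Sigma>) (sqrt (real n) / f * \<sigma>) n"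
  shows "opt_reward a \<sigma> \<alpha> \<Sigma> n i s q = f * bandit_scheme.u \<mu> \<tau> n (Suc n - i) ((1 / f) *\<^sub>R s) (\<chi> k. real (q $ k) / real n)"
proof -
  interpret bandit_scheme \<mu> \<tau> C n0 by (rule sch)
  have n1: "1 \<le> n" using n n0 by simp
  show ?thesis
  proof (induction "Suc n - i" arbitrary: i s q)
    case 0
    then have "n < i" by simp
    then show ?case by (subst opt_reward.simps) simp
  next
    case (Suc j)
    then have i: "i \<le> n" and j: "Suc n - i = Suc j" "j = Suc n - Suc i" by auto
    let ?sh = "(1 / f) *\<^sub>R s" and ?qh = "\<chi> k. real (q $ k) / real n"
    have k: "(\<integral>\<nu>. a k \<bullet> \<nu> \<partial>posterior a \<sigma> \<alpha> \<Sigma> s q) +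
        (\<integral>\<nu>. (\<integral>x. opt_reward a \<sigma> \<alpha> \<Sigma> n (Suc i) (s + x *\<^sub>R axis k 1) (q + axis k 1) \<partial>normal_law (a k \<bullet> \<nu>) \<sigma>) \<partial>posterior a \<sigma> \<alpha> \<Sigma> s q)
      = f * (\<mu> n k ?sh ?qh / real n + step n k (u n j) ?sh ?qh)" for k
    proof -
      note P = posterior_rescaled[OF \<sigma> S f n1, where a = a and q = q]
      let ?q' = "?qh + (1 / real n) *\<^sub>R axis k 1"
      let ?F = "\<lambda>x. f * u n j ((1 / f) *\<^sub>R (s + x *\<^sub>R axis k 1)) ?q'"
      have q': "(\<chi> i. real ((q + axis k 1) $ i) / real n) = ?q'"
        by (auto simp: vec_eq_iff axis_def add_divide_distrib)
      have IH: "opt_reward a \<sigma> \<alpha> \<Sigma> n (Suc i) (s + x *\<^sub>R axis k 1) (q + axis k 1) = ?F x" for x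
        using Suc.hyps(1)[OF j(2), of "s + x *\<^sub>R axis k 1" "q + axis k 1"] unfolding q' j(2) .
      have [measurable]: "?F \<in> borel_measurable borel"
        by (intro borel_measurable_times measurable_compose[OF _ u_measurable[OF n]]) measurable
      let ?m = "a k \<bullet> posterior_mean a \<sigma> \<alpha> \<Sigma> s q"
        and ?sd = "sqrt (a k \<bullet> (posterior_cov a \<sigma> \<Sigma> q *v a k) + \<sigma>\<^sup>2)"
      have m: "?m = f * (\<mu> n k ?sh ?qh / real n)" unfolding \<mu> by (rule P(2))
      have sd: "?sd = f * (\<tau> n k ?qh / sqrt (real n))" unfolding \<tau> by (rule P(3))
      have Fm: "?F (?m + ?sd * x) = f * u n j (move n k ?sh ?qh x) ?q'" for x
      proof -
        have "(1 / f) * (?m + ?sd * x) = incr n k ?sh ?qh x"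
          unfolding m sd incr_def using f by (simp add: distrib_left)
        then have "(1 / f) *\<^sub>R (s + (?m + ?sd * x) *\<^sub>R axis k 1) = move n k ?sh ?qh x"
          by (simp only: move_def scaleR_right_distrib scaleR_scaleR)
        then show ?thesis by (simp only:)
      qed
      have int: "integrable std_normal_distribution (\<lambda>x. ?F (?m + ?sd * x))"
        unfolding Fm by (intro integrable_mult_right u_integrable[OF n])
      have "(\<integral>\<nu>. (\<integral>x. ?F x \<partial>normal_law (a k \<bullet> \<nu>) \<sigma>) \<partial>posterior a \<sigma> \<alpha> \<Sigma> s q) = (\<integral>x. ?F (?m + ?sd * x) \<partial>std_normal_distribution)"
        unfolding posterior_def by (rule integral_mvn_normal_law[OF P(1) \<sigma> _ int]) measurable
      also have "\<dots> = f * step n k (u n j) ?sh ?qh" unfolding Fm step_def by simp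
      finally have "(\<integral>\<nu>. (\<integral>x. ?F x \<partial>normal_law (a k \<bullet> \<nu>) \<sigma>) \<partial>posterior a \<sigma> \<alpha> \<Sigma> s q) = f * step n k (u n j) ?sh ?qh" .
      moreover have "(\<integral>\<nu>. a k \<bullet> \<nu> \<partial>posterior a \<sigma> \<alpha> \<Sigma> s q) = f * (\<mu> n k ?sh ?qh / real n)"
        unfolding posterior_def by (subst integral_mvn_inner_mean[OF P(1)]) (rule m)
      ultimately show ?thesis unfolding IH by (simp add: distrib_left)
    qed
    have "mono (\<lambda>x. f * x)" using f by (auto intro: monoI mult_left_mono)
    then have Max: "f * Max (range h) = Max (range (\<lambda>k. f * h k))" for h :: "'k \<Rightarrow> real"
      by (simp add: mono_Max_commute image_image)
    have ni: "\<not> n < i" using i by simp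
    have "opt_reward a \<sigma> \<alpha> \<Sigma> n i s q = Max (range (\<lambda>k. f * (\<mu> n k ?sh ?qh / real n + step n k (u n j) ?sh ?qh)))"
      by (subst opt_reward.simps) (simp only: ni if_False k)
    also have "\<dots> = f * u n (Suc j) ?sh ?qh" by (simp only: Max u.simps)
    finally show ?case unfolding j(1) .
  qed
qed

theorem lemma5:
  fixes a :: "'k::finite \<Rightarrow> real^'d"
    and \<sigma> :: "nat \<Rightarrow> real" and \<alpha> :: "nat \<Rightarrow> real^'d" and \<Sigma> :: "nat \<Rightarrow> real^'d^'d"
    and f :: "nat \<Rightarrow> real"
    and \<alpha>h :: "real^'d" and \<Sigma>h :: "real^'d^'d" and \<sigma>h :: real
  assumes "\<And>n. n \<ge> 1 \<Longrightarrow> \<sigma> n > 0"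
    and "\<And>n. n \<ge> 1 \<Longrightarrow> sym_pos_def (\<Sigma> n)"
    and "\<And>n. n \<ge> 1 \<Longrightarrow> f n > 0"
    and "invertible \<Sigma>h"
    and "(\<lambda>n. ((\<sigma> n)\<^sup>2 / real n) *\<^sub>R matrix_inv (\<Sigma> n)) \<longlonglongrightarrow> matrix_inv \<Sigma>h"
    and "(\<lambda>n. ((\<sigma> n)\<^sup>2 / f n) *\<^sub>R (matrix_inv (\<Sigma> n) *v \<alpha> n)) \<longlonglongrightarrow> \<alpha>h"
    and "(\<lambda>n. sqrt (real n) / f n * \<sigma> n) \<longlonglongrightarrow> \<sigma>h"
  shows "rescaled_bandit_converges a \<sigma> \<alpha> \<Sigma> f (hjb_operator a \<alpha>h \<Sigma>h \<sigma>h)"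
proof -
  let ?M = "\<lambda>n. ((\<sigma> n)\<^sup>2 / real n) *\<^sub>R matrix_inv (\<Sigma> n)"
  let ?\<beta> = "\<lambda>n. ((\<sigma> n)\<^sup>2 / f n) *\<^sub>R (matrix_inv (\<Sigma> n) *v \<alpha> n)"
  let ?\<mu> = "\<lambda>n. drift a (?M n) (?\<beta> n)" and ?\<tau> = "\<lambda>n. spread a (?M n) (sqrt (real n) / f n * \<sigma> n) n"
  let ?\<mu>l = "drift a (matrix_inv \<Sigma>h) \<alpha>h"
  \<comment> \<open>\<open>coercive_limit\<close> concerns the precisions, whose limit is the
    inverse of \<open>\<Sigma>h\<close>.\<close>
  have inv: "invertible (matrix_inv \<Sigma>h)"
    using matrix_inv_left[OF assms(4)] invertible_right_inverse by blast
  have pd: "sym_pos_def (?M n)" if "1 \<le> n" for n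
    using assms(1)[OF that] that by (intro sym_pos_def_scaleR sym_pos_def_matrix_inv assms(2)) auto
  have "\<exists>C n0 \<gamma>. bandit_limit ?\<mu> ?\<tau> C n0 ?\<mu>l \<sigma>h \<gamma>"
    by (rule bandit_limit_coefficients[OF assms(5) inv _ assms(6) assms(7)]) (rule pd)
  then obtain C n0 \<gamma> where lim: "bandit_limit ?\<mu> ?\<tau> C n0 ?\<mu>l \<sigma>h \<gamma>"
    by (elim exE) (rule that)
  interpret bandit_limit ?\<mu> ?\<tau> C n0 ?\<mu>l \<sigma>h \<gamma> by (rule lim)
  let ?v = "\<lambda>z :: 'k hjb_point. vl (1 - fst z) (fst (snd z)) (snd (snd z))"
  have mu: "mu_hat a \<alpha>h \<Sigma>h s q (a k) = ?\<mu>l k s q" if "\<And>i. 0 < q $ i" for k s q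
    using that by (simp add: mu_hat_def drift_def prec_def max_absorb2 less_imp_le)
  show ?thesis unfolding rescaled_bandit_converges_def
  proof (intro exI[of _ ?v] conjI allI impI)
    show "viscosity_solution hjb_domain (hjb_operator a \<alpha>h \<Sigma>h \<sigma>h) ?v" by (rule vl_viscosity[OF mu])
    show "?v (1, s, q) = 0" for s q by (simp only: vl_0 fst_conv snd_conv diff_self)
  next
    fix t s q and i :: "nat \<Rightarrow> nat" and sn :: "nat \<Rightarrow> real^'k" and qn :: "nat \<Rightarrow> nat^'k"
    assume t: "t \<in> {0..1}" and adm: "\<forall>n\<ge>1. i n \<in> {1..n + 1} \<and> admissible_state (i n) (sn n) (qn n)"
      and ti: "(\<lambda>n. (real (i n) - 1) / real n) \<longlonglongrightarrow> t" and s: "(\<lambda>n. (1 / f n) *\<^sub>R sn n) \<longlonglongrightarrow> s"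
      and q: "(\<lambda>n. \<chi> k. real (qn n $ k) / real n) \<longlonglongrightarrow> q"
    have i: "1 \<le> i n" "i n \<le> n + 1" if "1 \<le> n" for n using adm that by simp_all
    have t01: "0 \<le> 1 - t" "1 - t \<le> 1" using t by simp_all
    have "(\<lambda>n. u n (Suc n - i n) ((1 / f n) *\<^sub>R sn n) (\<chi> k. real (qn n $ k) / real n)) \<longlonglongrightarrow> vl (1 - t) s q"
    proof (rule u_tendsto[OF _ _ t01 s q])
      \<comment> \<open>\<open>i n \<ge> 1\<close> leaves at most \<open>n\<close> rounds;
        \<open>n + 1 - i n\<close> rounds to go correspond to the time
        \<open>(i n - 1) / n\<close>.\<close>
      show "Suc n - i n \<le> n" if "1 \<le> n" for n using i[OF that] by linarith
      have "(\<lambda>n. 1 - (real (i n) - 1) / real n) \<longlonglongrightarrow> 1 - t" by (intro tendsto_intros ti)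
      moreover have "\<forall>\<^sub>F n in sequentially. 1 - (real (i n) - 1) / real n = real (Suc n - i n) / real n"
        unfolding eventually_sequentially
      proof (intro exI[of _ 1] allI impI)
        fix n :: nat assume n: "1 \<le> n"
        show "1 - (real (i n) - 1) / real n = real (Suc n - i n) / real n"
          using n i[OF n] by (simp add: of_nat_diff diff_divide_distrib add_divide_distrib)
      qed
      ultimately show "(\<lambda>n. real (Suc n - i n) / real n) \<longlonglongrightarrow> 1 - t" by (rule Lim_transform_eventually)
    qed
    moreover have "\<forall>\<^sub>F n in sequentially. u n (Suc n - i n) ((1 / f n) *\<^sub>R sn n) (\<chi> k. real (qn n $ k) / real n)
      = 1 / f n * opt_reward a (\<sigma> n) (\<alpha> n) (\<Sigma> n) n (i n) (sn n) (qn n)"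
      unfolding eventually_sequentially
    proof (intro exI[of _ n0] allI impI)
      fix n assume n: "n0 \<le> n"
      then have n1: "1 \<le> n" using n0 by simp
      show "u n (Suc n - i n) ((1 / f n) *\<^sub>R sn n) (\<chi> k. real (qn n $ k) / real n)
        = 1 / f n * opt_reward a (\<sigma> n) (\<alpha> n) (\<Sigma> n) n (i n) (sn n) (qn n)"
      proof -
        have "U = 1 / f n * (f n * U)" for U using assms(3)[OF n1] by simp
        then show ?thesis
          unfolding opt_reward_rescaled[OF assms(1)[OF n1] assms(2)[OF n1] assms(3)[OF n1] n bandit_scheme_axioms refl refl] .
      qed
    qed
    ultimately have "(\<lambda>n. 1 / f n * opt_reward a (\<sigma> n) (\<alpha> n) (\<Sigma> n) n (i n) (sn n) (qn n)) \<longlonglongrightarrow> vl (1 - t) s q"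
      by (rule Lim_transform_eventually)
    then show "(\<lambda>n. 1 / f n * opt_reward a (\<sigma> n) (\<alpha> n) (\<Sigma> n) n (i n) (sn n) (qn n)) \<longlonglongrightarrow> ?v (t, s, q)" by (simp only: fst_conv snd_conv)
  qed
qed

end
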